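(* Assume the following. (1) (Local Lipschitz) For each $R>0$ there is $C_R>0$ such that $|f(x)-f(y)|+|g(x)-g(y)|\le C_R|x-y|$ for all $x,y\in\mathbb{R}^d$ with $|x|\vee|y|\le R$. (2) There exist constants $p\ge 2$ and $K_1,K_2\ge 0$ such that $\langle x,f(x)\rangle+\frac{p-1}{2}|g(x)|^2\le K_1|x|^2+K_2$ for all $x\in\mathbb{R}^d$. (3) There exist constants $l>2$ and $K_3>0$ such that $|g(x)|^2\le K_3(1+|x|^l)$ for all $x\in\mathbb{R}^d$. (4) The timestep function $\delta:\mathbb{R}^d\to(0,\infty)$ is continuous and there is a constant $\gamma\in(0,1/3]$ such that $|f(x)|(\delta(x))^\gamma\le 1+|x|$ and $|g(x)|^2(\delta(x))^\gamma\le(1+|x|)^2$ for all $x\in\mathbb{R}^d$. Assume moreover that $p>l$ and set $\bar p=p+2-l$. Then for every $T>0$, $T$ is almost surely attainable, i.e. $\mathbb{P}(\exists\, M(\omega)\in\mathbb{N}^+ \text{ such that } t_{M(\omega)}\ge T)=1$, and the adaptive time-stepping Euler--Maruyama scheme satisfies $$\mathbb{E}\Big(\sup_{0\le t\le T}|\hat Y(t)|^{\bar p}\Big)\le C_T,$$ where $C_T$ is a finite positive constant (depending on $x_0,p,l,T$ and the constants in the hypotheses).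
   Context: $(\Omega,\mathcal{F},\mathbb{P})$ is a complete probability space with a filtration $\{\mathcal{F}_t\}_{t\ge0}$ satisfying the usual conditions, and $W$ is an $m$-dimensional Brownian motion with respect to it. $f:\mathbb{R}^d\to\mathbb{R}^d$, $g:\mathbb{R}^d\to\mathbb{R}^{d\times m}$ are the coefficients of the SDE $dX(t)=f(X(t))dt+g(X(t))dW(t)$, $X(0)=x_0\in\mathbb{R}^d$. $|\cdot|$ is the Euclidean norm on $\mathbb{R}^d$ and the Frobenius norm on $\mathbb{R}^{d\times m}$; $a\vee b=\max\{a,b\}$. Adaptive time-stepping Euler--Maruyama scheme with timestep function $\delta$: $t_0=0$, $Y_{t_0}=x_0$, and for $n\ge0$, $\delta_n=\delta(Y_{t_n})$, $t_{n+1}=t_n+\delta_n$, $Y_{t_{n+1}}=Y_{t_n}+f(Y_{t_n})\delta_n+g(Y_{t_n})(W(t_{n+1})-W(t_n))$. For $t\ge0$ (with $t<\sup_n t_n$) put $\underline{t}=\max\{t_n:t_n\le t\}$ and $\hat Y(t)=Y_{\underline t}+f(Y_{\underline t})(t-\underline t)+g(Y_{\underline t})(W(t)-W(\underline t))$. *)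

theory Defs
  imports "HOL-Probability.Probability"
begin

text \<open>Processes and filtrations have real index; only indices \<open>t \<ge> 0\<close> are ever constrained or used.\<close>

definition usual_conditions :: "'w measure \<Rightarrow> (real \<Rightarrow> 'w measure) \<Rightarrow> bool" where
  "usual_conditions M F \<longleftrightarrow>
     prob_space M \<and> complete_measure M \<and>
     (\<forall>t\<ge>0. subalgebra M (F t)) \<and>
     (\<forall>s t. 0 \<le> s \<and> s \<le> t \<longrightarrow> sets (F s) \<subseteq> sets (F t)) \<and>
     (\<forall>t\<ge>0. sets (F t) = (\<Inter>s\<in>{t<..}. sets (F s))) \<and>
     null_sets M \<subseteq> sets (F 0)"

definition brownian_motion ::
  "'w measure \<Rightarrow> (real \<Rightarrow> 'w measure) \<Rightarrow> (real \<Rightarrow> 'w \<Rightarrow> real ^ 'm) \<Rightarrow> bool" where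
  "brownian_motion M F W \<longleftrightarrow>
     (\<forall>t\<ge>0. W t \<in> borel_measurable (F t)) \<and>
     (AE \<omega> in M. W 0 \<omega> = 0) \<and>
     (AE \<omega> in M. continuous_on {0..} (\<lambda>t. W t \<omega>)) \<and>
     (\<forall>s t. 0 \<le> s \<and> s < t \<longrightarrow>
        prob_space.indep_set M (sets (F s))
          (sets (vimage_algebra (space M) (\<lambda>\<omega>. W t \<omega> - W s \<omega>) borel)) \<and>
        prob_space.indep_vars M (\<lambda>_. borel) (\<lambda>i \<omega>. (W t \<omega> - W s \<omega>) $ i) UNIV \<and>
        (\<forall>i. distributed M lborel (\<lambda>\<omega>. (W t \<omega> - W s \<omega>) $ i)
               (\<lambda>x. ennreal (normal_density 0 (sqrt (t - s)) x))))"

text \<open>The scheme is defined pathwise: \<open>w\<close> is one path \<open>\<lambda>t. W t \<omega>\<close> of the driving process,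
  and \<open>em_state f g \<delta> x0 w n\<close> is the pair of \<open>t\<^sub>n\<close> and \<open>Y\<close> at time \<open>t\<^sub>n\<close>.\<close>

primrec em_state ::
  "(real ^ 'd \<Rightarrow> real ^ 'd) \<Rightarrow> (real ^ 'd \<Rightarrow> real ^ 'm ^ 'd) \<Rightarrow> (real ^ 'd \<Rightarrow> real) \<Rightarrow> real ^ 'd \<Rightarrow>
   (real \<Rightarrow> real ^ 'm) \<Rightarrow> nat \<Rightarrow> real \<times> (real ^ 'd)" where
  "em_state f g \<delta> x0 w 0 = (0, x0)"
| "em_state f g \<delta> x0 w (Suc n) =
     (let (t, y) = em_state f g \<delta> x0 w n; t' = t + \<delta> y
      in (t', y + \<delta> y *\<^sub>R f y + g y *v (w t' - w t)))"

definition em_time ::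
  "(real ^ 'd \<Rightarrow> real ^ 'd) \<Rightarrow> (real ^ 'd \<Rightarrow> real ^ 'm ^ 'd) \<Rightarrow> (real ^ 'd \<Rightarrow> real) \<Rightarrow> real ^ 'd \<Rightarrow>
   (real \<Rightarrow> real ^ 'm) \<Rightarrow> nat \<Rightarrow> real" where
  "em_time f g \<delta> x0 w n = fst (em_state f g \<delta> x0 w n)"

definition em_val ::
  "(real ^ 'd \<Rightarrow> real ^ 'd) \<Rightarrow> (real ^ 'd \<Rightarrow> real ^ 'm ^ 'd) \<Rightarrow> (real ^ 'd \<Rightarrow> real) \<Rightarrow> real ^ 'd \<Rightarrow>
   (real \<Rightarrow> real ^ 'm) \<Rightarrow> nat \<Rightarrow> real ^ 'd" where
  "em_val f g \<delta> x0 w n = snd (em_state f g \<delta> x0 w n)"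

text \<open>For \<open>\<delta> > 0\<close> the grid times are strictly increasing, so the index in \<open>em_index\<close> is unique.
  \<open>em_floor\<close>, \<open>em_index\<close> and \<open>em_interp\<close> are meaningful only for
  \<open>0 \<le> t < (SUP n. em_time f g \<delta> x0 w n)\<close>; otherwise the set under \<open>Max\<close> is infinite or empty
  and the values are unspecified.\<close>

definition em_floor ::
  "(real ^ 'd \<Rightarrow> real ^ 'd) \<Rightarrow> (real ^ 'd \<Rightarrow> real ^ 'm ^ 'd) \<Rightarrow> (real ^ 'd \<Rightarrow> real) \<Rightarrow> real ^ 'd \<Rightarrow>
   (real \<Rightarrow> real ^ 'm) \<Rightarrow> real \<Rightarrow> real" where
  "em_floor f g \<delta> x0 w t = Max {em_time f g \<delta> x0 w n | n. em_time f g \<delta> x0 w n \<le> t}"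

definition em_index ::
  "(real ^ 'd \<Rightarrow> real ^ 'd) \<Rightarrow> (real ^ 'd \<Rightarrow> real ^ 'm ^ 'd) \<Rightarrow> (real ^ 'd \<Rightarrow> real) \<Rightarrow> real ^ 'd \<Rightarrow>
   (real \<Rightarrow> real ^ 'm) \<Rightarrow> real \<Rightarrow> nat" where
  "em_index f g \<delta> x0 w t = (THE n. em_time f g \<delta> x0 w n = em_floor f g \<delta> x0 w t)"

definition em_interp ::
  "(real ^ 'd \<Rightarrow> real ^ 'd) \<Rightarrow> (real ^ 'd \<Rightarrow> real ^ 'm ^ 'd) \<Rightarrow> (real ^ 'd \<Rightarrow> real) \<Rightarrow> real ^ 'd \<Rightarrow>
   (real \<Rightarrow> real ^ 'm) \<Rightarrow> real \<Rightarrow> real ^ 'd" where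
  "em_interp f g \<delta> x0 w t =
     (let s = em_floor f g \<delta> x0 w t; y = em_val f g \<delta> x0 w (em_index f g \<delta> x0 w t)
      in y + (t - s) *\<^sub>R f y + g y *v (w t - w s))"

definition as_attainable ::
  "'w measure \<Rightarrow> (real ^ 'd \<Rightarrow> real ^ 'd) \<Rightarrow> (real ^ 'd \<Rightarrow> real ^ 'm ^ 'd) \<Rightarrow> (real ^ 'd \<Rightarrow> real) \<Rightarrow>
   real ^ 'd \<Rightarrow> (real \<Rightarrow> 'w \<Rightarrow> real ^ 'm) \<Rightarrow> real \<Rightarrow> bool" where
  "as_attainable M f g \<delta> x0 W T \<longleftrightarrow>
     measure M {\<omega> \<in> space M. \<exists>k>0. em_time f g \<delta> x0 (\<lambda>t. W t \<omega>) k \<ge> T} = 1"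

text \<open>Valued in \<open>ennreal\<close>, so that the supremum over a possibly unbounded path is meaningful.\<close>

definition em_sup_pow ::
  "(real ^ 'd \<Rightarrow> real ^ 'd) \<Rightarrow> (real ^ 'd \<Rightarrow> real ^ 'm ^ 'd) \<Rightarrow> (real ^ 'd \<Rightarrow> real) \<Rightarrow> real ^ 'd \<Rightarrow>
   (real \<Rightarrow> 'w \<Rightarrow> real ^ 'm) \<Rightarrow> real \<Rightarrow> real \<Rightarrow> 'w \<Rightarrow> ennreal" where
  "em_sup_pow f g \<delta> x0 W T q \<omega> =
     (SUP t\<in>{0..T}. ennreal (norm (em_interp f g \<delta> x0 (\<lambda>t. W t \<omega>) t) powr q))"

end

theory Submission
  imports Defs
begin

text \<open>
  Write \<open>lyap a y = (1 + |y|\<^sup>2) powr (a / 2)\<close> and \<open>q = p + 2 - l\<close>, so that \<open>2 < q < p\<close>. The whole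
  argument takes place at the grid points, where the scheme is a Markov chain: given the past, a
  step of length \<open>h\<close> from \<open>y\<close> leads to \<open>y' = y + h f y + sqrt h (g y z)\<close> with a standard
  Gaussian vector \<open>z\<close>.

  One step. Put \<open>u = (|y'|\<^sup>2 - |y|\<^sup>2) / (1 + |y|\<^sup>2)\<close>. Then
  \<open>lyap a y' = lyap a y * (1 + u) powr (a / 2)\<close>, so that a Taylor expansion of a power of a real
  number replaces the Ito formula. The terms of order one and two reproduce the generator, and
  the monotonicity condition bounds them by a multiple of \<open>h * lyap a y\<close> for all \<open>a \<le> p\<close>. The
  remainder consists of powers at least three of \<open>|y' - y| / sqrt (1 + |y|\<^sup>2)\<close>, and the
  condition on the timestep with \<open>\<gamma> \<le> 1/3\<close> implies that this ratio is \<open>O(h powr (1/3))\<close>, hence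
  that the remainder is \<open>O(h)\<close> (\<open>lyap_growth\<close>). With the growth bound on \<open>g\<close>, the variance of
  \<open>lyap (q / 2) y'\<close> is at most a multiple of \<open>h * lyap p y\<close>, because \<open>q - 2 + l = p\<close>
  (\<open>lyap_fluctuation\<close>).

  Grid points. Stop the scheme at \<open>T\<close> by shortening the step that would pass \<open>T\<close>. The one-step
  bound makes \<open>exp (- c S\<^sub>n) * lyap p X\<^sub>n\<close> a supermartingale that loses a fixed fraction of
  \<open>H\<^sub>n * lyap p X\<^sub>n\<close> at each step, so \<open>E (\<Sum>n. H\<^sub>n * lyap p X\<^sub>n)\<close> is bounded no matter how many
  steps there are (\<open>occupation_le\<close>). Decompose \<open>lyap (q / 2) X\<^sub>n\<close> into a compensator, bounded
  above by \<open>C * (\<Sum>i<n. H\<^sub>i * lyap (q / 2) X\<^sub>i)\<close>, and a martingale whose squared increments have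
  total expectation at most \<open>C * E (\<Sum>n. H\<^sub>n * lyap p X\<^sub>n)\<close>. Doob's inequality in \<open>L\<^sup>2\<close> then
  bounds \<open>E (sup\<^sub>n lyap q X\<^sub>n)\<close> (\<open>sup_grid_moment\<close>). Working with the exponent \<open>q / 2\<close> in \<open>L\<^sup>2\<close>,
  and not with the exponent \<open>q\<close> itself, is what makes moments of order \<open>p\<close> enough. In particular
  \<open>X\<^sub>n\<close> is almost surely bounded, the continuous function \<open>\<delta>\<close> has a positive minimum along the
  path, and \<open>T\<close> is reached after finitely many steps (\<open>attained_AE\<close>).

  Between grid points. Chaining over dyadic points shows that the supremum of \<open>|W\<^sub>t - W\<^sub>s| powr q\<close>
  over one step has expectation at most a multiple of \<open>h powr (q / 2)\<close>, since \<open>q > 2\<close>; and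
  \<open>|g y| powr q * h powr (q / 2)\<close> is at most a multiple of \<open>h * lyap p y\<close>. Summing over the
  steps adds only another multiple of the quantity bounded before (\<open>bridge_sup_moment\<close>).

  Conditioning on the past at the random times \<open>S\<^sub>n\<close>, for steps whose length is random but known
  at time \<open>S\<^sub>n\<close>, is justified by the strong Markov property (\<open>strong_markov\<close>). All constants
  come from the one-step bounds, which mention only the data in the hypotheses, so they do not
  depend on the probability space, the coefficients or \<open>\<delta>\<close>.
\<close>

section \<open>Standard Gaussian vectors\<close>

definition std_gauss :: "(real ^ 'm) measure" where
  "std_gauss = distr (\<Pi>\<^sub>M i\<in>UNIV. density lborel std_normal_density) borel (\<lambda>x. \<chi> i. x i)"

abbreviation std_normal :: "real measure" where "std_normal \<equiv> density lborel (\<lambda>x. ennreal (std_normal_density x))"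

lemma prob_space_std_normal: "prob_space std_normal"
  by (intro prob_space_normal_density) simp

lemma measurable_vec_lambda:
  "(\<lambda>x. \<chi> i. x i) \<in> (\<Pi>\<^sub>M i\<in>(UNIV::'m::finite set). density lborel std_normal_density) \<rightarrow>\<^sub>M (borel :: (real^'m) measure)"
proof (subst borel_measurable_euclidean_space, intro ballI)
  fix b :: "real^'m" assume "b \<in> Basis"
  then obtain k where b: "b = axis k 1" by (auto simp: Basis_vec_def)
  have "(\<lambda>x. x k) \<in> (\<Pi>\<^sub>M i\<in>(UNIV::'m set). std_normal) \<rightarrow>\<^sub>M std_normal"
    by (rule measurable_component_singleton) simp
  then show "(\<lambda>x. (\<chi> i. x i) \<bullet> b) \<in> borel_measurable (\<Pi>\<^sub>M i\<in>(UNIV::'m set). std_normal)"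
    by (simp add: b inner_axis cong: measurable_cong_sets)
qed

lemma sets_std_gauss [measurable_cong, simp]: "sets std_gauss = sets borel"
  by (simp add: std_gauss_def)

lemma space_std_gauss [simp]: "space std_gauss = UNIV"
  by (simp add: std_gauss_def)

lemma prob_space_std_gauss: "prob_space std_gauss"
proof -
  interpret product_prob_space "\<lambda>_::'m. std_normal" UNIV
    by (simp add: product_prob_space_def product_prob_space_axioms_def product_sigma_finite_def prob_space_std_normal prob_space_imp_sigma_finite)
  show ?thesis unfolding std_gauss_def
    by (intro prob_space.prob_space_distr measurable_vec_lambda) (rule prob_space_axioms)
qed

interpretation std_gauss: prob_space std_gauss by (rule prob_space_std_gauss)

lemma measure_std_gauss_UNIV: "measure std_gauss UNIV = 1"
  and emeasure_std_gauss_UNIV: "emeasure std_gauss UNIV = 1"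
  using std_gauss.prob_space std_gauss.emeasure_space_1 by simp_all

lemma distr_std_gauss_component: "distr (std_gauss :: (real^'m) measure) borel (\<lambda>z. z $ i) = std_normal"
proof -
  have "distr (std_gauss :: (real^'m) measure) borel (\<lambda>z. z $ i)
     = distr (\<Pi>\<^sub>M i\<in>(UNIV::'m set). std_normal) borel (\<lambda>x. x i)"
    unfolding std_gauss_def by (subst distr_distr) (auto simp: measurable_vec_lambda o_def)
  also have "\<dots> = distr (\<Pi>\<^sub>M i\<in>(UNIV::'m set). std_normal) std_normal (\<lambda>x. x i)"
    by (intro distr_cong) auto
  also have "\<dots> = std_normal"
    by (rule distr_PiM_component) (auto simp: prob_space_std_normal)
  finally show ?thesis .
qed

lemma integrable_component_power: "integrable std_gauss (\<lambda>z::real^'m. \<bar>z $ i\<bar> ^ k)"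
proof -
  have "integrable (distr (std_gauss :: (real^'m) measure) borel (\<lambda>z. z $ i)) (\<lambda>x. \<bar>x\<bar> ^ k)"
    unfolding distr_std_gauss_component
    using integrable_std_normal_moment_abs by (simp add: integrable_density)
  then show ?thesis by (subst (asm) integrable_distr_eq) auto
qed

text \<open>The norm is at most the dimension times the largest coordinate in absolute value, so
  one-dimensional moments suffice.\<close>
lemma integrable_norm_power: "integrable std_gauss (\<lambda>z::real^'m. norm z ^ k)"
proof (rule Bochner_Integration.integrable_bound[where f="\<lambda>z. (\<Sum>i\<in>(UNIV::'m set). (real CARD('m) * \<bar>z $ i\<bar>) ^ k)"])
  show "integrable std_gauss (\<lambda>z. \<Sum>i\<in>UNIV. (real CARD('m) * \<bar>z $ i\<bar>) ^ k)"
    by (auto simp: power_mult_distrib intro!: integrable_component_power)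
  show "AE z::real^'m in std_gauss. norm (norm z ^ k) \<le> norm (\<Sum>i\<in>UNIV. (real CARD('m) * \<bar>z $ i\<bar>) ^ k)"
  proof (intro AE_I2)
    fix z :: "real^'m"
    have "Max (range (\<lambda>i. \<bar>z $ i\<bar>)) \<in> range (\<lambda>i. \<bar>z $ i\<bar>)" by (intro Max_in) auto
    then obtain j where "Max (range (\<lambda>i. \<bar>z $ i\<bar>)) = \<bar>z $ j\<bar>" by (rule imageE)
    then have j: "\<bar>z $ i\<bar> \<le> \<bar>z $ j\<bar>" for i
      using Max_ge[of "range (\<lambda>i. \<bar>z $ i\<bar>)" "\<bar>z $ i\<bar>"] by auto
    have "norm z \<le> (\<Sum>i\<in>UNIV. \<bar>z $ i\<bar>)" by (rule norm_le_l1_cart)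
    also have "\<dots> \<le> real CARD('m) * \<bar>z $ j\<bar>" using sum_bounded_above[of UNIV "\<lambda>i. \<bar>z $ i\<bar>" "\<bar>z $ j\<bar>"] j by simp
    finally have "norm z ^ k \<le> (real CARD('m) * \<bar>z $ j\<bar>) ^ k" by (intro power_mono) auto
    also have "\<dots> \<le> (\<Sum>i\<in>UNIV. (real CARD('m) * \<bar>z $ i\<bar>) ^ k)"
      by (intro member_le_sum) auto
    finally show "norm (norm z ^ k) \<le> norm (\<Sum>i\<in>UNIV. (real CARD('m) * \<bar>z $ i\<bar>) ^ k)"
      by simp
  qed
qed auto

lemma integral_component: "(LINT z|std_gauss. (z::real^'m) $ i) = 0"
proof -
  have "(LINT z|std_gauss. (z::real^'m) $ i) = (LINT x|distr (std_gauss :: (real^'m) measure) borel (\<lambda>z. z $ i). x)"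
    by (subst integral_distr) auto
  also have "\<dots> = 0" unfolding distr_std_gauss_component
    using integral_std_normal_moment_odd[of 0] by (simp add: integral_density)
  finally show ?thesis .
qed

lemma integral_component_sq: "(LINT z|std_gauss. (z::real^'m) $ i * z $ i) = 1"
proof -
  have "(LINT z|std_gauss. (z::real^'m) $ i * z $ i) = (LINT x|distr (std_gauss :: (real^'m) measure) borel (\<lambda>z. z $ i). x * x)"
    by (subst integral_distr) auto
  also have "\<dots> = 1" unfolding distr_std_gauss_component
    using integral_std_normal_moment_even[of 1] by (simp add: integral_density power2_eq_square)
  finally show ?thesis .
qed

text \<open>The coordinates are independent, so the integral factors, and one factor is the mean of a
  centred normal law.\<close>
lemma integral_component_mult:
  assumes "i \<noteq> j" shows "(LINT z|std_gauss. (z::real^'m) $ i * z $ j) = 0"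
proof -
  interpret product_sigma_finite "\<lambda>_::'m. std_normal"
    by (simp add: product_sigma_finite_def prob_space_std_normal prob_space_imp_sigma_finite)
  define f where "f k x = (if k = i then x else 1) * (if k = j then x else (1::real))" for k x
  have int: "integrable std_normal (\<lambda>x. x)"
    using integrable_std_normal_moment[of 1] by (simp add: integrable_density)
  have "(LINT z|std_gauss. (z::real^'m) $ i * z $ j) = (LINT x|(\<Pi>\<^sub>M i\<in>(UNIV::'m set). std_normal). x i * x j)"
    unfolding std_gauss_def by (subst integral_distr) (auto simp: measurable_vec_lambda)
  also have "\<dots> = (LINT x|(\<Pi>\<^sub>M i\<in>(UNIV::'m set). std_normal). (\<Prod>k\<in>UNIV. f k (x k)))"
    by (intro Bochner_Integration.integral_cong refl) (simp add: f_def prod.distrib prod.delta)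
  also have "\<dots> = (\<Prod>k\<in>UNIV. integral\<^sup>L std_normal (f k))"
  proof (rule product_integral_prod)
    show "integrable std_normal (f k)" for k
      using assms int finite_measure.integrable_const[OF prob_space.finite_measure[OF prob_space_std_normal]]
      by (cases "k = i"; cases "k = j") (auto simp: f_def[abs_def])
  qed simp
  also have "\<dots> = 0"
  proof -
    have "integral\<^sup>L std_normal (f i) = 0" using assms integral_std_normal_moment_odd[of 0] by (simp add: f_def[abs_def] integral_density)
    then show ?thesis by (intro prod_zero) auto
  qed
  finally show ?thesis .
qed

lemma integrable_component[simp]: "integrable std_gauss (\<lambda>z::real^'m. z $ i)"
  using integrable_component_power[of i 1] by (simp add: integrable_abs_iff)

lemma integrable_poly_growth:
  fixes f :: "real^'m \<Rightarrow> real"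
  assumes "f \<in> borel_measurable borel" "\<And>z. \<bar>f z\<bar> \<le> C * (1 + norm z) ^ k"
  shows "integrable std_gauss f"
proof (rule Bochner_Integration.integrable_bound[where f="\<lambda>z. \<bar>C\<bar> * (\<Sum>j\<le>k. of_nat (k choose j) * norm z ^ j)"])
  show "AE z in std_gauss. norm (f z) \<le> norm (\<bar>C\<bar> * (\<Sum>j\<le>k. of_nat (k choose j) * norm z ^ j))"
  proof (intro AE_I2)
    fix z :: "real^'m"
    have "\<bar>f z\<bar> \<le> \<bar>C\<bar> * (1 + norm z) ^ k" by (rule order_trans[OF assms(2)]) (auto intro!: mult_right_mono)
    also have "(1 + norm z) ^ k = (\<Sum>j\<le>k. of_nat (k choose j) * norm z ^ j)"
      using binomial_ring[of "norm z" 1 k] by (simp add: add.commute)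
    finally show "norm (f z) \<le> norm (\<bar>C\<bar> * (\<Sum>j\<le>k. of_nat (k choose j) * norm z ^ j))"
      by simp
  qed
  show "f \<in> borel_measurable std_gauss"
    using assms(1) by (simp only: measurable_cong_sets[OF sets_std_gauss refl])
  show "integrable std_gauss (\<lambda>z::real^'m. \<bar>C\<bar> * (\<Sum>j\<le>k. of_nat (k choose j) * norm z ^ j))"
    by (intro integrable_mult_right Bochner_Integration.integrable_sum integrable_norm_power)
qed

lemma integrable_inner_gauss: "integrable std_gauss (\<lambda>z::real^'m. v \<bullet> z)" "integrable std_gauss (\<lambda>z::real^'m. (v \<bullet> z)\<^sup>2)"
proof -
  have b: "\<bar>v \<bullet> z\<bar> ^ j \<le> norm v ^ j * (1 + norm z) ^ j" for z :: "real^'m" and j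
  proof -
    have "\<bar>v \<bullet> z\<bar> \<le> norm v * norm z" by (rule Cauchy_Schwarz_ineq2)
    also have "\<dots> \<le> norm v * (1 + norm z)" by (intro mult_left_mono) auto
    finally show ?thesis by (simp add: power_mono flip: power_mult_distrib)
  qed
  show "integrable std_gauss (\<lambda>z::real^'m. v \<bullet> z)" using b[where j=1] by (intro integrable_poly_growth[where k=1]) auto
  show "integrable std_gauss (\<lambda>z::real^'m. (v \<bullet> z)\<^sup>2)" using b[where j=2] by (intro integrable_poly_growth[where k=2]) auto
qed

lemma integral_inner: "(LINT z|std_gauss. v \<bullet> (z::real^'m)) = 0"
  by (simp add: inner_vec_def integral_component)

lemma integrable_component_mult[simp]: "integrable std_gauss (\<lambda>z::real^'m. z $ i * z $ j)"
proof (rule integrable_poly_growth[where C=1 and k=2])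
  fix z :: "real^'m"
  have "\<bar>z $ i * z $ j\<bar> \<le> (1 + norm z) * (1 + norm z)"
    unfolding abs_mult by (intro mult_mono) (auto intro: order_trans[OF component_le_norm_cart])
  then show "\<bar>z $ i * z $ j\<bar> \<le> 1 * (1 + norm z)\<^sup>2" by (simp add: power2_eq_square)
qed (intro borel_measurable_continuous_onI continuous_intros)

lemma integral_inner_sq: "(LINT z|std_gauss. (v \<bullet> (z::real^'m))\<^sup>2) = (norm v)\<^sup>2"
proof -
  have "(LINT z|std_gauss. (v \<bullet> (z::real^'m))\<^sup>2) = (LINT z|std_gauss. (\<Sum>i\<in>UNIV. \<Sum>j\<in>UNIV. v$i * v$j * ((z::real^'m)$i * z$j)))"
    by (intro Bochner_Integration.integral_cong refl) (simp add: inner_vec_def power2_eq_square sum_product mult_ac)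
  also have "\<dots> = (\<Sum>i\<in>UNIV. \<Sum>j\<in>UNIV. v$i * v$j * (LINT z|std_gauss. (z::real^'m)$i * z$j))"
    by (simp add: Bochner_Integration.integral_sum)
  also have "\<dots> = (\<Sum>i\<in>UNIV. \<Sum>j\<in>UNIV. if j = i then v$i * v$j else 0)"
    by (intro sum.cong refl) (auto simp: integral_component_sq integral_component_mult)
  also have "\<dots> = (norm v)\<^sup>2" by (simp add: power2_norm_eq_inner inner_vec_def)
  finally show ?thesis .
qed

lemma norm_matrix_vector_le: "norm (g *v z) \<le> norm (g :: real^'m^'d) * norm z"
proof -
  have "norm (g *v z) = L2_set (\<lambda>i. \<bar>g $ i \<bullet> z\<bar>) UNIV"
    by (simp add: norm_vec_def matrix_vector_mult_def inner_vec_def)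
  also have "\<dots> \<le> L2_set (\<lambda>i. norm (g $ i) * norm z) UNIV"
    by (intro L2_set_mono) (auto simp: Cauchy_Schwarz_ineq2)
  also have "\<dots> = norm g * norm z"
    by (simp add: norm_vec_def L2_set_left_distrib)
  finally show ?thesis .
qed

text \<open>This identity is the reason why the Frobenius norm of \<open>g\<close> appears in the monotonicity
  condition.\<close>
lemma integral_norm_matrix_sq: "(LINT z|std_gauss. (norm (g *v z))\<^sup>2) = (norm (g::real^'m^'d))\<^sup>2"
proof -
  have "(LINT z|std_gauss. (norm (g *v z))\<^sup>2) = (LINT z|std_gauss. (\<Sum>i\<in>UNIV. (g $ i \<bullet> z)\<^sup>2))"
    by (intro Bochner_Integration.integral_cong refl)
      (simp add: power2_norm_eq_inner, simp add: inner_vec_def matrix_vector_mult_def power2_eq_square)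
  also have "\<dots> = (\<Sum>i\<in>UNIV. (LINT z|std_gauss. (g $ i \<bullet> z)\<^sup>2))"
  proof (intro Bochner_Integration.integral_sum integrable_poly_growth[where C="(norm g)\<^sup>2" and k=2])
    fix i and z :: "real^'m"
    have "\<bar>g $ i \<bullet> z\<bar> \<le> norm (g $ i) * norm z" by (rule Cauchy_Schwarz_ineq2)
    also have "\<dots> \<le> norm g * (1 + norm z)" by (intro mult_mono Finite_Cartesian_Product.norm_nth_le) auto
    finally have "\<bar>g $ i \<bullet> z\<bar>\<^sup>2 \<le> (norm g * (1 + norm z))\<^sup>2" by (rule power_mono) simp
    then show "\<bar>(g $ i \<bullet> z)\<^sup>2\<bar> \<le> (norm g)\<^sup>2 * (1 + norm z)\<^sup>2" by (simp add: power_mult_distrib)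
  qed auto
  also have "\<dots> = (norm g)\<^sup>2"
    by (simp add: integral_inner_sq) (simp add: power2_norm_eq_inner inner_vec_def)
  finally show ?thesis .
qed

lemma inner_matrix_vector: "y \<bullet> (g *v z) = (y v* g) \<bullet> (z::real^'m)"
  by (simp add: dot_lmul_matrix)

lemma norm_vector_matrix_le: "norm (y v* g) \<le> norm y * norm (g :: real^'m^'d)"
proof -
  have "y v* g = (\<Sum>i\<in>UNIV. y $ i *\<^sub>R g $ i)"
    by (simp add: vec_eq_iff vector_matrix_mult_def mult.commute)
  also have "norm \<dots> \<le> (\<Sum>i\<in>UNIV. \<bar>y $ i\<bar> * \<bar>norm (g $ i)\<bar>)"
    by (intro order_trans[OF norm_sum] sum_mono) simp
  also have "\<dots> \<le> L2_set (\<lambda>i. y $ i) UNIV * L2_set (\<lambda>i. norm (g $ i)) UNIV" by (rule L2_set_mult_ineq)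
  also have "\<dots> = norm y * norm g" by (simp add: norm_vec_def L2_set_def)
  finally show ?thesis .
qed

lemma integrable_one_plus_norm_power: "integrable std_gauss (\<lambda>z::real^'m. (1 + norm z) ^ k)"
  by (rule integrable_poly_growth[where C=1 and k=k]) auto

section \<open>Taylor bounds for real powers\<close>

lemma powr_one_plus_le:
  fixes b u :: real
  assumes "0 \<le> b" "b \<le> 1" "-1 \<le> u"
  shows "(1 + u) powr b \<le> 1 + b * u"
proof (cases "u = -1")
  case False
  then show ?thesis using Youngs_inequality_0[of b "1 - b" "1 + u" 1] assms by (simp add: algebra_simps)
qed (use assms in simp)

text \<open>Apply the concave case with exponent \<open>1 / b\<close> to \<open>(1 + u) powr b - 1\<close>.\<close>
lemma powr_one_plus_ge:
  fixes b u :: real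
  assumes "1 \<le> b" "-1 \<le> u"
  shows "1 + b * u \<le> (1 + u) powr b"
proof -
  have "(1 + ((1 + u) powr b - 1)) powr (1 / b) \<le> 1 + (1 / b) * ((1 + u) powr b - 1)"
    using assms by (intro powr_one_plus_le) auto
  then have "1 + u \<le> 1 + (1 / b) * ((1 + u) powr b - 1)"
    using assms by (simp add: powr_powr)
  then show ?thesis using assms by (simp add: field_simps)
qed

lemma powr_one_plus_taylor:
  fixes b u :: real
  assumes u: "\<bar>u\<bar> \<le> 1/2" and b: "1 \<le> b"
  shows "(1 + u) powr b \<le> 1 + b * u + b * (b - 1) / 2 * u\<^sup>2 + b * (b - 1) * \<bar>b - 2\<bar> * 2 powr \<bar>b - 3\<bar> * \<bar>u\<bar> ^ 3"
proof (cases "u = 0")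
  case False
  define c where "c m = (\<Prod>i<m. b - real i)" for m
  define D where "D m t = c m * (1 + t) powr (b - real m)" for m :: nat and t :: real
  have "\<exists>t. (if u < 0 then u < t \<and> t < 0 else 0 < t \<and> t < u) \<and>
    (1 + u) powr b = (\<Sum>m<3. (D m 0 / fact m) * (u - 0)^m) + (D 3 t / fact 3) * (u - 0)^3"
  proof (rule Taylor[where a="-1/2" and b="1/2"])
    show "D 0 = (\<lambda>u. (1 + u) powr b)" by (auto simp: D_def c_def)
    show "\<forall>m t. m < 3 \<and> - 1 / 2 \<le> t \<and> t \<le> 1 / 2 \<longrightarrow> (D m has_real_derivative D (Suc m) t) (at t)"
    proof (intro allI impI)
      fix m :: nat and t :: real assume "m < 3 \<and> - 1 / 2 \<le> t \<and> t \<le> 1 / 2"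
      then have "0 < 1 + t" by auto
      then show "(D m has_real_derivative D (Suc m) t) (at t)"
        unfolding D_def c_def
        by (auto intro!: derivative_eq_intros simp: algebra_simps)
    qed
  qed (use u False in auto)
  then obtain t where t: "(if u < 0 then u < t \<and> t < 0 else 0 < t \<and> t < u)"
    and eq: "(1 + u) powr b = (\<Sum>m<3. (D m 0 / fact m) * u^m) + (D 3 t / fact 3) * u^3"
    by auto
  have t': "1/2 \<le> 1 + t" "1 + t \<le> 2" using t u by (auto split: if_splits)
  have pw: "(1 + t) powr (b - 3) \<le> 2 powr \<bar>b - 3\<bar>"
  proof (cases "b \<ge> 3")
    case True then show ?thesis using t' by (auto intro!: powr_mono2)
  next
    case False
    have "(1 + t) powr (b - 3) \<le> (1/2) powr (b - 3)" using False t' by (intro powr_mono2') auto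
    also have "\<dots> = 2 powr (3 - b)" by (simp add: powr_divide powr_minus_divide[symmetric])
    finally show ?thesis using False by simp
  qed
  have "\<bar>D 3 t\<bar> \<le> b * (b - 1) * \<bar>b - 2\<bar> * 2 powr \<bar>b - 3\<bar>"
    using b pw by (auto simp: D_def c_def numeral_3_eq_3 abs_mult intro!: mult_mono)
  then have "\<bar>D 3 t\<bar> * \<bar>u\<bar> ^ 3 \<le> b * (b - 1) * \<bar>b - 2\<bar> * 2 powr \<bar>b - 3\<bar> * \<bar>u\<bar> ^ 3"
    by (intro mult_right_mono) auto
  moreover have "(D 3 t / fact 3) * u^3 \<le> \<bar>D 3 t\<bar> * \<bar>u\<bar> ^ 3"
  proof -
    have "(D 3 t / fact 3) * u^3 \<le> \<bar>(D 3 t / fact 3) * u^3\<bar>" by (rule abs_ge_self)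
    also have "\<dots> = (\<bar>D 3 t\<bar> * \<bar>u\<bar> ^ 3) / fact 3" by (simp add: abs_mult power_abs)
    also have "\<dots> \<le> (\<bar>D 3 t\<bar> * \<bar>u\<bar> ^ 3) / 1" by (intro divide_left_mono) (auto simp: fact_numeral)
    finally show ?thesis by simp
  qed
  moreover have "(\<Sum>m<3. (D m 0 / fact m) * u^m) = 1 + b * u + b * (b - 1) / 2 * u\<^sup>2"
    by (simp add: D_def c_def numeral_3_eq_3 power2_eq_square algebra_simps)
  ultimately show ?thesis using eq by linarith
qed simp

text \<open>The second-order expansion is kept exact, because its coefficients must match the constant
  \<open>(p - 1) / 2\<close> of the monotonicity condition, while the remainder may be any combination of
  powers of order at least three. For \<open>b \<le> 1\<close> the quadratic term is negative and is dropped. The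
  power \<open>N\<close> takes over for large \<open>u\<close>.\<close>
lemma powr_one_plus_upper:
  fixes b :: real
  assumes b: "0 \<le> b" and N: "b \<le> real N" "3 \<le> N"
  shows "\<exists>C\<ge>0. \<forall>u\<ge>-1. (1 + u) powr b \<le> 1 + b * u + max 0 (b * (b - 1) / 2) * u\<^sup>2 + C * (\<bar>u\<bar> ^ 3 + \<bar>u\<bar> ^ N)"
proof (cases "b \<le> 1")
  case True
  have m: "max 0 (b * (b - 1) / 2) = 0" using True b by (simp add: mult_nonneg_nonpos)
  have "(1 + u) powr b \<le> 1 + b * u + max 0 (b * (b - 1) / 2) * u\<^sup>2 + 0 * (\<bar>u\<bar> ^ 3 + \<bar>u\<bar> ^ N)" if "u \<ge> -1" for u
    unfolding m using powr_one_plus_le[OF b True that] by simp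
  then show ?thesis by blast
next
  case False
  then have b1: "b \<ge> 1" by simp
  then have m: "max 0 (b * (b - 1) / 2) = b * (b - 1) / 2" by simp
  define C1 where "C1 = b * (b - 1) * \<bar>b - 2\<bar> * 2 powr \<bar>b - 3\<bar>"
  define C where "C = C1 + 8 * b + 3 ^ N"
  have C1: "C1 \<ge> 0" using b1 by (simp add: C1_def)
  have sq: "0 \<le> b * (b - 1) / 2 * u\<^sup>2" for u :: real using b1 by simp
  have "(1 + u) powr b \<le> 1 + b * u + b * (b - 1) / 2 * u\<^sup>2 + C * (\<bar>u\<bar> ^ 3 + \<bar>u\<bar> ^ N)" if u: "u \<ge> -1" for u
  proof -
    consider "\<bar>u\<bar> \<le> 1/2" | "u > 1/2" | "u < -1/2" by linarith
    then show ?thesis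
    proof cases
      case 1
      have "C1 * \<bar>u\<bar> ^ 3 \<le> C * (\<bar>u\<bar> ^ 3 + \<bar>u\<bar> ^ N)"
        using C1 b1 by (intro mult_mono) (auto simp: C_def)
      then show ?thesis using powr_one_plus_taylor[OF 1 b1] by (simp add: C1_def)
    next
      case 2
      have "(1 + u) powr b \<le> (1 + u) powr real N" using 2 N by (intro powr_mono) auto
      also have "\<dots> = (1 + u) ^ N" using 2 by (simp add: powr_realpow)
      also have "\<dots> \<le> (3 * u) ^ N" using 2 by (intro power_mono) auto
      also have "\<dots> = 3 ^ N * \<bar>u\<bar> ^ N" using 2 by (simp add: power_mult_distrib)
      also have "\<dots> \<le> C * (\<bar>u\<bar> ^ 3 + \<bar>u\<bar> ^ N)"
        using C1 b1 by (intro mult_mono) (auto simp: C_def)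
      also have "\<dots> \<le> 1 + b * u + b * (b - 1) / 2 * u\<^sup>2 + C * (\<bar>u\<bar> ^ 3 + \<bar>u\<bar> ^ N)"
        using sq[of u] 2 b1 by simp
      finally show ?thesis .
    next
      case 3
      have "(1 + u) powr b \<le> 1" using u 3 b by (intro powr_le1) auto
      moreover have "b * (- u) \<le> b * 1" using u b by (intro mult_left_mono) auto
      moreover have "(1/2) ^ 3 \<le> \<bar>u\<bar> ^ 3" using 3 by (intro power_mono) auto
      then have "(8 * b) * (1/2)^3 \<le> C * (\<bar>u\<bar> ^ 3 + \<bar>u\<bar> ^ N)"
        using C1 b1 by (intro mult_mono) (auto simp: C_def intro: add_increasing2)
      ultimately show ?thesis using sq[of u] by (simp add: power3_eq_cube)
    qed
  qed
  moreover have "C \<ge> 0" using C1 b1 by (simp add: C_def)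
  ultimately show ?thesis unfolding m by blast
qed

lemma power_le_add_powers:
  fixes x :: real
  assumes "0 \<le> x" "i \<le> j" "j \<le> k"
  shows "x ^ j \<le> x ^ i + x ^ k"
proof (cases "x \<le> 1")
  case True
  have "x ^ j \<le> x ^ i" using assms True by (intro power_decreasing) auto
  then show ?thesis using assms by (simp add: add_increasing2)
next
  case False
  have "x ^ j \<le> x ^ k" using assms False by (intro power_increasing) auto
  then show ?thesis using assms by (simp add: add_increasing)
qed

text \<open>A first-order version of the previous bound, with a lower estimate as well; it controls
  squared increments.\<close>
lemma powr_one_plus_dist:
  fixes b :: real
  assumes b: "0 \<le> b" and N: "b \<le> real N" "3 \<le> N"
  shows "\<exists>C\<ge>0. \<forall>u\<ge>-1. \<bar>(1 + u) powr b - 1\<bar> \<le> C * (\<bar>u\<bar> + \<bar>u\<bar> ^ N)"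
proof -
  obtain C where C: "C \<ge> 0" and up: "\<And>u. u \<ge> -1 \<Longrightarrow> (1 + u) powr b \<le> 1 + b * u + max 0 (b * (b - 1) / 2) * u\<^sup>2 + C * (\<bar>u\<bar> ^ 3 + \<bar>u\<bar> ^ N)"
    using powr_one_plus_upper[OF assms] by blast
  define m where "m = max 0 (b * (b - 1) / 2)"
  have m: "m \<ge> 0" by (simp add: m_def)
  define C' where "C' = 1 + b + m + 2 * C"
  have "\<bar>(1 + u) powr b - 1\<bar> \<le> C' * (\<bar>u\<bar> + \<bar>u\<bar> ^ N)" if u: "u \<ge> -1" for u
  proof -
    let ?s = "\<bar>u\<bar> + \<bar>u\<bar> ^ N"
    have p: "\<bar>u\<bar> ^ k \<le> ?s" if "1 \<le> k" "k \<le> N" for k using power_le_add_powers[of "\<bar>u\<bar>" 1 k N] that by simp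
    have "b * u \<le> b * ?s" using b by (intro mult_left_mono) (auto intro: order_trans[OF abs_ge_self])
    moreover have "m * u\<^sup>2 \<le> m * ?s" using m p[of 2] N by (intro mult_left_mono) auto
    moreover have "C * (\<bar>u\<bar> ^ 3 + \<bar>u\<bar> ^ N) \<le> C * (2 * ?s)" using C p[of 3] p[of N] N by (intro mult_left_mono) auto
    moreover have "C' * ?s = ?s + b * ?s + m * ?s + C * (2 * ?s)" by (simp add: C'_def algebra_simps)
    moreover have "0 \<le> ?s" by simp
    ultimately have 1: "(1 + u) powr b - 1 \<le> C' * ?s"
      using up[OF u, folded m_def] by linarith
    have "- (1 + b) * ?s \<le> (1 + u) powr b - 1"
    proof (cases "u \<ge> 0")
      case True
      then have "1 \<le> (1 + u) powr b" using b by (intro ge_one_powr_ge_zero) auto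
      moreover have "- (1 + b) * ?s \<le> 0" using b by (simp add: mult_nonpos_nonneg)
      ultimately show ?thesis by linarith
    next
      case neg: False
      have s: "-u \<le> ?s" using neg by simp
      show ?thesis
      proof (cases "b \<ge> 1")
        case True
        have "(1 + b) * - u \<le> (1 + b) * ?s" using b s by (intro mult_left_mono) auto
        then show ?thesis using powr_one_plus_ge[OF True u] neg by (simp add: algebra_simps)
      next
        case False
        have "(1 + u) powr 1 \<le> (1 + u) powr b"
          using u neg False b powr_mono'[of b 1 "1 + u"] by auto
        then have "- ?s \<le> (1 + u) powr b - 1" using u s by simp
        moreover have "- (1 + b) * ?s \<le> - ?s" using b by (simp add: algebra_simps)
        ultimately show ?thesis by linarith
      qed
    qed
    moreover have "(1 + b) * ?s \<le> C' * ?s" using m C by (intro mult_right_mono) (auto simp: C'_def)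
    ultimately show ?thesis using 1 by linarith
  qed
  moreover have "C' \<ge> 0" using b m C by (simp add: C'_def)
  ultimately show ?thesis by blast
qed

section \<open>One Euler-Maruyama step\<close>

text \<open>A smooth substitute for \<open>|y| powr a\<close> that is bounded below by one for \<open>a \<ge> 0\<close>.\<close>
definition lyap :: "real \<Rightarrow> 'a::real_normed_vector \<Rightarrow> real" where
  "lyap a y = (1 + (norm y)\<^sup>2) powr (a / 2)"

lemma one_plus_sq_pos: "0 < 1 + (norm y)\<^sup>2" "0 \<le> 1 + (norm y)\<^sup>2" "1 + (norm y)\<^sup>2 \<noteq> 0"
  using zero_le_power2[of "norm y"] by linarith+

lemma lyap_pos: "0 < lyap a y"
  using one_plus_sq_pos[of y] by (simp add: lyap_def)

lemma lyap_ge_1: "0 \<le> a \<Longrightarrow> 1 \<le> lyap a y"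
  unfolding lyap_def by (intro ge_one_powr_ge_zero) auto

lemma lyap_mono: "a \<le> b \<Longrightarrow> lyap a y \<le> lyap b y"
  unfolding lyap_def by (intro powr_mono) auto

lemma lyap_power2: "(lyap a y)\<^sup>2 = lyap (2 * a) y"
  by (simp add: lyap_def power2_eq_square powr_add[symmetric])

lemma lyap_mult: "lyap a y * lyap b y = lyap (a + b) y"
  by (simp add: lyap_def powr_add[symmetric] add_divide_distrib)

lemma norm_powr_le_lyap: "0 \<le> a \<Longrightarrow> norm y powr a \<le> lyap a y"
proof -
  assume a: "0 \<le> a"
  have "norm y powr a = ((norm y)\<^sup>2) powr (a / 2)"
    by (cases "y = 0") (simp_all add: powr_powr flip: powr_numeral)
  also have "\<dots> \<le> lyap a y" unfolding lyap_def using a by (intro powr_mono2) auto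
  finally show ?thesis .
qed

lemma continuous_on_lyap [continuous_intros]: "continuous_on S f \<Longrightarrow> continuous_on S (\<lambda>x. lyap a (f x))"
  unfolding lyap_def by (intro continuous_intros) (auto simp: one_plus_sq_pos)

lemma measurable_lyap [measurable]:
  "lyap a \<in> borel_measurable (borel :: 'a::{real_normed_vector, second_countable_topology} measure)"
  by (intro borel_measurable_continuous_onI continuous_intros)

text \<open>A step of length \<open>h\<close> from \<open>y\<close> with drift \<open>fv\<close> and diffusion matrix \<open>gv\<close>, and \<open>k\<close> the cube
  root of \<open>h\<close>. The last three assumptions are the form in which the timestep condition is used:
  relative to \<open>sqrt (1 + |y|\<^sup>2)\<close>, drift and diffusion parts are of order \<open>h powr (1/3)\<close>, and the
  square of the drift part is even of order \<open>h\<close>.\<close>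
locale em_step =
  fixes y fv :: "real ^ 'd" and gv :: "real ^ 'm ^ 'd" and h k B :: real
  assumes h_eq: "h = k ^ 3" and k_nonneg: "0 \<le> k" and k_le: "k \<le> B" and B_ge_1: "1 \<le> B"
    and drift_le: "h * norm fv \<le> B * sqrt (1 + (norm y)\<^sup>2) * k"
    and drift_sq_le: "(h * norm fv)\<^sup>2 \<le> B\<^sup>2 * (1 + (norm y)\<^sup>2) * h"
    and diffusion_le: "sqrt h * norm gv \<le> B * sqrt (1 + (norm y)\<^sup>2) * k"
begin

definition D where "D = 1 + (norm y)\<^sup>2"
definition incr where "incr z = h *\<^sub>R fv + sqrt h *\<^sub>R (gv *v z)"
definition u where "u z = (2 * (y \<bullet> incr z) + (norm (incr z))\<^sup>2) / D"
definition eta where "eta z = norm (incr z) / sqrt D"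

lemma h_nonneg: "0 \<le> h" using h_eq k_nonneg by simp

lemma D_pos: "0 < D" "D \<noteq> 0" "1 \<le> D" unfolding D_def by (rule one_plus_sq_pos | simp)+

lemma norm_y_le: "norm y \<le> sqrt D" unfolding D_def by (rule real_le_rsqrt) simp

lemma one_plus_u: "1 + u z = (1 + (norm (y + incr z))\<^sup>2) / D"
  using D_pos by (simp add: u_def field_simps) (simp add: D_def power2_norm_eq_inner inner_add inner_commute)

lemma u_ge: "-1 \<le> u z"
proof -
  have "0 \<le> 1 + u z" unfolding one_plus_u using D_pos by simp
  then show ?thesis by simp
qed

lemma lyap_ratio: "lyap a (y + incr z) = lyap a y * (1 + u z) powr (a / 2)"
  unfolding one_plus_u using D_pos by (simp add: lyap_def powr_divide D_def[symmetric])

lemma eta_nonneg: "0 \<le> eta z" using D_pos by (simp add: eta_def)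

lemma abs_inner_le: "\<bar>y \<bullet> incr z\<bar> / D \<le> eta z"
proof -
  have "\<bar>y \<bullet> incr z\<bar> \<le> norm y * norm (incr z)" by (rule Cauchy_Schwarz_ineq2)
  also have "\<dots> \<le> sqrt D * norm (incr z)" by (intro mult_right_mono norm_y_le) simp
  also have "\<dots> = D * eta z" using D_pos real_sqrt_mult_self[of D] by (simp add: eta_def field_simps)
  finally show ?thesis using D_pos by (simp add: field_simps)
qed

lemma eta_sq: "(eta z)\<^sup>2 = (norm (incr z))\<^sup>2 / D"
  using D_pos by (simp add: eta_def power_divide)

lemma abs_u_le: "\<bar>u z\<bar> \<le> 2 * eta z + (eta z)\<^sup>2"
proof -
  have "\<bar>u z\<bar> = \<bar>2 * (y \<bullet> incr z / D) + (eta z)\<^sup>2\<bar>" by (simp add: u_def eta_sq add_divide_distrib)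
  also have "\<dots> \<le> \<bar>2 * (y \<bullet> incr z / D)\<bar> + \<bar>(eta z)\<^sup>2\<bar>" by (rule abs_triangle_ineq)
  also have "\<dots> \<le> 2 * eta z + (eta z)\<^sup>2" using abs_inner_le[of z] D_pos by (simp add: abs_mult)
  finally show ?thesis .
qed

text \<open>Only \<open>(y \<bullet> incr z)\<^sup>2\<close> can be of order \<open>h\<close> in mean; the rest has order three in \<open>eta\<close>.\<close>
lemma u_sq_le: "(u z)\<^sup>2 \<le> 4 * (y \<bullet> incr z)\<^sup>2 / D\<^sup>2 + 4 * eta z ^ 3 + eta z ^ 4"
proof -
  define a where "a = y \<bullet> incr z / D"
  have a: "\<bar>a\<bar> \<le> eta z" using abs_inner_le[of z] D_pos by (simp add: a_def)
  have "u z = 2 * a + (eta z)\<^sup>2" by (simp add: u_def eta_sq add_divide_distrib a_def)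
  then have "(u z)\<^sup>2 = 4 * a\<^sup>2 + 4 * (a * (eta z)\<^sup>2) + eta z ^ 4"
    by (simp add: power2_eq_square algebra_simps power4_eq_xxxx)
  also have "a * (eta z)\<^sup>2 \<le> eta z * (eta z)\<^sup>2" using a by (intro mult_right_mono) auto
  also have "4 * a\<^sup>2 = 4 * (y \<bullet> incr z)\<^sup>2 / D\<^sup>2" by (simp add: a_def power_divide)
  finally show ?thesis by (simp add: power3_eq_cube power2_eq_square)
qed

lemma abs_u_power_le: "\<bar>u z\<bar> ^ j \<le> 3 ^ j * (eta z ^ j + eta z ^ (2 * j))"
proof -
  define m where "m = max (eta z) ((eta z)\<^sup>2)"
  have "\<bar>u z\<bar> \<le> 3 * m" using abs_u_le[of z] by (simp add: m_def)
  then have "\<bar>u z\<bar> ^ j \<le> (3 * m) ^ j" by (intro power_mono) auto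
  also have "\<dots> = 3 ^ j * m ^ j" by (simp add: power_mult_distrib)
  also have "m ^ j \<le> eta z ^ j + eta z ^ (2 * j)"
    using eta_nonneg[of z] by (auto simp: m_def max_def power_mult)
  finally show ?thesis by simp
qed

lemma eta_le: "eta z \<le> B * k * (1 + norm z)"
proof -
  have "norm (incr z) \<le> norm (h *\<^sub>R fv) + norm (sqrt h *\<^sub>R (gv *v z))" unfolding incr_def by (rule norm_triangle_ineq)
  also have "\<dots> = h * norm fv + sqrt h * norm (gv *v z)" using h_nonneg by simp
  also have "\<dots> \<le> B * sqrt D * k + (B * sqrt D * k) * norm z"
  proof (intro add_mono)
    show "h * norm fv \<le> B * sqrt D * k" using drift_le by (simp add: D_def)
    have "sqrt h * norm (gv *v z) \<le> sqrt h * (norm gv * norm z)" using h_nonneg by (intro mult_left_mono norm_matrix_vector_le) simp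
    also have "\<dots> \<le> (B * sqrt D * k) * norm z" using mult_right_mono[OF diffusion_le norm_ge_zero[of z]] by (simp add: D_def mult_ac)
    finally show "sqrt h * norm (gv *v z) \<le> (B * sqrt D * k) * norm z" .
  qed
  finally show ?thesis using D_pos by (simp add: eta_def field_simps)
qed

text \<open>Three factors \<open>k\<close> make one factor \<open>h\<close>, and any further ones are bounded by \<open>B\<close>. Thus
  everything of order at least three in \<open>eta\<close> counts as \<open>O(h)\<close>.\<close>
lemma eta_power_le:
  assumes "3 \<le> j" "j \<le> J"
  shows "eta z ^ j \<le> h * B ^ (2 * J) * (1 + norm z) ^ J"
proof -
  have "eta z ^ j \<le> (B * k * (1 + norm z)) ^ j" by (intro power_mono eta_le eta_nonneg)
  also have "\<dots> = (k ^ 3 * k ^ (j - 3)) * B ^ j * (1 + norm z) ^ j"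
    using assms by (simp add: power_mult_distrib mult_ac flip: power_add)
  also have "\<dots> \<le> (h * B ^ J) * B ^ J * (1 + norm z) ^ J"
  proof (intro mult_mono)
    have "k ^ (j - 3) \<le> B ^ (j - 3)" using k_nonneg k_le by (intro power_mono)
    also have "\<dots> \<le> B ^ J" using B_ge_1 assms by (intro power_increasing) auto
    finally show "k ^ (j - 3) \<le> B ^ J" .
  qed (use assms B_ge_1 k_nonneg in \<open>auto simp: h_eq intro!: power_increasing\<close>)
  also have "\<dots> = h * B ^ (2 * J) * (1 + norm z) ^ J" by (simp add: mult_2 power_add)
  finally show ?thesis .
qed

lemma continuous_incr [continuous_intros]: "continuous_on S incr"
  unfolding incr_def by (intro continuous_intros matrix_vector_mult_linear_continuous_on)

lemma measurable_incr [measurable]: "incr \<in> borel_measurable borel"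
  by (intro borel_measurable_continuous_onI continuous_incr)

lemma norm_incr_le: "norm (incr z) \<le> (B * sqrt D * k) * (1 + norm z)"
  using eta_le[of z] D_pos by (simp add: eta_def field_simps)

lemma integrable_lyap:
  assumes "0 \<le> a" "a \<le> real N"
  shows "integrable std_gauss (\<lambda>z. lyap a (y + incr z) ^ j)"
proof (rule integrable_poly_growth[where C="((1 + (norm y + B * sqrt D * k)) ^ N) ^ j" and k="N * j"])
  fix z :: "real^'m"
  have B: "0 \<le> B * sqrt D * k" using B_ge_1 D_pos k_nonneg by simp
  have "norm (y + incr z) \<le> norm y + B * sqrt D * k * (1 + norm z)"
    by (intro order_trans[OF norm_triangle_ineq] add_left_mono norm_incr_le)
  also have "\<dots> \<le> norm y * (1 + norm z) + B * sqrt D * k * (1 + norm z)"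
    by (simp add: distrib_left)
  finally have n: "norm (y + incr z) \<le> (norm y + B * sqrt D * k) * (1 + norm z)" by (simp add: distrib_right)
  have "lyap a (y + incr z) \<le> lyap (real N) (y + incr z)" by (intro lyap_mono assms)
  also have "\<dots> = sqrt (1 + (norm (y + incr z))\<^sup>2) ^ N"
    by (simp add: lyap_def powr_half_sqrt[symmetric] powr_realpow[symmetric] powr_powr one_plus_sq_pos)
  also have "\<dots> \<le> ((1 + (norm y + B * sqrt D * k)) * (1 + norm z)) ^ N"
  proof (intro power_mono)
    have "sqrt (1 + (norm (y + incr z))\<^sup>2) \<le> 1 + norm (y + incr z)"
      by (rule real_le_lsqrt) (auto simp: power2_eq_square algebra_simps)
    also have "\<dots> \<le> (1 + norm z) + (norm y + B * sqrt D * k) * (1 + norm z)" using n by (intro add_mono) auto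
    finally show "sqrt (1 + (norm (y + incr z))\<^sup>2) \<le> (1 + (norm y + B * sqrt D * k)) * (1 + norm z)" by (simp add: algebra_simps)
  qed simp
  finally have "lyap a (y + incr z) ^ j \<le> (((1 + (norm y + B * sqrt D * k)) * (1 + norm z)) ^ N) ^ j"
    by (intro power_mono less_imp_le[OF lyap_pos])
  then show "\<bar>lyap a (y + incr z) ^ j\<bar> \<le> ((1 + (norm y + B * sqrt D * k)) ^ N) ^ j * (1 + norm z) ^ (N * j)"
    using lyap_pos[of a "y + incr z"] by (simp add: power_mult_distrib power_mult)
qed (intro borel_measurable_continuous_onI continuous_intros continuous_incr)

lemma integrable_incr:
  "integrable std_gauss (\<lambda>z. y \<bullet> incr z)" "integrable std_gauss (\<lambda>z. (y \<bullet> incr z)\<^sup>2)" "integrable std_gauss (\<lambda>z. (norm (incr z))\<^sup>2)"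
proof -
  have b: "norm (incr z) ^ j \<le> (B * sqrt D * k) ^ j * (1 + norm z) ^ j" for z j
    using power_mono[OF norm_incr_le[of z] norm_ge_zero, of j] by (simp add: power_mult_distrib)
  have c: "\<bar>y \<bullet> incr z\<bar> ^ j \<le> norm y ^ j * (B * sqrt D * k) ^ j * (1 + norm z) ^ j" for z j
  proof -
    have "\<bar>y \<bullet> incr z\<bar> ^ j \<le> (norm y * norm (incr z)) ^ j" by (intro power_mono Cauchy_Schwarz_ineq2) simp
    also have "\<dots> \<le> norm y ^ j * ((B * sqrt D * k) ^ j * (1 + norm z) ^ j)"
      unfolding power_mult_distrib by (intro mult_left_mono b[unfolded power_mult_distrib]) simp
    finally show ?thesis by (simp add: mult.assoc)
  qed
  show "integrable std_gauss (\<lambda>z. y \<bullet> incr z)"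
    using c[where j=1] by (intro integrable_poly_growth[where k=1]) auto
  show "integrable std_gauss (\<lambda>z. (y \<bullet> incr z)\<^sup>2)"
    using c[where j=2] by (intro integrable_poly_growth[where k=2]) auto
  show "integrable std_gauss (\<lambda>z. (norm (incr z))\<^sup>2)"
    using b[where j=2] by (intro integrable_poly_growth[where k=2]) auto
qed

lemma integral_inner_incr: "(LINT z|std_gauss. y \<bullet> incr z) = h * (y \<bullet> fv)"
  by (simp add: incr_def inner_add_right inner_matrix_vector integrable_inner_gauss integral_inner measure_std_gauss_UNIV)

lemma integral_inner_incr_sq: "(LINT z|std_gauss. (y \<bullet> incr z)\<^sup>2) \<le> (norm y)\<^sup>2 * ((h * norm fv)\<^sup>2 + h * (norm gv)\<^sup>2)"
proof -
  define v where "v = y v* gv"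
  have "(LINT z|std_gauss. (y \<bullet> incr z)\<^sup>2) = (LINT z|std_gauss. (h * (y \<bullet> fv))\<^sup>2 + 2 * sqrt h * (h * (y \<bullet> fv)) * (v \<bullet> z) + h * (v \<bullet> z)\<^sup>2)"
    using h_nonneg by (intro Bochner_Integration.integral_cong refl)
      (simp add: incr_def inner_add_right inner_matrix_vector v_def power2_eq_square algebra_simps)
  also have "\<dots> = (h * (y \<bullet> fv))\<^sup>2 + h * (norm v)\<^sup>2"
    by (simp add: integrable_inner_gauss integral_inner integral_inner_sq measure_std_gauss_UNIV)
  also have "\<dots> \<le> (h * (norm y * norm fv))\<^sup>2 + h * (norm y * norm gv)\<^sup>2"
  proof (intro add_mono mult_left_mono)
    have "\<bar>h * (y \<bullet> fv)\<bar> \<le> h * (norm y * norm fv)"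
      using h_nonneg Cauchy_Schwarz_ineq2[of y fv] by (auto simp: abs_mult intro: mult_left_mono)
    then have "\<bar>h * (y \<bullet> fv)\<bar>\<^sup>2 \<le> (h * (norm y * norm fv))\<^sup>2" by (intro power_mono) auto
    then show "(h * (y \<bullet> fv))\<^sup>2 \<le> (h * (norm y * norm fv))\<^sup>2" by simp
    show "(norm v)\<^sup>2 \<le> (norm y * norm gv)\<^sup>2" unfolding v_def by (intro power_mono norm_vector_matrix_le) simp
  qed (rule h_nonneg)
  finally show ?thesis by (simp add: power_mult_distrib algebra_simps)
qed

lemma integral_incr_sq: "(LINT z|std_gauss. (norm (incr z))\<^sup>2) = (h * norm fv)\<^sup>2 + h * (norm gv)\<^sup>2"
proof -
  define v where "v = fv v* gv"
  have i: "integrable std_gauss (\<lambda>z::real^'m. (norm (gv *v z))\<^sup>2)"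
  proof (rule integrable_poly_growth[where C="(norm gv)\<^sup>2" and k=2])
    fix z :: "real^'m"
    have "norm (gv *v z) \<le> norm gv * (1 + norm z)"
      by (rule order_trans[OF norm_matrix_vector_le]) (intro mult_left_mono, auto)
    then show "\<bar>(norm (gv *v z))\<^sup>2\<bar> \<le> (norm gv)\<^sup>2 * (1 + norm z)\<^sup>2" by (simp add: power_mono flip: power_mult_distrib)
  qed (intro borel_measurable_continuous_onI continuous_intros matrix_vector_mult_linear_continuous_on)
  have "(LINT z|std_gauss. (norm (incr z))\<^sup>2) = (LINT z|std_gauss. (h * norm fv)\<^sup>2 + 2 * sqrt h * h * (v \<bullet> z) + h * (norm (gv *v z))\<^sup>2)"
  proof (intro Bochner_Integration.integral_cong refl)
    fix z
    have "(norm (incr z))\<^sup>2 = h * h * (fv \<bullet> fv) + 2 * (h * sqrt h) * (fv \<bullet> (gv *v z)) + (sqrt h * sqrt h) * ((gv *v z) \<bullet> (gv *v z))"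
      unfolding power2_norm_eq_inner incr_def by (simp only: inner_add inner_scaleR_left inner_scaleR_right inner_commute[of "gv *v z" fv] algebra_simps)
    also have "\<dots> = (h * norm fv)\<^sup>2 + 2 * sqrt h * h * (v \<bullet> z) + h * (norm (gv *v z))\<^sup>2"
      using h_nonneg unfolding inner_matrix_vector[of fv] v_def power_mult_distrib power2_norm_eq_inner
      by (simp add: power2_eq_square mult_ac)
    finally show "(norm (incr z))\<^sup>2 = (h * norm fv)\<^sup>2 + 2 * sqrt h * h * (v \<bullet> z) + h * (norm (gv *v z))\<^sup>2" .
  qed
  also have "\<dots> = (h * norm fv)\<^sup>2 + h * (norm gv)\<^sup>2"
    by (simp add: integrable_inner_gauss integral_inner i integral_norm_matrix_sq measure_std_gauss_UNIV)
  finally show ?thesis .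
qed

end

text \<open>Up to the common factor \<open>a / (2 * (1 + |y|\<^sup>2))\<close>, the mean of the first-order term is
  \<open>2 h (y \<bullet> fv) + h |gv|\<^sup>2\<close> and that of the second-order term at most
  \<open>max 0 (a - 2) * h |gv|\<^sup>2\<close>, apart from multiples of \<open>|h fv|\<^sup>2 = O(h)\<close>. Since \<open>a \<le> p\<close> and
  \<open>2 \<le> p\<close>, the sum is at most \<open>2 h\<close> times the left-hand side of the monotonicity condition. The
  long constant is spelled out because it must not depend on \<open>y\<close>, \<open>fv\<close>, \<open>gv\<close> and \<open>h\<close>.\<close>
lemma (in em_step) lyap_growth:
  fixes a p C K1 K2 :: real
  assumes a: "0 \<le> a" "a \<le> p" and p: "2 \<le> p" and N: "3 \<le> N" "a \<le> real N" and C: "0 \<le> C" and K: "0 \<le> K1" "0 \<le> K2"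
    and taylor: "\<And>u. -1 \<le> u \<Longrightarrow> (1 + u) powr (a / 2)
      \<le> 1 + a / 2 * u + max 0 (a / 2 * (a / 2 - 1) / 2) * u\<^sup>2 + C * (\<bar>u\<bar> ^ 3 + \<bar>u\<bar> ^ N)"
    and mono: "y \<bullet> fv + (p - 1) / 2 * (norm gv)\<^sup>2 \<le> K1 * (norm y)\<^sup>2 + K2"
  shows "(LINT z|std_gauss. lyap a (y + incr z)) \<le> lyap a y * (1 + (a / 2 * (2 * (K1 + K2) + (p - 1) * B\<^sup>2) +
     (5 * max 0 (a / 2 * (a / 2 - 1) / 2) + C * (54 + 2 * 3 ^ N)) * B ^ (4 * N) * (LINT z|(std_gauss :: (real^'m) measure). (1 + norm z) ^ (2 * N))) * h)"
proof -
  define b where "b = a / 2"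
  define c where "c = max 0 (b * (b - 1) / 2)"
  define E where "E = 5 * c + C * (54 + 2 * 3 ^ N)"
  define \<mu> where "\<mu> = (LINT z|(std_gauss :: (real^'m) measure). (1 + norm z) ^ (2 * N))"
  define S where "S = (h * norm fv)\<^sup>2 + h * (norm gv)\<^sup>2"
  have c: "0 \<le> c" by (simp add: c_def)
  have b: "0 \<le> b" using a by (simp add: b_def)
  have a2: "a = 2 * b" by (simp add: b_def)
  have Eh: "0 \<le> E * h * B ^ (4 * N)" using c C h_nonneg B_ge_1 by (simp add: E_def)
  have S: "0 \<le> S" using h_nonneg by (simp add: S_def)
  have pointwise: "(1 + u z) powr b \<le> 1 + b * u z + 4 * c / D\<^sup>2 * (y \<bullet> incr z)\<^sup>2 + E * h * B ^ (4 * N) * (1 + norm z) ^ (2 * N)" for z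
  proof -
    define R where "R = h * B ^ (4 * N) * (1 + norm z) ^ (2 * N)"
    have R: "eta z ^ j \<le> R" if "3 \<le> j" "j \<le> 2 * N" for j
      using eta_power_le[OF that, of z] by (simp add: R_def)
    have "(1 + u z) powr b \<le> 1 + b * u z + c * (u z)\<^sup>2 + C * (\<bar>u z\<bar> ^ 3 + \<bar>u z\<bar> ^ N)"
      using taylor[OF u_ge] by (simp add: b_def c_def)
    moreover have "c * (u z)\<^sup>2 \<le> c * (4 * (y \<bullet> incr z)\<^sup>2 / D\<^sup>2 + 5 * R)"
      using u_sq_le[of z] R[of 3] R[of 4] N c by (intro mult_left_mono) auto
    moreover have "C * (\<bar>u z\<bar> ^ 3 + \<bar>u z\<bar> ^ N) \<le> C * (54 * R + 3 ^ N * (2 * R))"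
    proof (intro mult_left_mono add_mono)
      show "\<bar>u z\<bar> ^ 3 \<le> 54 * R" using abs_u_power_le[of z 3] R[of 3] R[of 6] N by simp
      have "\<bar>u z\<bar> ^ N \<le> 3 ^ N * (eta z ^ N + eta z ^ (2 * N))" by (rule abs_u_power_le)
      also have "\<dots> \<le> 3 ^ N * (2 * R)" using R[of N] R[of "2 * N"] N by (intro mult_left_mono) auto
      finally show "\<bar>u z\<bar> ^ N \<le> 3 ^ N * (2 * R)" .
    qed (rule C)
    moreover have "c * (4 * (y \<bullet> incr z)\<^sup>2 / D\<^sup>2 + 5 * R) + C * (54 * R + 3 ^ N * (2 * R)) = 4 * c / D\<^sup>2 * (y \<bullet> incr z)\<^sup>2 + E * R"
      by (simp add: E_def algebra_simps)
    ultimately have "(1 + u z) powr b \<le> 1 + b * u z + 4 * c / D\<^sup>2 * (y \<bullet> incr z)\<^sup>2 + E * R" by linarith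
    then show ?thesis by (simp add: R_def mult.assoc)
  qed
  have int_u: "integrable std_gauss u" "(LINT z|std_gauss. u z) = (2 * h * (y \<bullet> fv) + S) / D"
    unfolding u_def[abs_def] by (auto simp: integrable_incr integral_inner_incr integral_incr_sq S_def)
  have int_pow: "integrable std_gauss (\<lambda>z. (1 + u z) powr b)"
    using integrable_lyap[of a N 1] a N lyap_pos[of a y]
    by (simp add: lyap_ratio b_def less_imp_neq[OF lyap_pos, symmetric])
  have "(LINT z|std_gauss. (1 + u z) powr b) \<le>
     (LINT z|std_gauss. 1 + b * u z + 4 * c / D\<^sup>2 * (y \<bullet> incr z)\<^sup>2 + E * h * B ^ (4 * N) * (1 + norm z) ^ (2 * N))"
    by (intro integral_mono pointwise int_pow Bochner_Integration.integrable_add integrable_mult_right int_u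
      integrable_incr integrable_one_plus_norm_power) simp
  also have "\<dots> = 1 + b * ((2 * h * (y \<bullet> fv) + S) / D) + 4 * c / D\<^sup>2 * (LINT z|std_gauss. (y \<bullet> incr z)\<^sup>2) + E * h * B ^ (4 * N) * \<mu>"
    by (simp add: int_u integrable_incr integrable_one_plus_norm_power measure_std_gauss_UNIV \<mu>_def)
  also have "\<dots> \<le> 1 + b * ((2 * h * (y \<bullet> fv) + S) / D) + 4 * c / D\<^sup>2 * (D * S) + E * h * B ^ (4 * N) * \<mu>"
  proof (intro add_mono mult_left_mono order_refl)
    show "(LINT z|std_gauss. (y \<bullet> incr z)\<^sup>2) \<le> D * S"
      using integral_inner_incr_sq mult_right_mono[of "(norm y)\<^sup>2" D S] S by (simp add: S_def D_def)
  qed (use c b Eh in auto)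
  also have "\<dots> = 1 + (2 * h * b * (y \<bullet> fv) + (b + 4 * c) * S) / D + E * h * B ^ (4 * N) * \<mu>"
  proof -
    have "4 * c / D\<^sup>2 * (D * S) = 4 * c * S / D" using D_pos by (simp add: power2_eq_square)
    then show ?thesis by (simp add: add_divide_distrib distrib_left distrib_right mult_ac)
  qed
  also have "\<dots> \<le> 1 + (b * (2 * (K1 + K2) + (p - 1) * B\<^sup>2) * h * D) / D + E * h * B ^ (4 * N) * \<mu>"
  proof (intro add_mono divide_right_mono order_refl)
    \<comment> \<open>This is where the constant in the monotonicity condition is matched:
      \<open>b + 4 c = b (a - 1)\<close> if \<open>a \<ge> 2\<close>.\<close>
    have "b + 4 * c \<le> b * (p - 1)"
    proof (cases "b \<le> 1")
      case True
      then have "c = 0" using b by (simp add: c_def mult_nonneg_nonpos)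
      then show ?thesis using b p mult_left_mono[of 1 "p - 1" b] by simp
    next
      case False
      then have "b + 4 * c = b * (a - 1)" by (simp add: c_def a2) (simp add: algebra_simps)
      then show ?thesis using b a mult_left_mono[of "a - 1" "p - 1" b] by simp
    qed
    then have "2 * h * b * (y \<bullet> fv) + (b + 4 * c) * S \<le> 2 * h * b * (y \<bullet> fv) + (b * (p - 1)) * S"
      using S by (intro add_left_mono mult_right_mono) auto
    also have "\<dots> = 2 * h * b * (y \<bullet> fv + (p - 1) / 2 * (norm gv)\<^sup>2) + b * (p - 1) * (h * norm fv)\<^sup>2"
      by (simp add: S_def field_simps)
    also have "\<dots> \<le> 2 * h * b * ((K1 + K2) * D) + b * (p - 1) * (B\<^sup>2 * D * h)"
    proof (intro add_mono mult_left_mono)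
      have "K1 * (norm y)\<^sup>2 + K2 \<le> K1 * D + K2 * D"
        using K D_pos by (intro add_mono) (auto simp: D_def mult_left_mono distrib_left)
      then show "y \<bullet> fv + (p - 1) / 2 * (norm gv)\<^sup>2 \<le> (K1 + K2) * D" using mono by (simp add: distrib_right)
      show "(h * norm fv)\<^sup>2 \<le> B\<^sup>2 * D * h" using drift_sq_le by (simp add: D_def)
    qed (use h_nonneg b p in auto)
    also have "\<dots> = b * (2 * (K1 + K2) + (p - 1) * B\<^sup>2) * h * D" by (simp add: algebra_simps)
    finally show "2 * h * b * (y \<bullet> fv) + (b + 4 * c) * S \<le> b * (2 * (K1 + K2) + (p - 1) * B\<^sup>2) * h * D" .
  qed (use D_pos in auto)
  also have "\<dots> = 1 + (b * (2 * (K1 + K2) + (p - 1) * B\<^sup>2) + E * B ^ (4 * N) * \<mu>) * h"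
    using D_pos by (simp add: distrib_right mult_ac) (simp add: algebra_simps)
  finally have "(LINT z|std_gauss. (1 + u z) powr b) \<le> 1 + (b * (2 * (K1 + K2) + (p - 1) * B\<^sup>2) + E * B ^ (4 * N) * \<mu>) * h" .
  then have "lyap a y * (LINT z|std_gauss. (1 + u z) powr b) \<le> lyap a y * (1 + (b * (2 * (K1 + K2) + (p - 1) * B\<^sup>2) + E * B ^ (4 * N) * \<mu>) * h)"
    by (intro mult_left_mono less_imp_le[OF lyap_pos])
  then show ?thesis by (simp add: lyap_ratio b_def c_def E_def \<mu>_def)
qed

text \<open>To leading order and up to a constant the left-hand side is
  \<open>lyap (2 * a - 2) y * |gv|\<^sup>2 * h\<close>, and \<open>|gv|\<^sup>2\<close> grows like \<open>lyap l y\<close>. The exponents add up to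
  \<open>2 * a - 2 + l = p\<close>.\<close>
lemma (in em_step) lyap_fluctuation:
  fixes a p l C K3 :: real
  assumes a: "0 \<le> a" "2 * a = p + 2 - l" and l: "2 \<le> l" and N: "3 \<le> N" "a \<le> real N" and C: "0 \<le> C" and K: "0 \<le> K3"
    and dist: "\<And>u. -1 \<le> u \<Longrightarrow> \<bar>(1 + u) powr (a / 2) - 1\<bar> \<le> C * (\<bar>u\<bar> + \<bar>u\<bar> ^ N)"
    and gl: "(norm gv)\<^sup>2 \<le> K3 * (1 + norm y powr l)"
  shows "(LINT z|std_gauss. (lyap a (y + incr z) - lyap a y)\<^sup>2) \<le> (18 * C\<^sup>2 * (B\<^sup>2 + 2 * K3) +
     2 * C\<^sup>2 * (9 + 2 * 9 ^ N) * B ^ (8 * N) * (LINT z|(std_gauss :: (real^'m) measure). (1 + norm z) ^ (4 * N))) * (lyap p y * h)"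
proof -
  define b where "b = a / 2"
  define E where "E = 2 * C\<^sup>2 * (9 + 2 * 9 ^ N)"
  define \<mu> where "\<mu> = (LINT z|(std_gauss :: (real^'m) measure). (1 + norm z) ^ (4 * N))"
  define S where "S = (h * norm fv)\<^sup>2 + h * (norm gv)\<^sup>2"
  have pointwise: "((1 + u z) powr b - 1)\<^sup>2 \<le> 18 * C\<^sup>2 / D * (norm (incr z))\<^sup>2 + E * h * B ^ (8 * N) * (1 + norm z) ^ (4 * N)" for z
  proof -
    define R where "R = h * B ^ (8 * N) * (1 + norm z) ^ (4 * N)"
    have R: "eta z ^ j \<le> R" if "3 \<le> j" "j \<le> 4 * N" for j
      using eta_power_le[OF that, of z] by (simp add: R_def)
    have "((1 + u z) powr b - 1)\<^sup>2 = \<bar>(1 + u z) powr b - 1\<bar>\<^sup>2" by simp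
    also have "\<dots> \<le> (C * (\<bar>u z\<bar> + \<bar>u z\<bar> ^ N))\<^sup>2"
      using dist[OF u_ge] by (intro power_mono) (auto simp: b_def)
    also have "\<dots> \<le> C\<^sup>2 * (2 * (\<bar>u z\<bar> ^ 2 + \<bar>u z\<bar> ^ (2 * N)))"
      unfolding power_mult_distrib using sum_squares_bound[of "\<bar>u z\<bar>" "\<bar>u z\<bar> ^ N"]
      by (intro mult_left_mono) (auto simp: power2_sum power_mult[symmetric] mult.commute)
    also have "\<dots> \<le> C\<^sup>2 * (2 * (9 * ((eta z)\<^sup>2 + R) + 9 ^ N * (2 * R)))"
    proof (intro mult_left_mono add_mono)
      show "\<bar>u z\<bar> ^ 2 \<le> 9 * ((eta z)\<^sup>2 + R)" using abs_u_power_le[of z 2] R[of 4] N by simp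
      have "\<bar>u z\<bar> ^ (2 * N) \<le> 3 ^ (2 * N) * (eta z ^ (2 * N) + eta z ^ (2 * (2 * N)))" by (rule abs_u_power_le)
      also have "\<dots> = 9 ^ N * (eta z ^ (2 * N) + eta z ^ (4 * N))" by (simp add: power_mult)
      also have "\<dots> \<le> 9 ^ N * (2 * R)" using R[of "2 * N"] R[of "4 * N"] N by (intro mult_left_mono) auto
      finally show "\<bar>u z\<bar> ^ (2 * N) \<le> 9 ^ N * (2 * R)" .
    qed auto
    also have "\<dots> = 18 * C\<^sup>2 * (eta z)\<^sup>2 + E * R" by (simp add: E_def algebra_simps)
    finally show ?thesis by (simp add: R_def mult.assoc eta_sq)
  qed
  have E: "0 \<le> E" by (simp add: E_def)
  have \<mu>: "0 \<le> \<mu>" unfolding \<mu>_def by (intro Bochner_Integration.integral_nonneg) auto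
  have int: "integrable std_gauss (\<lambda>z. 18 * C\<^sup>2 / D * (norm (incr z))\<^sup>2 + E * h * B ^ (8 * N) * (1 + norm z) ^ (4 * N))"
    by (intro Bochner_Integration.integrable_add integrable_mult_right integrable_incr integrable_one_plus_norm_power)
  have meas: "(\<lambda>z. ((1 + u z) powr b - 1)\<^sup>2) \<in> borel_measurable std_gauss"
    unfolding u_def by measurable
  have "(LINT z|std_gauss. ((1 + u z) powr b - 1)\<^sup>2)
      \<le> (LINT z|std_gauss. 18 * C\<^sup>2 / D * (norm (incr z))\<^sup>2 + E * h * B ^ (8 * N) * (1 + norm z) ^ (4 * N))"
  proof (rule integral_mono[OF Bochner_Integration.integrable_bound[OF int meas] int])
    show "AE z in std_gauss. norm (((1 + u z) powr b - 1)\<^sup>2) \<le> norm (18 * C\<^sup>2 / D * (norm (incr z))\<^sup>2 + E * h * B ^ (8 * N) * (1 + norm z) ^ (4 * N))"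
      by (intro AE_I2) (simp only: real_norm_def abs_of_nonneg[OF zero_le_power2] order_trans[OF pointwise abs_ge_self])
  qed (rule pointwise)
  also have "\<dots> = 18 * C\<^sup>2 * (S / D) + E * B ^ (8 * N) * \<mu> * h"
    by (simp add: integrable_incr integrable_one_plus_norm_power \<mu>_def integral_incr_sq S_def)
  finally have 1: "(LINT z|std_gauss. ((1 + u z) powr b - 1)\<^sup>2) \<le> 18 * C\<^sup>2 * (S / D) + E * B ^ (8 * N) * \<mu> * h" .
  have D: "D = lyap 2 y" using D_pos by (simp add: lyap_def D_def)
  have "S \<le> B\<^sup>2 * D * h + h * (K3 * (2 * lyap l y))"
    unfolding S_def
  proof (intro add_mono mult_left_mono order_trans[OF gl])
    show "(h * norm fv)\<^sup>2 \<le> B\<^sup>2 * D * h" using drift_sq_le by (simp add: D_def)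
    show "1 + norm y powr l \<le> 2 * lyap l y" using l lyap_ge_1[of l y] norm_powr_le_lyap[of l y] by simp
  qed (use h_nonneg K in auto)
  then have "lyap (2 * a) y * (S / D) \<le> lyap (2 * a) y * ((B\<^sup>2 * D * h + h * (K3 * (2 * lyap l y))) / D)"
    using D_pos by (intro mult_left_mono less_imp_le[OF lyap_pos] divide_right_mono) auto
  also have "\<dots> = B\<^sup>2 * h * lyap (2 * a) y + 2 * K3 * h * (lyap (2 * a) y * lyap l y / lyap 2 y)"
    using D_pos by (simp add: field_simps D[symmetric])
  also have "lyap (2 * a) y * lyap l y / lyap 2 y = lyap p y"
  proof -
    have "lyap (2 * a) y * lyap l y = lyap p y * lyap 2 y" unfolding lyap_mult using a by (simp add: algebra_simps)
    then show ?thesis using lyap_pos[of 2 y] by simp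
  qed
  also have "B\<^sup>2 * h * lyap (2 * a) y \<le> B\<^sup>2 * h * lyap p y"
    using h_nonneg a l by (intro mult_left_mono lyap_mono) auto
  finally have 2: "lyap (2 * a) y * (S / D) \<le> (B\<^sup>2 + 2 * K3) * (lyap p y * h)" by (simp add: algebra_simps)
  have 3: "lyap (2 * a) y \<le> lyap p y" using a l by (intro lyap_mono) auto
  have "(lyap a (y + incr z) - lyap a y)\<^sup>2 = lyap (2 * a) y * ((1 + u z) powr b - 1)\<^sup>2" for z
    unfolding lyap_ratio lyap_power2[symmetric] b_def by (simp add: power_mult_distrib[symmetric] algebra_simps)
  then have "(LINT z|std_gauss. (lyap a (y + incr z) - lyap a y)\<^sup>2) = lyap (2 * a) y * (LINT z|std_gauss. ((1 + u z) powr b - 1)\<^sup>2)"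
    by simp
  also have "\<dots> \<le> lyap (2 * a) y * (18 * C\<^sup>2 * (S / D) + E * B ^ (8 * N) * \<mu> * h)"
    by (intro mult_left_mono 1 less_imp_le[OF lyap_pos])
  also have "\<dots> = 18 * C\<^sup>2 * (lyap (2 * a) y * (S / D)) + E * B ^ (8 * N) * \<mu> * h * lyap (2 * a) y" by (simp add: algebra_simps)
  also have "\<dots> \<le> 18 * C\<^sup>2 * ((B\<^sup>2 + 2 * K3) * (lyap p y * h)) + E * B ^ (8 * N) * \<mu> * h * lyap p y"
    using E \<mu> h_nonneg B_ge_1 by (intro add_mono mult_left_mono 2 3) auto
  also have "\<dots> = (18 * C\<^sup>2 * (B\<^sup>2 + 2 * K3) + E * B ^ (8 * N) * \<mu>) * (lyap p y * h)" by (simp add: algebra_simps)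
  finally show ?thesis by (simp add: E_def \<mu>_def)
qed

section \<open>Consequences of the timestep condition\<close>

text \<open>Since \<open>|fv| * d powr \<gamma> \<le> 1 + |y|\<close>, the drift part is at most \<open>(1 + |y|) * h powr (1 - \<gamma>)\<close>
  and the square of the diffusion part at most \<open>(1 + |y|)\<^sup>2 * h powr (1 - \<gamma>)\<close>, where
  \<open>1 - \<gamma> \<ge> 2/3\<close>. The step length \<open>h\<close> may be smaller than the timestep \<open>d\<close>, because the last step
  is cut off at the terminal time.\<close>
lemma em_step_of_timestep:
  fixes y fv :: "real ^ 'd" and gv :: "real ^ 'm ^ 'd"
  assumes \<gamma>: "0 < \<gamma>" "\<gamma> \<le> 1 / 3" and h: "0 \<le> h" "h \<le> d" "h \<le> T"
    and f: "norm fv * d powr \<gamma> \<le> 1 + norm y" and g: "(norm gv)\<^sup>2 * d powr \<gamma> \<le> (1 + norm y)\<^sup>2"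
  shows "em_step y fv gv h (h powr (1 / 3)) (2 * (1 + T)\<^sup>2)"
proof -
  define D where "D = 1 + (norm y)\<^sup>2"
  define k where "k = h powr (1 / 3)"
  define L where "L = 1 + T"
  have L: "1 \<le> L" using h by (simp add: L_def)
  have LL: "L \<le> L\<^sup>2" using L by (simp add: power2_eq_square)
  have k: "0 \<le> k" by (simp add: k_def)
  have k3: "h = k ^ 3"
    using h by (cases "h = 0") (auto simp: k_def powr_powr simp flip: powr_realpow)
  have kL: "k \<le> L"
  proof -
    have "k \<le> L powr (1 / 3)" unfolding k_def using h by (intro powr_mono2) (auto simp: L_def)
    also have "\<dots> \<le> L powr 1" using L by (intro powr_mono) auto
    finally show ?thesis using L by simp
  qed
  have D: "1 \<le> D" by (simp add: D_def)
  have y: "1 + norm y \<le> 2 * sqrt D"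
  proof -
    have "norm y \<le> sqrt D" unfolding D_def by (rule real_le_rsqrt) simp
    moreover have "1 \<le> sqrt D" using D by simp
    ultimately show ?thesis by linarith
  qed
  have y2: "(1 + norm y)\<^sup>2 \<le> 4 * D"
  proof -
    have "(1 + norm y)\<^sup>2 \<le> (2 * sqrt D)\<^sup>2" using y by (intro power_mono) auto
    then show ?thesis using D by (simp add: power_mult_distrib)
  qed
  have h\<gamma>: "h powr \<gamma> \<le> d powr \<gamma>" using h \<gamma> by (intro powr_mono2) auto
  have split: "h = h powr \<gamma> * h powr (1 - \<gamma>)"
    using h by (cases "h = 0") (simp_all add: powr_add[symmetric])
  have hp: "h powr (1 - \<gamma>) \<le> L * k\<^sup>2"
  proof (cases "h = 0")
    case False
    then have h0: "0 < h" using h by simp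
    have "h powr (1 - \<gamma>) = h powr (1 / 3 - \<gamma>) * k\<^sup>2"
      using h0 by (simp add: k_def power2_eq_square powr_add[symmetric])
    also have "h powr (1 / 3 - \<gamma>) \<le> L powr (1 / 3 - \<gamma>)" using h \<gamma> by (intro powr_mono2) (auto simp: L_def)
    also have "L powr (1 / 3 - \<gamma>) \<le> L powr 1" using L \<gamma> by (intro powr_mono) auto
    finally show ?thesis using L by (simp add: mult_right_mono)
  qed (use L in auto)
  have fh: "h * norm fv \<le> 2 * sqrt D * (L * k\<^sup>2)"
  proof -
    have "h * norm fv = (norm fv * h powr \<gamma>) * h powr (1 - \<gamma>)" using split by (metis mult.assoc mult.commute)
    also have "norm fv * h powr \<gamma> \<le> 1 + norm y" using order_trans[OF mult_left_mono[OF h\<gamma>] f] by simp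
    also have "(1 + norm y) * h powr (1 - \<gamma>) \<le> (2 * sqrt D) * (L * k\<^sup>2)"
      using D y hp by (intro mult_mono) auto
    finally show ?thesis by (simp add: mult_right_mono)
  qed
  have gh: "h * (norm gv)\<^sup>2 \<le> 4 * D * (L * k\<^sup>2)"
  proof -
    have "h * (norm gv)\<^sup>2 = ((norm gv)\<^sup>2 * h powr \<gamma>) * h powr (1 - \<gamma>)" using split by (metis mult.assoc mult.commute)
    also have "(norm gv)\<^sup>2 * h powr \<gamma> \<le> (1 + norm y)\<^sup>2" using order_trans[OF mult_left_mono[OF h\<gamma>] g] by simp
    also have "(1 + norm y)\<^sup>2 * h powr (1 - \<gamma>) \<le> (4 * D) * (L * k\<^sup>2)"
      using D y2 hp by (intro mult_mono) auto
    finally show ?thesis by (simp add: mult_right_mono)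
  qed
  show ?thesis
    unfolding k_def[symmetric] L_def[symmetric]
  proof
    show "h = k ^ 3" by (rule k3)
    show "0 \<le> k" by (rule k)
    show "k \<le> 2 * L\<^sup>2" using kL LL L by linarith
    show "1 \<le> 2 * L\<^sup>2" using LL L by linarith
    have Lk: "L * k\<^sup>2 \<le> L\<^sup>2 * k" using mult_mono[of L L "k * k" "L * k"] kL L k
      by (simp add: power2_eq_square mult_right_mono mult.assoc)
    show "h * norm fv \<le> 2 * L\<^sup>2 * sqrt (1 + (norm y)\<^sup>2) * k"
    proof -
      have "2 * sqrt D * (L * k\<^sup>2) \<le> 2 * sqrt D * (L\<^sup>2 * k)" using D Lk by (intro mult_left_mono) auto
      with fh show ?thesis by (simp add: D_def mult_ac)
    qed
    show "(h * norm fv)\<^sup>2 \<le> (2 * L\<^sup>2)\<^sup>2 * (1 + (norm y)\<^sup>2) * h"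
    proof -
      have "(h * norm fv)\<^sup>2 \<le> (2 * sqrt D * (L * k\<^sup>2))\<^sup>2" using fh h by (intro power_mono) auto
      also have "\<dots> = (4 * D * L\<^sup>2 * h) * k" using D by (simp add: power_mult_distrib k3 power2_eq_square power3_eq_cube)
      also have "\<dots> \<le> (4 * D * L\<^sup>2 * h) * L\<^sup>2" using kL LL D h by (intro mult_left_mono) auto
      finally show ?thesis by (simp add: D_def power2_eq_square mult_ac)
    qed
    show "sqrt h * norm gv \<le> 2 * L\<^sup>2 * sqrt (1 + (norm y)\<^sup>2) * k"
    proof (rule power2_le_imp_le)
      have "(sqrt h * norm gv)\<^sup>2 = h * (norm gv)\<^sup>2" using h by (simp add: power_mult_distrib)
      also have "\<dots> \<le> 4 * D * (L * k\<^sup>2)" by (rule gh)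
      also have "\<dots> \<le> 4 * D * ((L\<^sup>2)\<^sup>2 * k\<^sup>2)"
      proof (intro mult_left_mono mult_right_mono)
        have "L\<^sup>2 \<le> (L\<^sup>2)\<^sup>2" using L LL by (intro self_le_power) auto
        then show "L \<le> (L\<^sup>2)\<^sup>2" using LL by linarith
      qed (use D in auto)
      also have "\<dots> = (2 * L\<^sup>2 * sqrt (1 + (norm y)\<^sup>2) * k)\<^sup>2" using D by (simp add: power_mult_distrib D_def)
      finally show "(sqrt h * norm gv)\<^sup>2 \<le> (2 * L\<^sup>2 * sqrt (1 + (norm y)\<^sup>2) * k)\<^sup>2" .
      show "0 \<le> 2 * L\<^sup>2 * sqrt (1 + (norm y)\<^sup>2) * k" using k by simp
    qed
  qed
qed

text \<open>The quantifiers express that one constant serves all steps.\<close>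
lemma exists_growth_const:
  assumes a: "0 \<le> a" "a \<le> p" and p: "2 \<le> p" and K: "0 \<le> K1" "0 \<le> K2" and B: "0 \<le> B"
  shows "\<exists>C\<ge>0. \<forall>y fv (gv :: real^'m^'d) h k. em_step y fv gv h k B \<longrightarrow>
    y \<bullet> fv + (p - 1) / 2 * (norm gv)\<^sup>2 \<le> K1 * (norm y)\<^sup>2 + K2 \<longrightarrow>
    (LINT z|std_gauss. lyap a (y + em_step.incr fv gv h z)) \<le> lyap a y * (1 + C * h)"
proof -
  define N where "N = max 3 (nat \<lceil>a\<rceil>)"
  have N: "3 \<le> N" "a \<le> real N" "a / 2 \<le> real N" using a by (auto simp: N_def le_max_iff_disj) linarith+
  obtain C where C: "C \<ge> 0" and taylor: "\<And>u. -1 \<le> u \<Longrightarrow> (1 + u) powr (a / 2)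
      \<le> 1 + a / 2 * u + max 0 (a / 2 * (a / 2 - 1) / 2) * u\<^sup>2 + C * (\<bar>u\<bar> ^ 3 + \<bar>u\<bar> ^ N)"
    using powr_one_plus_upper[of "a / 2" N] a N by auto
  define C' where "C' = a / 2 * (2 * (K1 + K2) + (p - 1) * B\<^sup>2) +
     (5 * max 0 (a / 2 * (a / 2 - 1) / 2) + C * (54 + 2 * 3 ^ N)) * B ^ (4 * N) * (LINT z|(std_gauss :: (real^'m) measure). (1 + norm z) ^ (2 * N))"
  have "(LINT z|std_gauss. lyap a (y + em_step.incr fv gv h z)) \<le> lyap a y * (1 + C' * h)"
    if "em_step y fv gv h k B" "y \<bullet> fv + (p - 1) / 2 * (norm gv)\<^sup>2 \<le> K1 * (norm y)\<^sup>2 + K2"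
    for y fv and gv :: "real^'m^'d" and h k
    unfolding C'_def by (rule em_step.lyap_growth[OF that(1) a p N(1,2) C K taylor that(2)])
  moreover have "0 \<le> C'" unfolding C'_def using a p K C B
    by (intro add_nonneg_nonneg mult_nonneg_nonneg Bochner_Integration.integral_nonneg) auto
  ultimately show ?thesis by blast
qed

lemma exists_fluctuation_const:
  assumes a: "0 \<le> a" "2 * a = p + 2 - l" and l: "2 \<le> l" and K: "0 \<le> K3" and B: "0 \<le> B"
  shows "\<exists>C\<ge>0. \<forall>y fv (gv :: real^'m^'d) h k. em_step y fv gv h k B \<longrightarrow>
    (norm gv)\<^sup>2 \<le> K3 * (1 + norm y powr l) \<longrightarrow>
    (LINT z|std_gauss. (lyap a (y + em_step.incr fv gv h z) - lyap a y)\<^sup>2) \<le> C * (lyap p y * h)"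
proof -
  define N where "N = max 3 (nat \<lceil>a\<rceil>)"
  have N: "3 \<le> N" "a \<le> real N" "a / 2 \<le> real N" using a by (auto simp: N_def le_max_iff_disj) linarith+
  obtain C where C: "C \<ge> 0" and dist: "\<And>u. -1 \<le> u \<Longrightarrow> \<bar>(1 + u) powr (a / 2) - 1\<bar> \<le> C * (\<bar>u\<bar> + \<bar>u\<bar> ^ N)"
    using powr_one_plus_dist[of "a / 2" N] a N by auto
  define C' where "C' = 18 * C\<^sup>2 * (B\<^sup>2 + 2 * K3) +
     2 * C\<^sup>2 * (9 + 2 * 9 ^ N) * B ^ (8 * N) * (LINT z|(std_gauss :: (real^'m) measure). (1 + norm z) ^ (4 * N))"
  have "(LINT z|std_gauss. (lyap a (y + em_step.incr fv gv h z) - lyap a y)\<^sup>2) \<le> C' * (lyap p y * h)"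
    if "em_step y fv gv h k B" "(norm gv)\<^sup>2 \<le> K3 * (1 + norm y powr l)"
    for y fv and gv :: "real^'m^'d" and h k
    unfolding C'_def by (rule em_step.lyap_fluctuation[OF that(1) a l N(1,2) C K dist that(2)])
  moreover have "0 \<le> C'" unfolding C'_def using K C B
    by (intro add_nonneg_nonneg mult_nonneg_nonneg Bochner_Integration.integral_nonneg) auto
  ultimately show ?thesis by blast
qed

context em_step begin

lemma h_le: "h \<le> B ^ 3" unfolding h_eq using k_nonneg k_le by (intro power_mono)

text \<open>The bound on the square of the drift is raised to the power \<open>q / 2 \<ge> 1\<close>; spare powers of
  \<open>h\<close> are bounded.\<close>
lemma drift_power_le:
  assumes q: "2 \<le> q" "q \<le> p"
  shows "(h * norm fv) powr q \<le> (B powr q * (B ^ 3) powr (q / 2 - 1)) * (lyap p y * h)"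
proof -
  have "(h * norm fv) powr q = ((h * norm fv)\<^sup>2) powr (q / 2)"
    using h_nonneg by (cases "h * norm fv = 0") (auto simp: powr_powr simp flip: powr_numeral)
  also have "\<dots> \<le> (B\<^sup>2 * D * h) powr (q / 2)" using drift_sq_le q by (intro powr_mono2) (auto simp: D_def)
  also have "\<dots> = B powr q * lyap q y * h powr (q / 2)"
  proof -
    have "(B\<^sup>2) powr (q / 2) = B powr q" using B_ge_1 by (simp add: powr_powr flip: powr_numeral)
    then show ?thesis using B_ge_1 D_pos h_nonneg by (simp add: powr_mult lyap_def D_def)
  qed
  also have "\<dots> \<le> B powr q * lyap p y * (h * (B ^ 3) powr (q / 2 - 1))"
  proof (rule mult_mono)
    show "B powr q * lyap q y \<le> B powr q * lyap p y" using q by (intro mult_left_mono lyap_mono) auto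
    show "h powr (q / 2) \<le> h * (B ^ 3) powr (q / 2 - 1)"
    proof (cases "h = 0")
      case False
      then have "h powr (q / 2) = h * h powr (q / 2 - 1)" using h_nonneg by (simp add: powr_diff)
      also have "\<dots> \<le> h * (B ^ 3) powr (q / 2 - 1)" using h_nonneg h_le q by (intro mult_left_mono powr_mono2) auto
      finally show ?thesis .
    qed (use B_ge_1 in simp)
  qed (use less_imp_le[OF lyap_pos[of p y]] in auto)
  finally show ?thesis by (simp add: mult_ac)
qed

text \<open>Two of the \<open>q\<close> factors \<open>|gv|\<close> are estimated by the polynomial growth of \<open>g\<close>, which
  produces the full power of \<open>h\<close>, and the remaining \<open>q - 2\<close> by the timestep condition.\<close>
lemma diffusion_power_le:
  assumes q: "2 \<le> q" and qp: "q = p + 2 - l" and l: "0 \<le> l" and K: "0 \<le> K3"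
    and gl: "(norm gv)\<^sup>2 \<le> K3 * (1 + norm y powr l)"
  shows "norm gv powr q * h powr (q / 2) \<le> (2 * K3 * (B\<^sup>2) powr (q - 2)) * (lyap p y * h)"
proof -
  have g: "(norm gv)\<^sup>2 \<le> K3 * (2 * lyap l y)"
  proof -
    have "1 + norm y powr l \<le> 2 * lyap l y" using l lyap_ge_1[of l y] norm_powr_le_lyap[of l y] by simp
    then show ?thesis using gl mult_left_mono[OF _ K] by fastforce
  qed
  have "norm gv powr q * h powr (q / 2) = (sqrt h * norm gv) powr q"
    using h_nonneg by (simp add: powr_mult powr_half_sqrt[symmetric] powr_powr)
  also have "\<dots> = (sqrt h * norm gv) powr (q - 2) * (sqrt h * norm gv)\<^sup>2"
    using h_nonneg by (cases "sqrt h * norm gv = 0") (auto simp: powr_diff simp flip: powr_numeral)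
  also have "\<dots> \<le> (B\<^sup>2 * sqrt D) powr (q - 2) * (h * (K3 * (2 * lyap l y)))"
  proof (rule mult_mono)
    have "sqrt h * norm gv \<le> B * sqrt D * k" using diffusion_le by (simp add: D_def)
    also have "\<dots> \<le> B * sqrt D * B" using k_le B_ge_1 D_pos by (intro mult_left_mono) auto
    finally have "sqrt h * norm gv \<le> B\<^sup>2 * sqrt D" by (simp add: power2_eq_square mult_ac)
    then show "(sqrt h * norm gv) powr (q - 2) \<le> (B\<^sup>2 * sqrt D) powr (q - 2)" using q h_nonneg by (intro powr_mono2) auto
    show "(sqrt h * norm gv)\<^sup>2 \<le> h * (K3 * (2 * lyap l y))" using g h_nonneg by (simp add: power_mult_distrib mult_left_mono)
  qed (use q h_nonneg in auto)
  also have "(B\<^sup>2 * sqrt D) powr (q - 2) = (B\<^sup>2) powr (q - 2) * lyap (q - 2) y"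
    using D_pos by (simp add: powr_mult powr_half_sqrt[symmetric] powr_powr lyap_def D_def diff_divide_distrib)
  also have "(B\<^sup>2) powr (q - 2) * lyap (q - 2) y * (h * (K3 * (2 * lyap l y))) = (2 * K3 * (B\<^sup>2) powr (q - 2)) * ((lyap (q - 2) y * lyap l y) * h)"
    by (simp add: mult_ac)
  also have "lyap (q - 2) y * lyap l y = lyap p y" unfolding lyap_mult qp by simp
  finally show ?thesis .
qed

end

section \<open>Brownian motion at stopping times\<close>

lemma distr_scale_std_normal:
  assumes "0 < s"
  shows "distr std_normal borel (\<lambda>x. s * x) = density lborel (\<lambda>x. ennreal (normal_density 0 s x))"
proof -
  interpret prob_space std_normal by (rule prob_space_std_normal)
  have "distributed std_normal lborel (\<lambda>x. x) (\<lambda>x. ennreal (std_normal_density x))"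
    unfolding distributed_def by (auto simp: distr_id2 intro!: distr_id2)
  from normal_density_affine[OF this _ , of s 0] assms
  have "distributed std_normal lborel (\<lambda>x. s * x) (\<lambda>x. ennreal (normal_density 0 s x))" by simp
  then have "distr std_normal lborel (\<lambda>x. s * x) = density lborel (\<lambda>x. ennreal (normal_density 0 s x))"
    by (simp add: distributed_def)
  moreover have "distr std_normal lborel (\<lambda>x. s * x) = distr std_normal borel (\<lambda>x. s * x)" by (rule distr_cong) auto
  ultimately show ?thesis by simp
qed

text \<open>Independent coordinates with these marginals determine the joint law as a product, and
  \<open>std_gauss\<close> is such a product by definition.\<close>
lemma (in prob_space) gaussian_vector_law:
  fixes X :: "'a \<Rightarrow> real ^ 'm"
  assumes s: "0 < s"
    and indep: "indep_vars (\<lambda>_. borel) (\<lambda>i \<omega>. X \<omega> $ i) UNIV"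
    and comp: "\<And>i. distributed M lborel (\<lambda>\<omega>. X \<omega> $ i) (\<lambda>x. ennreal (normal_density 0 s x))"
  shows "distr M borel X = distr std_gauss borel (\<lambda>z. s *\<^sub>R z)"
proof -
  define G where "G = density lborel (\<lambda>x. ennreal (normal_density 0 s x))"
  have G: "prob_space G" "sets G = sets borel" using s by (auto simp: G_def prob_space_normal_density)
  have scale: "distr std_normal G (\<lambda>x. s * x) = G"
    using distr_scale_std_normal[OF s] by (simp add: G_def[symmetric] cong: distr_cong) (metis G(2) distr_cong)
  have rv: "(\<lambda>\<omega>. X \<omega> $ i) \<in> borel_measurable M" for i
    using comp[of i] by (simp add: distributed_def)
  have marg: "distr M borel (\<lambda>\<omega>. X \<omega> $ i) = G" for i
  proof -
    have "distr M borel (\<lambda>\<omega>. X \<omega> $ i) = distr M lborel (\<lambda>\<omega>. X \<omega> $ i)" by (rule distr_cong) auto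
    then show ?thesis using comp[of i] by (simp add: distributed_def G_def)
  qed
  have sP: "sets (Pi\<^sub>M (UNIV::'m set) (\<lambda>_. G)) = sets (Pi\<^sub>M (UNIV::'m set) (\<lambda>_. std_normal))"
    "sets (Pi\<^sub>M (UNIV::'m set) (\<lambda>_. borel)) = sets (Pi\<^sub>M (UNIV::'m set) (\<lambda>_. std_normal))"
    by (auto intro!: sets_PiM_cong simp: G)
  have vl: "(\<lambda>x. \<chi> i. x i) \<in> (Pi\<^sub>M (UNIV::'m set) (\<lambda>_. G)) \<rightarrow>\<^sub>M borel" "(\<lambda>x. \<chi> i. x i) \<in> (Pi\<^sub>M (UNIV::'m set) (\<lambda>_. borel)) \<rightarrow>\<^sub>M (borel :: (real^'m) measure)"
    using measurable_vec_lambda[where 'm='m] by (simp_all only: measurable_cong_sets[OF sP(1) refl] measurable_cong_sets[OF sP(2) refl])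
  have jl: "(\<lambda>\<omega>. \<lambda>i\<in>(UNIV::'m set). X \<omega> $ i) \<in> M \<rightarrow>\<^sub>M Pi\<^sub>M UNIV (\<lambda>_. borel)"
    by (intro measurable_restrict rv)
  have cl: "compose UNIV (\<lambda>x. s * x) \<in> Pi\<^sub>M (UNIV::'m set) (\<lambda>_. std_normal) \<rightarrow>\<^sub>M Pi\<^sub>M UNIV (\<lambda>_. G)"
    unfolding compose_def
  proof (rule measurable_restrict)
    fix i :: 'm
    have "(\<lambda>x. x i) \<in> Pi\<^sub>M (UNIV::'m set) (\<lambda>_. std_normal) \<rightarrow>\<^sub>M std_normal" by (rule measurable_component_singleton) simp
    then have "(\<lambda>x. x i) \<in> Pi\<^sub>M (UNIV::'m set) (\<lambda>_. std_normal) \<rightarrow>\<^sub>M borel" by (simp cong: measurable_cong_sets)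
    then have "(\<lambda>x. s * x i) \<in> Pi\<^sub>M (UNIV::'m set) (\<lambda>_. std_normal) \<rightarrow>\<^sub>M borel" by (intro borel_measurable_times borel_measurable_const)
    then show "(\<lambda>x. s * x i) \<in> Pi\<^sub>M (UNIV::'m set) (\<lambda>_. std_normal) \<rightarrow>\<^sub>M G" by (simp only: measurable_cong_sets[OF refl G(2)])
  qed
  have sg: "(\<lambda>z::real^'m. s *\<^sub>R z) \<in> borel \<rightarrow>\<^sub>M borel" by simp
  have "distr M borel X = distr M borel ((\<lambda>x. \<chi> i. x i) \<circ> (\<lambda>\<omega>. \<lambda>i\<in>UNIV. X \<omega> $ i))"
    by (intro distr_cong refl) (auto simp: vec_eq_iff)
  also have "\<dots> = distr (distr M (Pi\<^sub>M UNIV (\<lambda>_. borel)) (\<lambda>\<omega>. \<lambda>i\<in>UNIV. X \<omega> $ i)) borel (\<lambda>x. \<chi> i. x i)"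
    by (rule distr_distr[symmetric, OF vl(2) jl])
  also have "distr M (Pi\<^sub>M UNIV (\<lambda>_. borel)) (\<lambda>\<omega>. \<lambda>i\<in>UNIV. X \<omega> $ i) = Pi\<^sub>M UNIV (\<lambda>_. G)"
    using indep_vars_iff_distr_eq_PiM[where I=UNIV and M'="\<lambda>_. borel" and X="\<lambda>i \<omega>. X \<omega> $ i"] indep rv marg by simp
  also have "\<dots> = distr (Pi\<^sub>M UNIV (\<lambda>_. std_normal)) (Pi\<^sub>M UNIV (\<lambda>_. G)) (compose UNIV (\<lambda>x. s * x))"
    by (subst distr_PiM_finite_prob_space') (auto simp: prob_space_std_normal G scale cong: measurable_cong_sets)
  also have "distr \<dots> borel (\<lambda>x. \<chi> i. x i) = distr (Pi\<^sub>M UNIV (\<lambda>_. std_normal)) borel ((\<lambda>x. \<chi> i. x i) \<circ> compose UNIV (\<lambda>x. s * x))"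
    by (rule distr_distr[OF vl(1) cl])
  also have "(\<lambda>x. \<chi> i. x i) \<circ> compose UNIV (\<lambda>x. s * x) = (\<lambda>z. s *\<^sub>R z) \<circ> (\<lambda>x. (\<chi> i::'m. x i))"
    by (auto simp: fun_eq_iff compose_def vec_eq_iff)
  also have "distr (Pi\<^sub>M UNIV (\<lambda>_. std_normal)) borel \<dots> = distr std_gauss borel (\<lambda>z. s *\<^sub>R z)"
    unfolding std_gauss_def by (rule distr_distr[symmetric, OF sg measurable_vec_lambda])
  finally show ?thesis .
qed

definition dyad_up :: "nat \<Rightarrow> real \<Rightarrow> nat" where "dyad_up k x = nat \<lceil>2 ^ k * x\<rceil>"

lemma dyad_up_tendsto:
  assumes "0 \<le> x"
  shows "(\<lambda>k. real (dyad_up k x) / 2 ^ k) \<longlonglongrightarrow> x"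
proof (rule LIMSEQ_I)
  fix r :: real assume r: "0 < r"
  obtain n where n: "1 / 2 ^ n < r" using real_arch_pow_inv[OF r, of "1/2"] by (auto simp: power_one_over)
  have "norm (real (dyad_up k x) / 2 ^ k - x) < r" if "n \<le> k" for k
  proof -
    have "0 \<le> \<lceil>2 ^ k * x\<rceil>" using assms by (simp add: order_less_le_trans[of "-1" 0])
    then have "real (dyad_up k x) = of_int \<lceil>2 ^ k * x\<rceil>" by (simp add: dyad_up_def)
    then have "2 ^ k * x \<le> real (dyad_up k x)" "real (dyad_up k x) - 2 ^ k * x < 1" by linarith+
    then have "0 \<le> real (dyad_up k x) / 2 ^ k - x" "(real (dyad_up k x) - 2 ^ k * x) / 2 ^ k < 1 / 2 ^ k"
      by (simp add: field_simps, intro divide_strict_right_mono, auto)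
    moreover have "(real (dyad_up k x) - 2 ^ k * x) / 2 ^ k = real (dyad_up k x) / 2 ^ k - x" by (simp add: diff_divide_distrib)
    ultimately have "0 \<le> real (dyad_up k x) / 2 ^ k - x" "real (dyad_up k x) / 2 ^ k - x < 1 / 2 ^ k" by simp_all
    moreover have "(1::real) / 2 ^ k \<le> 1 / 2 ^ n" using that by (intro divide_left_mono power_increasing) auto
    ultimately show ?thesis using n by simp
  qed
  then show "\<exists>no. \<forall>k\<ge>no. norm (real (dyad_up k x) / 2 ^ k - x) < r" by blast
qed

lemma dyad_up_eq_iff:
  assumes "0 \<le> x"
  shows "dyad_up k x = n \<longleftrightarrow> x \<le> real n / 2 ^ k \<and> \<not> x \<le> (real n - 1) / 2 ^ k"
proof -
  have 0: "0 \<le> \<lceil>2 ^ k * x\<rceil>" using assms by (simp add: order_less_le_trans[of "-1" 0])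
  have "dyad_up k x = n \<longleftrightarrow> \<lceil>2 ^ k * x\<rceil> = int n" using 0 by (auto simp: dyad_up_def)
  also have "\<dots> \<longleftrightarrow> real n - 1 < 2 ^ k * x \<and> 2 ^ k * x \<le> real n" by (simp add: ceiling_eq_iff)
  also have "\<dots> \<longleftrightarrow> x \<le> real n / 2 ^ k \<and> \<not> x \<le> (real n - 1) / 2 ^ k" by (auto simp: field_simps)
  finally show ?thesis .
qed

lemma measurable_dyad_up [measurable]: "dyad_up k \<in> borel \<rightarrow>\<^sub>M count_space UNIV"
  unfolding dyad_up_def by measurable

text \<open>Brownian motion with all paths continuous, reduced to what is used of it. The filtration
  is indexed by all real numbers, because stopping times and the \<open>\<sigma>\<close>-algebra \<open>pre_sigma \<sigma>\<close> of
  the past at \<open>\<sigma>\<close> refer to a whole index type; the values at negative times carry no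
  information.\<close>
locale bm_paths = prob_space M for M :: "'w measure" +
  fixes F :: "real \<Rightarrow> 'w measure" and W :: "real \<Rightarrow> 'w \<Rightarrow> real ^ 'm"
  assumes filtration: "filtration (space M) F"
    and sets_F: "\<And>t. sets (F t) \<subseteq> sets M"
    and adapted: "\<And>t. 0 \<le> t \<Longrightarrow> W t \<in> borel_measurable (F t)"
    and continuous_path: "\<And>\<omega>. \<omega> \<in> space M \<Longrightarrow> continuous_on {0..} (\<lambda>t. W t \<omega>)"
    and indep_increment: "\<And>s t A B. 0 \<le> s \<Longrightarrow> s < t \<Longrightarrow> A \<in> sets (F s) \<Longrightarrow> B \<in> sets borel \<Longrightarrow>
      prob (A \<inter> {\<omega> \<in> space M. W t \<omega> - W s \<omega> \<in> B}) = prob A * prob {\<omega> \<in> space M. W t \<omega> - W s \<omega> \<in> B}"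
    and increment_law: "\<And>s t. 0 \<le> s \<Longrightarrow> s < t \<Longrightarrow>
      distr M borel (\<lambda>\<omega>. W t \<omega> - W s \<omega>) = distr std_gauss borel (\<lambda>z. sqrt (t - s) *\<^sub>R z)"
begin

sublocale filtration "space M" F by (rule filtration)

lemma subset_M: "f \<in> F t \<rightarrow>\<^sub>M N \<Longrightarrow> f \<in> M \<rightarrow>\<^sub>M N"
  using measurable_mono[OF order_refl refl sets_F space_F] by blast

lemma measurable_W [measurable]: "0 \<le> t \<Longrightarrow> W t \<in> borel_measurable M"
  by (rule subset_M[OF adapted])

lemma measurable_later: "f \<in> F s \<rightarrow>\<^sub>M N \<Longrightarrow> s \<le> t \<Longrightarrow> f \<in> F t \<rightarrow>\<^sub>M N"
  using measurable_mono[OF order_refl refl sets_F_mono[of s t], of N] by (auto simp: space_F)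

text \<open>By continuity of the paths, \<open>W\<close> at a random time is a limit of its values at times from a
  countable grid, capped at \<open>t\<close>.\<close>
lemma measurable_W_random_time:
  assumes t: "0 \<le> t" and G: "space G = space M" "sets (F t) \<subseteq> sets G"
    and r: "r \<in> borel_measurable G" "\<And>\<omega>. \<omega> \<in> space M \<Longrightarrow> 0 \<le> r \<omega> \<and> r \<omega> \<le> t"
  shows "(\<lambda>\<omega>. W (r \<omega>) \<omega>) \<in> borel_measurable G"
proof (rule borel_measurable_LIMSEQ_metric)
  have WG: "W s \<in> borel_measurable G" if "0 \<le> s" "s \<le> t" for s
    using measurable_later[OF adapted that(2)] that measurable_mono[OF order_refl refl G(2), of borel] by (auto simp: space_F G)
  show "(\<lambda>\<omega>. W (min (real (dyad_up k (r \<omega>)) / 2 ^ k) t) \<omega>) \<in> borel_measurable G" for k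
  proof (rule measurable_compose_countable[where f="\<lambda>n. W (min (real n / 2 ^ k) t)" and g="\<lambda>\<omega>. dyad_up k (r \<omega>)"])
    show "W (min (real n / 2 ^ k) t) \<in> borel_measurable G" for n using t by (intro WG) auto
    show "(\<lambda>\<omega>. dyad_up k (r \<omega>)) \<in> G \<rightarrow>\<^sub>M count_space UNIV" using r(1) by measurable
  qed
  fix \<omega> assume "\<omega> \<in> space G"
  then have \<omega>: "\<omega> \<in> space M" using G by simp
  have "(\<lambda>k. min (real (dyad_up k (r \<omega>)) / 2 ^ k) t) \<longlonglongrightarrow> min (r \<omega>) t"
    using r(2)[OF \<omega>] by (intro tendsto_min dyad_up_tendsto tendsto_const) auto
  then have "(\<lambda>k. min (real (dyad_up k (r \<omega>)) / 2 ^ k) t) \<longlonglongrightarrow> r \<omega>" using r(2)[OF \<omega>] by simp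
  then show "(\<lambda>k. W (min (real (dyad_up k (r \<omega>)) / 2 ^ k) t) \<omega>) \<longlonglongrightarrow> W (r \<omega>) \<omega>"
    using r(2)[OF \<omega>] t by (intro continuous_on_tendsto_compose[OF continuous_path[OF \<omega>]]) auto
qed

lemma sets_pre_sigma_subset:
  assumes "stopping_time F \<sigma>" shows "sets (pre_sigma \<sigma>) \<subseteq> sets M"
proof
  fix A assume A: "A \<in> sets (pre_sigma \<sigma>)"
  then have "(\<Union>n::nat. {\<omega> \<in> A. \<sigma> \<omega> \<le> real n}) \<in> sets M"
    using sets_pre_sigmaD[OF assms A] sets_F by (intro sets.countable_UN) auto
  also have "(\<Union>n::nat. {\<omega> \<in> A. \<sigma> \<omega> \<le> real n}) = A" by (auto intro: real_arch_simple)
  finally show "A \<in> sets M" .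
qed

lemma measurable_pre_sigma_M: "stopping_time F \<sigma> \<Longrightarrow> f \<in> pre_sigma \<sigma> \<rightarrow>\<^sub>M N \<Longrightarrow> f \<in> M \<rightarrow>\<^sub>M N"
  using measurable_mono[OF order_refl refl sets_pre_sigma_subset, of \<sigma> N] by (auto simp: space_pre_sigma)

lemma measurable_pre_sigma_mono:
  assumes "stopping_time F \<sigma>" "stopping_time F \<tau>" "\<And>\<omega>. \<omega> \<in> space M \<Longrightarrow> \<sigma> \<omega> \<le> \<tau> \<omega>" "f \<in> pre_sigma \<sigma> \<rightarrow>\<^sub>M N"
  shows "f \<in> pre_sigma \<tau> \<rightarrow>\<^sub>M N"
  using measurable_mono[OF order_refl refl mono_pre_sigma[OF assms(1-3)], of N] assms(4) by (auto simp: space_pre_sigma)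

lemma stopping_time_add:
  assumes \<sigma>: "stopping_time F \<sigma>" and h: "h \<in> borel_measurable (pre_sigma \<sigma>)" "\<And>\<omega>. \<omega> \<in> space M \<Longrightarrow> 0 \<le> h \<omega>"
  shows "stopping_time F (\<lambda>\<omega>. \<sigma> \<omega> + h \<omega>)"
proof
  fix t
  note [measurable] = h(1) measurable_stopping_time_pre_sigma[OF \<sigma>]
  have "{\<omega> \<in> space (pre_sigma \<sigma>). \<sigma> \<omega> + h \<omega> \<le> t} \<in> sets (pre_sigma \<sigma>)" by measurable
  from sets_pre_sigmaD[OF \<sigma> this, of t]
  have "{\<omega> \<in> {\<omega> \<in> space M. \<sigma> \<omega> + h \<omega> \<le> t}. \<sigma> \<omega> \<le> t} \<in> sets (F t)" by (simp add: space_pre_sigma)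
  also have "{\<omega> \<in> {\<omega> \<in> space M. \<sigma> \<omega> + h \<omega> \<le> t}. \<sigma> \<omega> \<le> t} = {\<omega> \<in> space M. \<sigma> \<omega> + h \<omega> \<le> t}"
    using h(2) by force
  finally show "Measurable.pred (F t) (\<lambda>\<omega>. \<sigma> \<omega> + h \<omega> \<le> t)" by (simp add: pred_def space_F)
qed

text \<open>On \<open>{\<sigma> \<le> t}\<close> the value at \<open>\<sigma>\<close> agrees with the value at \<open>min \<sigma> t\<close>, which is known at time
  \<open>t\<close>.\<close>
lemma measurable_W_stopping_time:
  assumes \<sigma>: "stopping_time F \<sigma>" and pos: "\<And>\<omega>. \<omega> \<in> space M \<Longrightarrow> 0 \<le> \<sigma> \<omega>"
  shows "(\<lambda>\<omega>. W (\<sigma> \<omega>) \<omega>) \<in> borel_measurable (pre_sigma \<sigma>)"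
proof (rule measurableI)
  fix B :: "(real ^ 'm) set" assume B: "B \<in> sets borel"
  show "(\<lambda>\<omega>. W (\<sigma> \<omega>) \<omega>) -` B \<inter> space (pre_sigma \<sigma>) \<in> sets (pre_sigma \<sigma>)"
  proof (rule sets_pre_sigmaI[OF \<sigma>])
    fix t
    show "{\<omega> \<in> (\<lambda>\<omega>. W (\<sigma> \<omega>) \<omega>) -` B \<inter> space (pre_sigma \<sigma>). \<sigma> \<omega> \<le> t} \<in> sets (F t)"
    proof (cases "0 \<le> t")
      case True
      have m: "(\<lambda>\<omega>. min (\<sigma> \<omega>) t) \<in> borel_measurable (F t)"
      proof (rule borel_measurableI_le)
        fix a
        have "Measurable.pred (F t) (\<lambda>\<omega>. min (\<sigma> \<omega>) t \<le> a)"
          by (cases "t \<le> a") (auto simp: min_le_iff_disj intro!: stopping_time_le_const[OF \<sigma>] pred_intros_logic)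
        then show "{\<omega> \<in> space (F t). min (\<sigma> \<omega>) t \<le> a} \<in> sets (F t)" by (simp add: pred_def)
      qed
      have "(\<lambda>\<omega>. W (min (\<sigma> \<omega>) t) \<omega>) \<in> borel_measurable (F t)"
        using True pos by (intro measurable_W_random_time[OF True _ _ m]) (auto simp: space_F)
      from sets.Int[OF measurable_sets[OF this B] stopping_timeD[OF \<sigma>, of t, unfolded pred_def]]
      have "((\<lambda>\<omega>. W (min (\<sigma> \<omega>) t) \<omega>) -` B \<inter> space (F t)) \<inter> {\<omega> \<in> space (F t). \<sigma> \<omega> \<le> t} \<in> sets (F t)" .
      also have "((\<lambda>\<omega>. W (min (\<sigma> \<omega>) t) \<omega>) -` B \<inter> space (F t)) \<inter> {\<omega> \<in> space (F t). \<sigma> \<omega> \<le> t}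
         = {\<omega> \<in> (\<lambda>\<omega>. W (\<sigma> \<omega>) \<omega>) -` B \<inter> space (pre_sigma \<sigma>). \<sigma> \<omega> \<le> t}"
        by (auto simp: space_F space_pre_sigma min_def)
      finally show ?thesis .
    next
      case False
      then have "{\<omega> \<in> (\<lambda>\<omega>. W (\<sigma> \<omega>) \<omega>) -` B \<inter> space (pre_sigma \<sigma>). \<sigma> \<omega> \<le> t} = {}"
        using pos by (force simp: space_pre_sigma)
      then show ?thesis by (simp only: sets.empty_sets)
    qed
  qed
qed simp

end

section \<open>The strong Markov property\<close>

context bm_paths begin

lemma increment_from_fixed_time:
  assumes s: "0 \<le> s" and h: "0 \<le> h" and A: "A \<in> sets (F s)" and \<phi>: "\<phi> \<in> borel_measurable borel"
  shows "(\<integral>\<^sup>+\<omega>. indicator A \<omega> * \<phi> (W (s + h) \<omega> - W s \<omega>) \<partial>M) = emeasure M A * (\<integral>\<^sup>+z. \<phi> (sqrt h *\<^sub>R z) \<partial>std_gauss)"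
proof (cases "h = 0")
  case True
  have "A \<in> sets M" using A sets_F by auto
  then show ?thesis
    by (simp add: True nn_integral_multc emeasure_std_gauss_UNIV)
next
  case False
  then have h: "0 < h" using assms by simp
  define X where "X \<omega> = W (s + h) \<omega> - W s \<omega>" for \<omega>
  have AM [measurable]: "A \<in> sets M" using A sets_F by auto
  have X [measurable]: "X \<in> borel_measurable M" unfolding X_def using s h by (intro borel_measurable_diff measurable_W) auto
  define \<nu> where "\<nu> = distr std_gauss borel (\<lambda>z::real^'m. sqrt h *\<^sub>R z)"
  have law: "distr M borel X = \<nu>" unfolding X_def \<nu>_def using increment_law[of s "s + h"] s h by simp
  have eq: "distr (density M (indicator A)) borel X = scale_measure (emeasure M A) \<nu>"
  proof (rule measure_eqI)
    fix B assume "B \<in> sets (distr (density M (indicator A)) borel X)"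
    then have B [measurable]: "B \<in> sets borel" by simp
    have "emeasure (distr (density M (indicator A)) borel X) B = emeasure (density M (indicator A)) (X -` B \<inter> space M)"
      by (subst emeasure_distr) auto
    also have "\<dots> = (\<integral>\<^sup>+\<omega>. indicator A \<omega> * indicator (X -` B \<inter> space M) \<omega> \<partial>M)"
      by (rule emeasure_density) measurable
    also have "\<dots> = (\<integral>\<^sup>+\<omega>. indicator (A \<inter> {\<omega> \<in> space M. X \<omega> \<in> B}) \<omega> \<partial>M)"
      by (intro nn_integral_cong) (auto split: split_indicator)
    also have "\<dots> = emeasure M (A \<inter> {\<omega> \<in> space M. X \<omega> \<in> B})" by (rule nn_integral_indicator) measurable
    also have "\<dots> = emeasure M A * emeasure M {\<omega> \<in> space M. X \<omega> \<in> B}"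
      using indep_increment[OF s, of "s + h", OF _ A B] h
      by (simp add: emeasure_eq_measure X_def ennreal_mult')
    also have "emeasure M {\<omega> \<in> space M. X \<omega> \<in> B} = emeasure (distr M borel X) B"
      by (subst emeasure_distr) (auto intro!: arg_cong[where f="emeasure M"])
    finally show "emeasure (distr (density M (indicator A)) borel X) B = emeasure (scale_measure (emeasure M A) \<nu>) B"
      by (simp add: law)
  qed (simp add: \<nu>_def)
  have "(\<integral>\<^sup>+\<omega>. indicator A \<omega> * \<phi> (X \<omega>) \<partial>M) = (\<integral>\<^sup>+\<omega>. \<phi> (X \<omega>) \<partial>density M (indicator A))"
    using \<phi> by (subst nn_integral_density) auto
  also have "\<dots> = (\<integral>\<^sup>+x. \<phi> x \<partial>distr (density M (indicator A)) borel X)"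
    using \<phi> by (subst nn_integral_distr) auto
  also have "\<dots> = emeasure M A * (\<integral>\<^sup>+x. \<phi> x \<partial>\<nu>)" unfolding eq
    using \<phi> by (subst nn_integral_scale_measure) (auto simp: \<nu>_def)
  also have "(\<integral>\<^sup>+x. \<phi> x \<partial>\<nu>) = (\<integral>\<^sup>+z. \<phi> (sqrt h *\<^sub>R z) \<partial>std_gauss)" unfolding \<nu>_def
    using \<phi> by (subst nn_integral_distr) auto
  finally show ?thesis by (simp add: X_def)
qed

text \<open>Round both the time \<open>\<sigma>\<close> and the length \<open>h\<close> up to multiples of \<open>1 / 2 ^ k\<close>. On each of the
  countably many events where the rounded values are fixed, which belong to the past at the
  rounded time, independence of increments applies. The claim follows in the limit, because
  paths, \<open>\<phi>\<close> and the square root are continuous.\<close>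
lemma strong_markov_continuous:
  fixes \<phi> :: "real ^ 'm \<Rightarrow> real"
  assumes \<sigma>: "stopping_time F \<sigma>" and pos: "\<And>\<omega>. \<omega> \<in> space M \<Longrightarrow> 0 \<le> \<sigma> \<omega>"
    and h: "h \<in> borel_measurable (pre_sigma \<sigma>)" "\<And>\<omega>. \<omega> \<in> space M \<Longrightarrow> 0 \<le> h \<omega>"
    and A: "A \<in> sets (pre_sigma \<sigma>)"
    and \<phi>: "continuous_on UNIV \<phi>" "\<And>x. 0 \<le> \<phi> x" "\<And>x. \<phi> x \<le> 1"
  shows "(\<integral>\<^sup>+\<omega>. indicator A \<omega> * ennreal (\<phi> (W (\<sigma> \<omega> + h \<omega>) \<omega> - W (\<sigma> \<omega>) \<omega>)) \<partial>M) =
     (\<integral>\<^sup>+\<omega>. indicator A \<omega> * (\<integral>\<^sup>+z. ennreal (\<phi> (sqrt (h \<omega>) *\<^sub>R z)) \<partial>std_gauss) \<partial>M)"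
proof -
  have \<phi>m [measurable]: "\<phi> \<in> borel_measurable borel" by (intro borel_measurable_continuous_onI \<phi>)
  have \<sigma>G: "\<sigma> \<in> borel_measurable (pre_sigma \<sigma>)" by (rule measurable_stopping_time_pre_sigma[OF \<sigma>])
  have AM [measurable]: "A \<in> sets M" using A sets_pre_sigma_subset[OF \<sigma>] by auto
  have hM [measurable]: "h \<in> borel_measurable M" "\<sigma> \<in> borel_measurable M"
    using measurable_pre_sigma_M[OF \<sigma>] h(1) \<sigma>G by auto
  define s where "s k \<omega> = real (dyad_up k (\<sigma> \<omega>)) / 2 ^ k" for k \<omega>
  define d where "d k \<omega> = real (dyad_up k (h \<omega>)) / 2 ^ k" for k \<omega>
  define \<Phi> where "\<Phi> b = (\<integral>\<^sup>+z. ennreal (\<phi> (sqrt b *\<^sub>R (z :: real ^ 'm))) \<partial>std_gauss)" for b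
  have \<Phi>m [measurable]: "\<Phi> \<in> borel_measurable borel" unfolding \<Phi>_def
    by (rule std_gauss.borel_measurable_nn_integral) measurable
  have \<Phi>1: "\<Phi> b \<le> 1" for b
  proof -
    have "\<Phi> b \<le> (\<integral>\<^sup>+z. 1 \<partial>(std_gauss :: (real^'m) measure))" unfolding \<Phi>_def
      by (intro nn_integral_mono) (simp add: \<phi>)
    then show ?thesis by (simp add: emeasure_std_gauss_UNIV)
  qed
  have sdM [measurable]: "s k \<in> borel_measurable M" "d k \<in> borel_measurable M" for k
    unfolding s_def d_def by measurable
  have lim_s: "(\<lambda>k. s k \<omega>) \<longlonglongrightarrow> \<sigma> \<omega>" "(\<lambda>k. d k \<omega>) \<longlonglongrightarrow> h \<omega>" if "\<omega> \<in> space M" for \<omega>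
    unfolding s_def d_def using pos h(2) that by (auto intro!: dyad_up_tendsto)
  have sd0: "0 \<le> s k \<omega>" "0 \<le> d k \<omega>" for k \<omega> by (auto simp: s_def d_def)
  define X where "X k \<omega> = W (s k \<omega> + d k \<omega>) \<omega> - W (s k \<omega>) \<omega>" for k \<omega>
  define a where "a k n = real (fst (prod_decode n)) / 2 ^ k" for k n
  define b where "b k n = real (snd (prod_decode n)) / 2 ^ k" for k n
  \<comment> \<open>A single natural number encodes the pair of rounded values.\<close>
  define idx where "idx k \<omega> = prod_encode (dyad_up k (\<sigma> \<omega>), dyad_up k (h \<omega>))" for k \<omega>
  have ab: "s k \<omega> = a k (idx k \<omega>)" "d k \<omega> = b k (idx k \<omega>)" for k \<omega>
    by (simp_all add: s_def d_def a_def b_def idx_def)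
  have ab0: "0 \<le> a k n" "0 \<le> b k n" for k n by (auto simp: a_def b_def)
  have idxM [measurable]: "idx k \<in> M \<rightarrow>\<^sub>M count_space UNIV" for k
  proof -
    have "(\<lambda>\<omega>. (dyad_up k (\<sigma> \<omega>), dyad_up k (h \<omega>))) \<in> M \<rightarrow>\<^sub>M count_space UNIV \<Otimes>\<^sub>M count_space UNIV" by measurable
    then have "(\<lambda>\<omega>. (dyad_up k (\<sigma> \<omega>), dyad_up k (h \<omega>))) \<in> M \<rightarrow>\<^sub>M count_space UNIV"
      by (simp add: pair_measure_countable)
    then show ?thesis unfolding idx_def by (rule measurable_compose) simp
  qed
  have XM [measurable]: "X k \<in> borel_measurable M" for k
    unfolding X_def ab
    by (rule measurable_compose_countable[where f="\<lambda>n \<omega>. W (a k n + b k n) \<omega> - W (a k n) \<omega>", OF _ idxM])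
       (auto intro!: borel_measurable_diff measurable_W ab0 add_nonneg_nonneg)
  define P where "P k n = {\<omega> \<in> A. idx k \<omega> = n}" for k n
  have Asub: "A \<subseteq> space M" by (rule sets.sets_into_space[OF AM])
  have P: "P k n \<in> sets (F (a k n))" for k n
  proof -
    define i j where "i = fst (prod_decode n)" and "j = snd (prod_decode n)"
    note [measurable] = h(1)
    have "{\<omega> \<in> space (pre_sigma \<sigma>). dyad_up k (h \<omega>) = j} \<in> sets (pre_sigma \<sigma>)" by measurable
    then have A': "A \<inter> {\<omega> \<in> space (pre_sigma \<sigma>). dyad_up k (h \<omega>) = j} \<in> sets (pre_sigma \<sigma>)" by (intro sets.Int A)
    define A' where "A' = A \<inter> {\<omega> \<in> space (pre_sigma \<sigma>). dyad_up k (h \<omega>) = j}"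
    \<comment> \<open>The event is known at time \<open>a k n\<close>, because \<open>\<sigma>\<close> was rounded up to that time.\<close>
    have "{\<omega> \<in> A'. \<sigma> \<omega> \<le> real i / 2 ^ k} \<in> sets (F (a k n))"
      using sets_pre_sigmaD[OF \<sigma> A'] by (simp add: A'_def a_def i_def)
    moreover have "{\<omega> \<in> A'. \<sigma> \<omega> \<le> (real i - 1) / 2 ^ k} \<in> sets (F (a k n))"
    proof -
      have "(real i - 1) / 2 ^ k \<le> a k n" unfolding a_def i_def by (intro divide_right_mono) auto
      then show ?thesis using sets_pre_sigmaD[OF \<sigma> A', of "(real i - 1) / 2 ^ k"] sets_F_mono by (auto simp: A'_def)
    qed
    ultimately have "{\<omega> \<in> A'. \<sigma> \<omega> \<le> real i / 2 ^ k} - {\<omega> \<in> A'. \<sigma> \<omega> \<le> (real i - 1) / 2 ^ k} \<in> sets (F (a k n))"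
      by (rule sets.Diff)
    also have "{\<omega> \<in> A'. \<sigma> \<omega> \<le> real i / 2 ^ k} - {\<omega> \<in> A'. \<sigma> \<omega> \<le> (real i - 1) / 2 ^ k} = P k n"
    proof -
      have "idx k \<omega> = n \<longleftrightarrow> dyad_up k (\<sigma> \<omega>) = i \<and> dyad_up k (h \<omega>) = j" for \<omega>
        unfolding idx_def i_def j_def by (metis fst_conv prod_decode_inverse prod_encode_inverse snd_conv surjective_pairing)
      then have "idx k \<omega> = n \<longleftrightarrow> (\<sigma> \<omega> \<le> real i / 2 ^ k \<and> \<not> \<sigma> \<omega> \<le> (real i - 1) / 2 ^ k) \<and> dyad_up k (h \<omega>) = j"
        if "\<omega> \<in> space M" for \<omega> using dyad_up_eq_iff[OF pos[OF that], of k i] by simp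
      then show ?thesis using Asub by (auto simp: P_def A'_def space_pre_sigma)
    qed
    finally show ?thesis .
  qed
  have PM [measurable]: "P k n \<in> sets M" for k n using P sets_F by auto
  have split: "indicator A \<omega> * f (idx k \<omega>) = (\<Sum>n. indicator (P k n) \<omega> * f n)" for f :: "nat \<Rightarrow> ennreal" and k \<omega>
  proof -
    have "(\<Sum>n. indicator (P k n) \<omega> * f n) = (\<Sum>n\<in>{idx k \<omega>}. indicator (P k n) \<omega> * f n)"
      by (rule suminf_finite) (auto simp: P_def)
    then show ?thesis by (simp add: P_def indicator_def)
  qed
  have step: "(\<integral>\<^sup>+\<omega>. indicator A \<omega> * ennreal (\<phi> (X k \<omega>)) \<partial>M) = (\<integral>\<^sup>+\<omega>. indicator A \<omega> * \<Phi> (d k \<omega>) \<partial>M)" for k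
  proof -
    have "(\<integral>\<^sup>+\<omega>. indicator A \<omega> * ennreal (\<phi> (X k \<omega>)) \<partial>M) =
       (\<integral>\<^sup>+\<omega>. (\<Sum>n. indicator (P k n) \<omega> * ennreal (\<phi> (W (a k n + b k n) \<omega> - W (a k n) \<omega>))) \<partial>M)"
      unfolding X_def ab by (intro nn_integral_cong split)
    also have "\<dots> = (\<Sum>n. \<integral>\<^sup>+\<omega>. indicator (P k n) \<omega> * ennreal (\<phi> (W (a k n + b k n) \<omega> - W (a k n) \<omega>)) \<partial>M)"
    proof (rule nn_integral_suminf)
      fix n
      have [measurable]: "W (a k n + b k n) \<in> borel_measurable M" "W (a k n) \<in> borel_measurable M"
        using ab0 by (auto intro!: measurable_W add_nonneg_nonneg)
      show "(\<lambda>\<omega>. indicator (P k n) \<omega> * ennreal (\<phi> (W (a k n + b k n) \<omega> - W (a k n) \<omega>))) \<in> borel_measurable M" by measurable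
    qed
    also have "\<dots> = (\<Sum>n. emeasure M (P k n) * \<Phi> (b k n))"
      unfolding \<Phi>_def by (intro suminf_cong increment_from_fixed_time P ab0) measurable
    also have "\<dots> = (\<Sum>n. \<integral>\<^sup>+\<omega>. indicator (P k n) \<omega> * \<Phi> (b k n) \<partial>M)"
      by (simp add: nn_integral_multc)
    also have "\<dots> = (\<integral>\<^sup>+\<omega>. (\<Sum>n. indicator (P k n) \<omega> * \<Phi> (b k n)) \<partial>M)"
      by (rule nn_integral_suminf[symmetric]) measurable
    also have "\<dots> = (\<integral>\<^sup>+\<omega>. indicator A \<omega> * \<Phi> (d k \<omega>) \<partial>M)"
      unfolding ab by (intro nn_integral_cong split[symmetric])
    finally show ?thesis .
  qed
  have fin: "(\<integral>\<^sup>+\<omega>. 1 \<partial>M) < \<infinity>" by (simp add: emeasure_space_1)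
  have XlimM: "(\<lambda>k. X k \<omega>) \<longlonglongrightarrow> W (\<sigma> \<omega> + h \<omega>) \<omega> - W (\<sigma> \<omega>) \<omega>" if \<omega>: "\<omega> \<in> space M" for \<omega>
    unfolding X_def using sd0 pos[OF \<omega>] h(2)[OF \<omega>]
    by (intro tendsto_diff continuous_on_tendsto_compose[OF continuous_path[OF \<omega>]] tendsto_add lim_s \<omega>) auto
  have [measurable]: "(\<lambda>\<omega>. W (\<sigma> \<omega> + h \<omega>) \<omega> - W (\<sigma> \<omega>) \<omega>) \<in> borel_measurable M"
    by (rule borel_measurable_LIMSEQ_metric[OF XM XlimM])
  have 1: "(\<lambda>k. \<integral>\<^sup>+\<omega>. indicator A \<omega> * ennreal (\<phi> (X k \<omega>)) \<partial>M) \<longlonglongrightarrow>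
     (\<integral>\<^sup>+\<omega>. indicator A \<omega> * ennreal (\<phi> (W (\<sigma> \<omega> + h \<omega>) \<omega> - W (\<sigma> \<omega>) \<omega>)) \<partial>M)"
  proof (rule nn_integral_dominated_convergence[where w="\<lambda>_. 1"])
    show "AE \<omega> in M. (\<lambda>k. indicator A \<omega> * ennreal (\<phi> (X k \<omega>))) \<longlonglongrightarrow> indicator A \<omega> * ennreal (\<phi> (W (\<sigma> \<omega> + h \<omega>) \<omega> - W (\<sigma> \<omega>) \<omega>))"
      using XlimM \<phi>(1)
      by (intro AE_I2 ennreal_tendsto_cmult tendsto_ennrealI continuous_on_tendsto_compose[OF \<phi>(1)])
         (auto simp: indicator_def)
  qed (use fin in \<open>auto simp: indicator_def \<phi>\<close>)
  have \<Phi>lim: "(\<lambda>k. \<Phi> (d k \<omega>)) \<longlonglongrightarrow> \<Phi> (h \<omega>)" if \<omega>: "\<omega> \<in> space M" for \<omega>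
    unfolding \<Phi>_def
  proof (rule nn_integral_dominated_convergence[where w="\<lambda>_. 1"])
    show "AE z in std_gauss. (\<lambda>k. ennreal (\<phi> (sqrt (d k \<omega>) *\<^sub>R z))) \<longlonglongrightarrow> ennreal (\<phi> (sqrt (h \<omega>) *\<^sub>R z))"
      by (intro AE_I2 tendsto_ennrealI continuous_on_tendsto_compose[OF \<phi>(1)] tendsto_scaleR tendsto_real_sqrt lim_s \<omega> tendsto_const) auto
  qed (auto simp: \<phi> emeasure_std_gauss_UNIV)
  have 2: "(\<lambda>k. \<integral>\<^sup>+\<omega>. indicator A \<omega> * \<Phi> (d k \<omega>) \<partial>M) \<longlonglongrightarrow> (\<integral>\<^sup>+\<omega>. indicator A \<omega> * \<Phi> (h \<omega>) \<partial>M)"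
  proof (rule nn_integral_dominated_convergence[where w="\<lambda>_. 1"])
    show "AE \<omega> in M. (\<lambda>k. indicator A \<omega> * \<Phi> (d k \<omega>)) \<longlonglongrightarrow> indicator A \<omega> * \<Phi> (h \<omega>)"
      using \<Phi>lim by (intro AE_I2 ennreal_tendsto_cmult) (auto simp: indicator_def)
  qed (use fin in \<open>auto simp: indicator_def \<Phi>1\<close>)
  show ?thesis using LIMSEQ_unique[OF 1[unfolded step] 2] by (simp add: \<Phi>_def)
qed

end

context bm_paths begin

lemma measurable_increment:
  assumes \<sigma>: "stopping_time F \<sigma>" and pos: "\<And>\<omega>. \<omega> \<in> space M \<Longrightarrow> 0 \<le> \<sigma> \<omega>"
    and h: "h \<in> borel_measurable (pre_sigma \<sigma>)" "\<And>\<omega>. \<omega> \<in> space M \<Longrightarrow> 0 \<le> h \<omega>"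
  shows "(\<lambda>\<omega>. W (\<sigma> \<omega> + h \<omega>) \<omega> - W (\<sigma> \<omega>) \<omega>) \<in> borel_measurable (pre_sigma (\<lambda>\<omega>. \<sigma> \<omega> + h \<omega>))"
proof -
  have \<tau>: "stopping_time F (\<lambda>\<omega>. \<sigma> \<omega> + h \<omega>)" by (rule stopping_time_add[OF \<sigma> h])
  show ?thesis
    using pos h(2)
    by (intro borel_measurable_diff measurable_W_stopping_time[OF \<tau>] measurable_pre_sigma_mono[OF \<sigma> \<tau> _ measurable_W_stopping_time[OF \<sigma>]])
       auto
qed

text \<open>The indicator of an open set is an increasing limit of continuous functions.\<close>
lemma strong_markov_open:
  assumes \<sigma>: "stopping_time F \<sigma>" and pos: "\<And>\<omega>. \<omega> \<in> space M \<Longrightarrow> 0 \<le> \<sigma> \<omega>"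
    and h: "h \<in> borel_measurable (pre_sigma \<sigma>)" "\<And>\<omega>. \<omega> \<in> space M \<Longrightarrow> 0 \<le> h \<omega>"
    and A: "A \<in> sets (pre_sigma \<sigma>)" and U: "open U"
  shows "(\<integral>\<^sup>+\<omega>. indicator A \<omega> * indicator U (W (\<sigma> \<omega> + h \<omega>) \<omega> - W (\<sigma> \<omega>) \<omega>) \<partial>M) =
     (\<integral>\<^sup>+\<omega>. indicator A \<omega> * (\<integral>\<^sup>+z. indicator U (sqrt (h \<omega>) *\<^sub>R z) \<partial>std_gauss) \<partial>M)"
proof (cases "U = UNIV")
  case True
  then show ?thesis by (simp add: emeasure_std_gauss_UNIV)
next
  case False
  define X where "X \<omega> = W (\<sigma> \<omega> + h \<omega>) \<omega> - W (\<sigma> \<omega>) \<omega>" for \<omega>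
  have [measurable]: "X \<in> borel_measurable M" unfolding X_def
    by (rule measurable_pre_sigma_M[OF stopping_time_add[OF \<sigma> h] measurable_increment[OF assms(1-4)]])
  have [measurable]: "h \<in> borel_measurable M" "A \<in> sets M"
    using measurable_pre_sigma_M[OF \<sigma> h(1)] A sets_pre_sigma_subset[OF \<sigma>] by auto
  define \<phi> where "\<phi> n x = min 1 (real n * infdist x (- U))" for n :: nat and x :: "real^'m"
  have cont: "continuous_on UNIV (\<phi> n)" for n unfolding \<phi>_def by (intro continuous_intros)
  have [measurable]: "\<phi> n \<in> borel_measurable borel" for n by (intro borel_measurable_continuous_onI cont)
  have bnd: "0 \<le> \<phi> n x" "\<phi> n x \<le> 1" for n x by (auto simp: \<phi>_def infdist_nonneg)
  have mono: "incseq (\<lambda>n. ennreal (\<phi> n x))" for x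
    by (intro incseq_SucI ennreal_leI) (auto simp: \<phi>_def infdist_nonneg min_le_iff_disj distrib_right)
  have lim: "(\<lambda>n. ennreal (\<phi> n x)) \<longlonglongrightarrow> indicator U x" for x
  proof (cases "x \<in> U")
    case True
    have "infdist x (- U) \<noteq> 0"
      using in_closed_iff_infdist_zero[of "- U" x] U False True by auto
    then have d: "0 < infdist x (- U)" using infdist_nonneg[of x "- U"] by linarith
    obtain N :: nat where N: "1 / infdist x (- U) \<le> real N" using real_arch_simple by blast
    have "\<forall>\<^sub>F n in sequentially. ennreal (\<phi> n x) = indicator U x"
      unfolding eventually_sequentially
    proof (intro exI[of _ N] allI impI)
      fix n assume "N \<le> n"
      then have "1 / infdist x (- U) \<le> real n" using N by linarith
      then have "1 \<le> real n * infdist x (- U)" using d by (simp add: field_simps)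
      then show "ennreal (\<phi> n x) = indicator U x" using True by (simp add: \<phi>_def)
    qed
    then show ?thesis by (rule tendsto_eventually)
  next
    case F: False
    then have "\<phi> n x = 0" for n by (simp add: \<phi>_def)
    then show ?thesis using F by simp
  qed
  have sup: "(SUP n. ennreal (\<phi> n x)) = indicator U x" for x
    by (rule LIMSEQ_unique[OF LIMSEQ_SUP[OF mono] lim])
  have "(\<integral>\<^sup>+\<omega>. indicator A \<omega> * indicator U (X \<omega>) \<partial>M) = (\<integral>\<^sup>+\<omega>. (SUP n. indicator A \<omega> * ennreal (\<phi> n (X \<omega>))) \<partial>M)"
    by (simp add: sup[symmetric] SUP_mult_left_ennreal)
  also have "\<dots> = (SUP n. \<integral>\<^sup>+\<omega>. indicator A \<omega> * ennreal (\<phi> n (X \<omega>)) \<partial>M)"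
    using mono by (intro nn_integral_monotone_convergence_SUP) (auto simp: incseq_def le_fun_def intro!: mult_left_mono)
  also have "\<dots> = (SUP n. \<integral>\<^sup>+\<omega>. indicator A \<omega> * (\<integral>\<^sup>+z. ennreal (\<phi> n (sqrt (h \<omega>) *\<^sub>R z)) \<partial>std_gauss) \<partial>M)"
    unfolding X_def using strong_markov_continuous[OF \<sigma> pos h A cont bnd] by simp
  also have "\<dots> = (\<integral>\<^sup>+\<omega>. (SUP n. indicator A \<omega> * (\<integral>\<^sup>+z. ennreal (\<phi> n (sqrt (h \<omega>) *\<^sub>R z)) \<partial>std_gauss)) \<partial>M)"
  proof (intro nn_integral_monotone_convergence_SUP[symmetric])
    have "(\<lambda>\<omega>. \<integral>\<^sup>+z. ennreal (\<phi> n (sqrt (h \<omega>) *\<^sub>R z)) \<partial>std_gauss) \<in> borel_measurable M" for n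
      by (rule std_gauss.borel_measurable_nn_integral) measurable
    then show "(\<lambda>\<omega>. indicator A \<omega> * (\<integral>\<^sup>+z. ennreal (\<phi> n (sqrt (h \<omega>) *\<^sub>R z)) \<partial>std_gauss)) \<in> borel_measurable M" for n by measurable
    show "incseq (\<lambda>n \<omega>. indicator A \<omega> * (\<integral>\<^sup>+z. ennreal (\<phi> n (sqrt (h \<omega>) *\<^sub>R z)) \<partial>std_gauss))"
      using mono by (auto simp: incseq_def le_fun_def intro!: mult_left_mono nn_integral_mono)
  qed
  also have "\<dots> = (\<integral>\<^sup>+\<omega>. indicator A \<omega> * (\<integral>\<^sup>+z. indicator U (sqrt (h \<omega>) *\<^sub>R z) \<partial>std_gauss) \<partial>M)"
  proof (intro nn_integral_cong)
    fix \<omega>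
    have "(SUP n. indicator A \<omega> * (\<integral>\<^sup>+z. ennreal (\<phi> n (sqrt (h \<omega>) *\<^sub>R z)) \<partial>std_gauss)) =
      indicator A \<omega> * (\<integral>\<^sup>+z. (SUP n. ennreal (\<phi> n (sqrt (h \<omega>) *\<^sub>R z))) \<partial>std_gauss)"
      using mono by (subst nn_integral_monotone_convergence_SUP) (auto simp: incseq_def le_fun_def SUP_mult_left_ennreal)
    then show "(SUP n. indicator A \<omega> * (\<integral>\<^sup>+z. ennreal (\<phi> n (sqrt (h \<omega>) *\<^sub>R z)) \<partial>std_gauss)) =
      indicator A \<omega> * (\<integral>\<^sup>+z. indicator U (sqrt (h \<omega>) *\<^sub>R z) \<partial>std_gauss)" by (simp add: sup)
  qed
  finally show ?thesis by (simp add: X_def)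
qed

text \<open>The increment after \<open>\<sigma>\<close> over a length \<open>h\<close> known at \<open>\<sigma>\<close> is \<open>sqrt h\<close> times a Gaussian vector
  independent of the past. The statement is an identity of joint laws on
  \<open>pre_sigma \<sigma> \<Otimes>\<^sub>M borel\<close>; it also covers \<open>h = 0\<close>, where dividing the increment by \<open>sqrt h\<close>
  would not define such a vector. Rectangles with an open second side form a generator that is
  closed under intersection.\<close>
theorem strong_markov:
  assumes \<sigma>: "stopping_time F \<sigma>" and pos: "\<And>\<omega>. \<omega> \<in> space M \<Longrightarrow> 0 \<le> \<sigma> \<omega>"
    and h: "h \<in> borel_measurable (pre_sigma \<sigma>)" "\<And>\<omega>. \<omega> \<in> space M \<Longrightarrow> 0 \<le> h \<omega>"
  shows "distr M (pre_sigma \<sigma> \<Otimes>\<^sub>M borel) (\<lambda>\<omega>. (\<omega>, W (\<sigma> \<omega> + h \<omega>) \<omega> - W (\<sigma> \<omega>) \<omega>)) =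
    distr (M \<Otimes>\<^sub>M std_gauss) (pre_sigma \<sigma> \<Otimes>\<^sub>M borel) (\<lambda>(\<omega>, z). (\<omega>, sqrt (h \<omega>) *\<^sub>R z))" (is "?L = ?R")
    and "(\<lambda>\<omega>. (\<omega>, W (\<sigma> \<omega> + h \<omega>) \<omega> - W (\<sigma> \<omega>) \<omega>)) \<in> M \<rightarrow>\<^sub>M pre_sigma \<sigma> \<Otimes>\<^sub>M borel" (is "?m1")
    and "(\<lambda>(\<omega>, z). (\<omega>, sqrt (h \<omega>) *\<^sub>R z)) \<in> M \<Otimes>\<^sub>M (std_gauss :: (real^'m) measure) \<rightarrow>\<^sub>M pre_sigma \<sigma> \<Otimes>\<^sub>M borel" (is "?m2")
proof -
  define X where "X \<omega> = W (\<sigma> \<omega> + h \<omega>) \<omega> - W (\<sigma> \<omega>) \<omega>" for \<omega>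
  have X [measurable]: "X \<in> borel_measurable M" unfolding X_def
    by (rule measurable_pre_sigma_M[OF stopping_time_add[OF \<sigma> h] measurable_increment[OF assms]])
  have hM [measurable]: "h \<in> borel_measurable M" using measurable_pre_sigma_M[OF \<sigma> h(1)] .
  have id: "(\<lambda>\<omega>. \<omega>) \<in> M \<rightarrow>\<^sub>M pre_sigma \<sigma>"
    using sets_pre_sigma_subset[OF \<sigma>] by (intro measurableI) (auto simp: space_pre_sigma)
  note [measurable] = id
  show m1: ?m1 unfolding X_def[symmetric] by measurable
  have fstm: "(\<lambda>p. fst p) \<in> M \<Otimes>\<^sub>M (std_gauss :: (real^'m) measure) \<rightarrow>\<^sub>M pre_sigma \<sigma>" by (rule measurable_compose[OF measurable_fst id])
  have "(\<lambda>p. (fst p, sqrt (h (fst p)) *\<^sub>R snd p)) \<in> M \<Otimes>\<^sub>M (std_gauss :: (real^'m) measure) \<rightarrow>\<^sub>M pre_sigma \<sigma> \<Otimes>\<^sub>M borel"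
    by (intro measurable_Pair fstm) measurable
  then show m2: ?m2 by (simp add: case_prod_beta')
  define E where "E = {A \<times> U |A U. A \<in> sets (pre_sigma \<sigma>) \<and> U \<in> {U :: (real^'m) set. open U}}"
  have setsE: "sets (pre_sigma \<sigma> \<Otimes>\<^sub>M (borel :: (real^'m) measure)) = sigma_sets (space M \<times> UNIV) E"
  proof -
    have "sets (pre_sigma \<sigma> \<Otimes>\<^sub>M (borel :: (real^'m) measure))
      = sets (sigma (space (pre_sigma \<sigma>) \<times> space (borel :: (real^'m) measure)) {a \<times> b |a b. a \<in> sets (pre_sigma \<sigma>) \<and> b \<in> {U. open U}})"
      using sets.space_closed[of "pre_sigma \<sigma>"] sets.top[of "pre_sigma \<sigma>"]
      by (intro sets_pair_eq[where Ca="{space (pre_sigma \<sigma>)}" and Cb="{UNIV}"])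
         (auto simp: sets.sigma_sets_eq borel_def)
    also have "\<dots> = sigma_sets (space M \<times> UNIV) E"
      unfolding E_def using sets.sets_into_space[of _ "pre_sigma \<sigma>"]
      by (subst sets_measure_of) (auto simp: space_pre_sigma)
    finally show ?thesis .
  qed
  show "?L = ?R"
  proof (rule measure_eqI_generator_eq[where E=E and \<Omega>="space M \<times> UNIV" and A="\<lambda>_. space M \<times> UNIV"])
    show "Int_stable E"
      unfolding Int_stable_def E_def
    proof safe
      fix A1 A2 :: "'w set" and U1 U2 :: "(real^'m) set"
      assume "A1 \<in> sets (pre_sigma \<sigma>)" "A2 \<in> sets (pre_sigma \<sigma>)" "open U1" "open U2"
      then show "\<exists>A U. A1 \<times> U1 \<inter> A2 \<times> U2 = A \<times> U \<and> A \<in> sets (pre_sigma \<sigma>) \<and> U \<in> {U. open U}"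
        by (intro exI[of _ "A1 \<inter> A2"] exI[of _ "U1 \<inter> U2"]) auto
    qed
    show "E \<subseteq> Pow (space M \<times> UNIV)" using sets.sets_into_space[of _ "pre_sigma \<sigma>"] by (auto simp: E_def space_pre_sigma)
    show "range (\<lambda>_::nat. space M \<times> UNIV) \<subseteq> E" using sets.top[of "pre_sigma \<sigma>"] by (auto simp: E_def space_pre_sigma)
    interpret L: prob_space ?L by (rule prob_space_distr[OF m1])
    show "emeasure ?L (space M \<times> UNIV) \<noteq> \<infinity>" by simp
    fix B assume "B \<in> E"
    then obtain A U where B: "B = A \<times> U" and A: "A \<in> sets (pre_sigma \<sigma>)" and U: "open U" by (auto simp: E_def)
    have AM [measurable]: "A \<in> sets M" using A sets_pre_sigma_subset[OF \<sigma>] by auto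
    have UM [measurable]: "U \<in> sets borel" using U by simp
    have BM: "B \<in> sets (pre_sigma \<sigma> \<Otimes>\<^sub>M borel)" unfolding B using A by simp
    have "emeasure ?L B = (\<integral>\<^sup>+\<omega>. indicator B (\<omega>, X \<omega>) \<partial>M)"
      using nn_integral_distr[OF m1, of "indicator B"] BM by (simp add: X_def)
    also have "\<dots> = (\<integral>\<^sup>+\<omega>. indicator A \<omega> * indicator U (X \<omega>) \<partial>M)"
      by (intro nn_integral_cong) (simp add: B indicator_times)
    also have "\<dots> = (\<integral>\<^sup>+\<omega>. indicator A \<omega> * (\<integral>\<^sup>+z. indicator U (sqrt (h \<omega>) *\<^sub>R z) \<partial>std_gauss) \<partial>M)"
      unfolding X_def by (rule strong_markov_open[OF assms A U])
    also have "\<dots> = (\<integral>\<^sup>+\<omega>. \<integral>\<^sup>+z. indicator B (\<omega>, sqrt (h \<omega>) *\<^sub>R z) \<partial>std_gauss \<partial>M)"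
      by (intro nn_integral_cong) (simp add: B indicator_times nn_integral_cmult)
    also have "\<dots> = (\<integral>\<^sup>+p. indicator B (case p of (\<omega>, z) \<Rightarrow> (\<omega>, sqrt (h \<omega>) *\<^sub>R z)) \<partial>(M \<Otimes>\<^sub>M std_gauss))"
    proof -
      have "(\<lambda>p. indicator B (case p of (\<omega>, z) \<Rightarrow> (\<omega>, sqrt (h \<omega>) *\<^sub>R z)) :: ennreal) \<in> borel_measurable (M \<Otimes>\<^sub>M std_gauss)"
        by (rule measurable_compose[OF m2]) (use BM in simp)
      from std_gauss.nn_integral_fst[OF this] show ?thesis by simp
    qed
    also have "\<dots> = emeasure ?R B"
      using nn_integral_distr[OF m2, of "indicator B"] BM by simp
    finally show "emeasure ?L B = emeasure ?R B" .
  qed (auto simp: setsE)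
qed

corollary strong_markov_nn_integral:
  assumes "stopping_time F \<sigma>" and "\<And>\<omega>. \<omega> \<in> space M \<Longrightarrow> 0 \<le> \<sigma> \<omega>"
    and "h \<in> borel_measurable (pre_sigma \<sigma>)" "\<And>\<omega>. \<omega> \<in> space M \<Longrightarrow> 0 \<le> h \<omega>"
    and f: "case_prod f \<in> borel_measurable (pre_sigma \<sigma> \<Otimes>\<^sub>M borel)"
  shows "(\<integral>\<^sup>+\<omega>. f \<omega> (W (\<sigma> \<omega> + h \<omega>) \<omega> - W (\<sigma> \<omega>) \<omega>) \<partial>M) = (\<integral>\<^sup>+\<omega>. \<integral>\<^sup>+z. f \<omega> (sqrt (h \<omega>) *\<^sub>R z) \<partial>std_gauss \<partial>M)"
proof -
  \<comment> \<open>The simplification removes trivial premises left over from the universally quantified ones.\<close>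
  note sm = strong_markov[OF assms(1-4), simplified implies_True_equals triv_forall_equality True_implies_equals]
  have "(\<integral>\<^sup>+\<omega>. f \<omega> (W (\<sigma> \<omega> + h \<omega>) \<omega> - W (\<sigma> \<omega>) \<omega>) \<partial>M) = (\<integral>\<^sup>+p. case_prod f (case p of (\<omega>, z) \<Rightarrow> (\<omega>, sqrt (h \<omega>) *\<^sub>R z)) \<partial>(M \<Otimes>\<^sub>M std_gauss))"
    using nn_integral_distr[OF sm(2), of "case_prod f"] nn_integral_distr[OF sm(3), of "case_prod f"] sm(1) f by simp
  also have "\<dots> = (\<integral>\<^sup>+\<omega>. \<integral>\<^sup>+z. f \<omega> (sqrt (h \<omega>) *\<^sub>R z) \<partial>std_gauss \<partial>M)"
    using std_gauss.nn_integral_fst[OF measurable_compose[OF sm(3) f]] by simp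
  finally show ?thesis .
qed

corollary strong_markov_integral:
  fixes f :: "'w \<Rightarrow> real ^ 'm \<Rightarrow> real"
  assumes "stopping_time F \<sigma>" and "\<And>\<omega>. \<omega> \<in> space M \<Longrightarrow> 0 \<le> \<sigma> \<omega>"
    and "h \<in> borel_measurable (pre_sigma \<sigma>)" "\<And>\<omega>. \<omega> \<in> space M \<Longrightarrow> 0 \<le> h \<omega>"
    and f: "case_prod f \<in> borel_measurable (pre_sigma \<sigma> \<Otimes>\<^sub>M borel)"
    and int: "integrable M (\<lambda>\<omega>. f \<omega> (W (\<sigma> \<omega> + h \<omega>) \<omega> - W (\<sigma> \<omega>) \<omega>))"
  shows "(LINT \<omega>|M. f \<omega> (W (\<sigma> \<omega> + h \<omega>) \<omega> - W (\<sigma> \<omega>) \<omega>)) = (LINT \<omega>|M. LINT z|std_gauss. f \<omega> (sqrt (h \<omega>) *\<^sub>R z))"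
proof -
  note sm = strong_markov[OF assms(1-4), simplified implies_True_equals triv_forall_equality True_implies_equals]
  interpret P: pair_sigma_finite M std_gauss by (simp add: pair_sigma_finite_def sigma_finite_measure_axioms std_gauss.sigma_finite_measure_axioms)
  have "integrable (distr M (pre_sigma \<sigma> \<Otimes>\<^sub>M borel) (\<lambda>\<omega>. (\<omega>, W (\<sigma> \<omega> + h \<omega>) \<omega> - W (\<sigma> \<omega>) \<omega>))) (case_prod f)"
  proof (rule iffD2[OF integrable_distr_eq[OF sm(2) f]])
    show "integrable M (\<lambda>\<omega>. case_prod f (\<omega>, W (\<sigma> \<omega> + h \<omega>) \<omega> - W (\<sigma> \<omega>) \<omega>))" using int by simp
  qed
  from back_subst[of "\<lambda>N. integrable N (case_prod f)", OF this sm(1)]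
  have int2: "integrable (M \<Otimes>\<^sub>M std_gauss) (\<lambda>p. case_prod f (case p of (\<omega>, z) \<Rightarrow> (\<omega>, sqrt (h \<omega>) *\<^sub>R z)))"
    by (rule iffD1[OF integrable_distr_eq[OF sm(3) f]])
  have "(LINT \<omega>|M. f \<omega> (W (\<sigma> \<omega> + h \<omega>) \<omega> - W (\<sigma> \<omega>) \<omega>)) = (LINT p|(M \<Otimes>\<^sub>M std_gauss). case_prod f (case p of (\<omega>, z) \<Rightarrow> (\<omega>, sqrt (h \<omega>) *\<^sub>R z)))"
    using integral_distr[OF sm(2) f] integral_distr[OF sm(3) f] sm(1) by simp
  also have "\<dots> = (LINT \<omega>|M. LINT z|std_gauss. f \<omega> (sqrt (h \<omega>) *\<^sub>R z))"
    using P.integral_fst'[OF int2] by simp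
  finally show ?thesis .
qed

end

section \<open>Oscillation of Brownian motion over a random interval\<close>

lemma unit_dyadic_approx:
  fixes r :: real
  assumes r: "0 \<le> r" "r \<le> 1"
  obtains x where "x \<longlonglongrightarrow> r" "\<And>J. x J \<in> {0..1}" "\<And>J. \<exists>k\<le>2 ^ J. x J = real k / 2 ^ J"
proof
  define x where "x J = real (nat \<lfloor>2 ^ J * r\<rfloor>) / 2 ^ J" for J
  have xb: "x J \<le> r" "r - x J \<le> 1 / 2 ^ J" "0 \<le> x J" "nat \<lfloor>2 ^ J * r\<rfloor> \<le> 2 ^ J" for J
  proof -
    have e: "real (nat \<lfloor>2 ^ J * r\<rfloor>) = of_int \<lfloor>2 ^ J * r\<rfloor>" using r by simp
    then have le: "real (nat \<lfloor>2 ^ J * r\<rfloor>) \<le> 2 ^ J * r" "2 ^ J * r - real (nat \<lfloor>2 ^ J * r\<rfloor>) \<le> 1" by linarith+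
    show "x J \<le> r" using le(1) by (simp add: x_def field_simps)
    have "(2 ^ J * r - real (nat \<lfloor>2 ^ J * r\<rfloor>)) / 2 ^ J \<le> 1 / 2 ^ J" by (rule divide_right_mono[OF le(2)]) simp
    then show "r - x J \<le> 1 / 2 ^ J" by (simp add: x_def diff_divide_distrib)
    show "0 \<le> x J" by (simp add: x_def)
    have "2 ^ J * r \<le> 2 ^ J" using r by simp
    then have "real (nat \<lfloor>2 ^ J * r\<rfloor>) \<le> real (2 ^ J)" using le(1) unfolding of_nat_power of_nat_numeral by linarith
    then show "nat \<lfloor>2 ^ J * r\<rfloor> \<le> 2 ^ J" by (simp only: of_nat_le_iff)
  qed
  show "x \<longlonglongrightarrow> r"
  proof (rule tendsto_sandwich[of "\<lambda>J. r - 1 / 2 ^ J" _ _ "\<lambda>_. r"])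
    have "r - 1 / 2 ^ J \<le> x J" for J using xb(2)[of J] by linarith
    then show "\<forall>\<^sub>F J in sequentially. r - 1 / 2 ^ J \<le> x J" by (intro always_eventually allI)
    show "\<forall>\<^sub>F J in sequentially. x J \<le> r" by (intro always_eventually allI xb)
    have "(\<lambda>J. r - (1 / 2) ^ J) \<longlonglongrightarrow> r - 0" by (intro tendsto_diff tendsto_const LIMSEQ_power_zero) auto
    then show "(\<lambda>J. r - 1 / 2 ^ J) \<longlonglongrightarrow> r" by (simp add: power_one_over)
  qed simp
  show "x J \<in> {0..1}" for J using xb(1,3)[of J] r by simp
  show "\<exists>k\<le>2 ^ J. x J = real k / 2 ^ J" for J using xb(4)[of J] by (auto simp: x_def)
qed

text \<open>A dyadic point of level \<open>J\<close> is reached from \<open>0\<close> by at most one increment of each level up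
  to \<open>J\<close>, so the distances form a geometric series; continuity extends the bound to all points.\<close>
lemma dyadic_chaining:
  fixes f :: "real \<Rightarrow> 'a :: real_normed_vector"
  assumes a: "0 \<le> a" and \<rho>: "0 < \<rho>" "\<rho> < 1" and cont: "continuous_on {0..1} f"
    and inc: "\<And>j k. k < 2 ^ j \<Longrightarrow> norm (f (real (Suc k) / 2 ^ j) - f (real k / 2 ^ j)) \<le> a * \<rho> ^ j"
    and r: "0 \<le> r" "r \<le> 1"
  shows "norm (f r - f 0) \<le> a / (1 - \<rho>)"
proof -
  have step: "norm (f (real k / 2 ^ J) - f 0) \<le> (\<Sum>j\<le>J. a * \<rho> ^ j)" if "k \<le> 2 ^ J" for k J
    using that
  proof (induction J arbitrary: k)
    case 0
    then have "k = 0 \<or> k = 1" by auto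
    then show ?case using inc[of 0 0] a by auto
  next
    case (Suc J)
    define i where "i = k div 2"
    have i: "i \<le> 2 ^ J" using Suc.prems by (simp add: i_def)
    have half: "real (2 * i) / 2 ^ Suc J = real i / 2 ^ J" by simp
    have "norm (f (real k / 2 ^ Suc J) - f (real i / 2 ^ J)) \<le> a * \<rho> ^ Suc J"
    proof (cases "even k")
      case True
      then have "k = 2 * i" by (simp add: i_def)
      then show ?thesis using half a \<rho> by simp
    next
      case False
      then have k: "k = Suc (2 * i)" by (simp add: i_def)
      have "2 * i < 2 ^ Suc J" using Suc.prems k by linarith
      from inc[OF this] show ?thesis unfolding k half .
    qed
    moreover have "norm (f (real k / 2 ^ Suc J) - f 0) \<le> norm (f (real k / 2 ^ Suc J) - f (real i / 2 ^ J)) + norm (f (real i / 2 ^ J) - f 0)"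
      using norm_triangle_ineq[of "f (real k / 2 ^ Suc J) - f (real i / 2 ^ J)" "f (real i / 2 ^ J) - f 0"] by simp
    ultimately show ?case using Suc.IH[OF i] by simp
  qed
  have geo: "(\<Sum>j\<le>J. a * \<rho> ^ j) \<le> a / (1 - \<rho>)" for J
  proof -
    have "(\<Sum>j\<le>J. \<rho> ^ j) \<le> (\<Sum>j. \<rho> ^ j)" using \<rho> by (intro sum_le_suminf summable_geometric) auto
    also have "\<dots> = 1 / (1 - \<rho>)" using \<rho> by (intro suminf_geometric) auto
    finally have "a * (\<Sum>j\<le>J. \<rho> ^ j) \<le> a * (1 / (1 - \<rho>))" by (rule mult_left_mono[OF _ a])
    then show ?thesis by (simp add: sum_distrib_left)
  qed
  obtain x where x: "x \<longlonglongrightarrow> r" "\<And>J. x J \<in> {0..1}" "\<And>J. \<exists>k\<le>2 ^ J. x J = real k / 2 ^ J"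
    by (rule unit_dyadic_approx[OF r]) blast
  have "(\<lambda>J. f (x J)) \<longlonglongrightarrow> f r"
    using x(2) r by (intro continuous_on_tendsto_compose[OF cont x(1)] always_eventually) auto
  then have "(\<lambda>J. norm (f (x J) - f 0)) \<longlonglongrightarrow> norm (f r - f 0)" by (intro tendsto_norm tendsto_diff tendsto_const)
  moreover have "norm (f (x J) - f 0) \<le> a / (1 - \<rho>)" for J
    using x(3)[of J] order_trans[OF step geo] by auto
  ultimately show ?thesis by (intro LIMSEQ_le_const2) auto
qed

text \<open>The weights \<open>v ^ j\<close> with \<open>v > 1\<close> turn a bound on this sum into a geometric bound on the
  increments of level \<open>j\<close>.\<close>
definition dyadic_energy :: "real \<Rightarrow> real \<Rightarrow> (real \<Rightarrow> 'a::real_normed_vector) \<Rightarrow> ennreal" where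
  "dyadic_energy v q f = (\<Sum>j. \<Sum>k<2 ^ j. ennreal (v ^ j) * ennreal (norm (f (real (Suc k) / 2 ^ j) - f (real k / 2 ^ j)) powr q))"

lemma oscillation_le_dyadic_energy:
  fixes f :: "real \<Rightarrow> 'a :: real_normed_vector"
  assumes q: "0 < q" and v: "1 < v" and cont: "continuous_on {0..1} f" and r: "0 \<le> r" "r \<le> 1"
  shows "ennreal (norm (f r - f 0) powr q) \<le> ennreal ((1 / (1 - v powr (- 1 / q))) powr q) * dyadic_energy v q f"
proof (cases "dyadic_energy v q f")
  case (real s)
  define \<rho> where "\<rho> = v powr (- 1 / q)"
  have \<rho>: "0 < \<rho>" "\<rho> < 1" using v q by (auto simp: \<rho>_def powr_less_one)
  define a where "a = s powr (1 / q)"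
  have "norm (f r - f 0) \<le> a / (1 - \<rho>)"
  proof (rule dyadic_chaining[OF _ \<rho> cont _ r])
    fix j k :: nat assume k: "k < 2 ^ j"
    let ?n = "norm (f (real (Suc k) / 2 ^ j) - f (real k / 2 ^ j))"
    have "ennreal (v ^ j * ?n powr q) = ennreal (v ^ j) * ennreal (?n powr q)" using v by (intro ennreal_mult') auto
    also have "\<dots> \<le> (\<Sum>k<2 ^ j. ennreal (v ^ j) * ennreal (norm (f (real (Suc k) / 2 ^ j) - f (real k / 2 ^ j)) powr q))"
      using k by (intro member_le_sum[of k "{..<2 ^ j}" "\<lambda>k. ennreal (v ^ j) * ennreal (norm (f (real (Suc k) / 2 ^ j) - f (real k / 2 ^ j)) powr q)"]) auto
    also have "\<dots> \<le> dyadic_energy v q f" unfolding dyadic_energy_def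
      using sum_le_suminf[OF summableI, of "{j}" "\<lambda>j. \<Sum>k<2 ^ j. ennreal (v ^ j) * ennreal (norm (f (real (Suc k) / 2 ^ j) - f (real k / 2 ^ j)) powr q)"] by simp
    finally have "v ^ j * ?n powr q \<le> s" using real by simp
    then have "?n powr q \<le> s * (1 / v) ^ j" using v by (simp add: field_simps power_one_over)
    then have "(?n powr q) powr (1 / q) \<le> (s * (1 / v) ^ j) powr (1 / q)" using q by (intro powr_mono2) auto
    also have "(?n powr q) powr (1 / q) = ?n" using q by (simp add: powr_powr)
    also have "(s * (1 / v) ^ j) powr (1 / q) = a * \<rho> ^ j"
    proof -
      have "((1 / v) ^ j) powr (1 / q) = ((1 / v) powr (1 / q)) ^ j"
        using v by (simp add: powr_realpow[symmetric] powr_powr mult.commute)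
      also have "(1 / v) powr (1 / q) = \<rho>" using v by (simp add: \<rho>_def powr_divide powr_minus_divide)
      finally show ?thesis using real v by (simp add: a_def powr_mult)
    qed
    finally show "?n \<le> a * \<rho> ^ j" .
  qed (simp add: a_def)
  then have "norm (f r - f 0) powr q \<le> (a / (1 - \<rho>)) powr q" using q by (intro powr_mono2) auto
  also have "\<dots> = (1 / (1 - \<rho>)) powr q * s" using real q \<rho> by (simp add: a_def powr_divide powr_powr)
  finally have "ennreal (norm (f r - f 0) powr q) \<le> ennreal ((1 / (1 - \<rho>)) powr q * s)" by (rule ennreal_leI)
  then show ?thesis using real by (simp add: ennreal_mult' \<rho>_def)
next
  case top
  have "0 < (1 / (1 - v powr (- 1 / q))) powr q"
    using powr_less_one[of v "- 1 / q"] v q by simp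
  then show ?thesis using top by (simp add: ennreal_mult_top)
qed

definition gauss_moment :: "'m::finite itself \<Rightarrow> real \<Rightarrow> ennreal" where
  "gauss_moment _ q = (\<integral>\<^sup>+z. ennreal (norm z powr q) \<partial>(std_gauss :: (real ^ 'm) measure))"

lemma gauss_moment_finite: "0 \<le> q \<Longrightarrow> gauss_moment TYPE('m::finite) q < \<infinity>"
proof -
  assume q: "0 \<le> q"
  define N where "N = nat \<lceil>q\<rceil>"
  have N: "q \<le> real N" unfolding N_def using q by linarith
  have "gauss_moment TYPE('m) q \<le> (\<integral>\<^sup>+z. ennreal ((1 + norm z) ^ N) \<partial>(std_gauss :: (real ^ 'm) measure))"
    unfolding gauss_moment_def
  proof (intro nn_integral_mono ennreal_leI)
    fix z :: "real^'m"
    have "norm z powr q \<le> (1 + norm z) powr q" using q by (intro powr_mono2) auto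
    also have "\<dots> \<le> (1 + norm z) powr real N" using N by (intro powr_mono) auto
    also have "\<dots> = (1 + norm z) ^ N" by (rule powr_realpow) (simp add: add_pos_nonneg)
    finally show "norm z powr q \<le> (1 + norm z) ^ N" .
  qed
  also have "\<dots> = ennreal (LINT z|(std_gauss :: (real ^ 'm) measure). (1 + norm z) ^ N)"
    by (intro nn_integral_eq_integral integrable_one_plus_norm_power) auto
  also have "\<dots> < \<infinity>" by simp
  finally show ?thesis .
qed

text \<open>The product of the constant from chaining, a geometric series with ratio
  \<open>2 powr (- (q - 2) / 4)\<close> and a Gaussian moment.\<close>
definition osc_const :: "'m::finite itself \<Rightarrow> real \<Rightarrow> ennreal" where
  "osc_const _ q = ennreal ((1 / (1 - (2 powr ((q - 2) / 4)) powr (- 1 / q))) powr q) *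
     (ennreal (1 / (1 - 2 powr (- (q - 2) / 4))) * gauss_moment TYPE('m) q)"

lemma osc_const_finite: "0 \<le> q \<Longrightarrow> osc_const TYPE('m::finite) q < \<infinity>"
  unfolding osc_const_def using gauss_moment_finite[where 'm='m, of q] by (auto simp: ennreal_mult_less_top)

context bm_paths begin

lemma increment_moment:
  assumes \<sigma>: "stopping_time F \<sigma>" and pos: "\<And>\<omega>. \<omega> \<in> space M \<Longrightarrow> 0 \<le> \<sigma> \<omega>"
    and h: "h \<in> borel_measurable (pre_sigma \<sigma>)" "\<And>\<omega>. \<omega> \<in> space M \<Longrightarrow> 0 \<le> h \<omega>"
    and \<psi>: "\<psi> \<in> borel_measurable (pre_sigma \<sigma>)" and r: "0 \<le> r" "r \<le> r'" and q: "0 \<le> q"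
  shows "(\<integral>\<^sup>+\<omega>. \<psi> \<omega> * ennreal (norm (W (\<sigma> \<omega> + r' * h \<omega>) \<omega> - W (\<sigma> \<omega> + r * h \<omega>) \<omega>) powr q) \<partial>M) =
    ennreal ((r' - r) powr (q / 2)) * gauss_moment TYPE('m) q * (\<integral>\<^sup>+\<omega>. \<psi> \<omega> * ennreal (h \<omega> powr (q / 2)) \<partial>M)"
proof -
  define \<tau> where "\<tau> \<omega> = \<sigma> \<omega> + r * h \<omega>" for \<omega>
  define d where "d \<omega> = (r' - r) * h \<omega>" for \<omega>
  note [measurable] = h(1) \<psi>
  have rh: "(\<lambda>\<omega>. r * h \<omega>) \<in> borel_measurable (pre_sigma \<sigma>)" "(\<lambda>\<omega>. (r' - r) * h \<omega>) \<in> borel_measurable (pre_sigma \<sigma>)" by measurable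
  have \<tau>: "stopping_time F \<tau>" unfolding \<tau>_def by (rule stopping_time_add[OF \<sigma> rh(1)]) (use h r in simp)
  have \<tau>pos: "0 \<le> \<tau> \<omega>" "0 \<le> d \<omega>" if "\<omega> \<in> space M" for \<omega> using pos[OF that] h(2)[OF that] r by (auto simp: \<tau>_def d_def)
  have later: "f \<in> borel_measurable (pre_sigma \<sigma>) \<Longrightarrow> f \<in> borel_measurable (pre_sigma \<tau>)" for f :: "'w \<Rightarrow> 'b::topological_space"
    by (rule measurable_pre_sigma_mono[OF \<sigma> \<tau>]) (use h r in \<open>auto simp: \<tau>_def\<close>)
  have d: "d \<in> borel_measurable (pre_sigma \<tau>)" unfolding d_def by (intro later rh)
  have [measurable]: "\<psi> \<in> borel_measurable (pre_sigma \<tau>)" by (intro later \<psi>)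
  have [measurable]: "h \<in> borel_measurable M" "\<psi> \<in> borel_measurable M" using measurable_pre_sigma_M[OF \<sigma> h(1)] measurable_pre_sigma_M[OF \<sigma> \<psi>] by auto
  have eq: "\<tau> \<omega> + d \<omega> = \<sigma> \<omega> + r' * h \<omega>" for \<omega> by (simp add: \<tau>_def d_def algebra_simps)
  have "(\<integral>\<^sup>+\<omega>. \<psi> \<omega> * ennreal (norm (W (\<tau> \<omega> + d \<omega>) \<omega> - W (\<tau> \<omega>) \<omega>) powr q) \<partial>M) =
     (\<integral>\<^sup>+\<omega>. \<integral>\<^sup>+z. \<psi> \<omega> * ennreal (norm (sqrt (d \<omega>) *\<^sub>R (z :: real^'m)) powr q) \<partial>std_gauss \<partial>M)"
    by (rule strong_markov_nn_integral[where f="\<lambda>\<omega> w. \<psi> \<omega> * ennreal (norm w powr q)", OF \<tau> \<tau>pos(1) d \<tau>pos(2)]) measurable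
  also have "\<dots> = (\<integral>\<^sup>+\<omega>. (ennreal ((r' - r) powr (q / 2)) * gauss_moment TYPE('m) q) * (\<psi> \<omega> * ennreal (h \<omega> powr (q / 2))) \<partial>M)"
  proof (rule nn_integral_cong)
    fix \<omega> assume \<omega>: "\<omega> \<in> space M"
    have e: "norm (sqrt (d \<omega>) *\<^sub>R z) powr q = ((r' - r) powr (q / 2) * h \<omega> powr (q / 2)) * norm z powr q" for z :: "real^'m"
      using \<tau>pos[OF \<omega>] h(2)[OF \<omega>] r by (simp add: powr_mult d_def powr_half_sqrt[symmetric] powr_powr)
    have "(\<integral>\<^sup>+z. \<psi> \<omega> * ennreal (norm (sqrt (d \<omega>) *\<^sub>R (z :: real^'m)) powr q) \<partial>std_gauss) =
      (\<integral>\<^sup>+z. (\<psi> \<omega> * ennreal ((r' - r) powr (q / 2) * h \<omega> powr (q / 2))) * ennreal (norm (z :: real^'m) powr q) \<partial>std_gauss)"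
      unfolding e by (intro nn_integral_cong) (simp add: ennreal_mult' mult_ac)
    also have "\<dots> = (\<psi> \<omega> * ennreal ((r' - r) powr (q / 2) * h \<omega> powr (q / 2))) * gauss_moment TYPE('m) q"
      unfolding gauss_moment_def by (rule nn_integral_cmult) measurable
    finally show "(\<integral>\<^sup>+z. \<psi> \<omega> * ennreal (norm (sqrt (d \<omega>) *\<^sub>R (z :: real^'m)) powr q) \<partial>std_gauss) = (ennreal ((r' - r) powr (q / 2)) * gauss_moment TYPE('m) q) * (\<psi> \<omega> * ennreal (h \<omega> powr (q / 2)))"
      by (simp add: ennreal_mult' mult_ac)
  qed
  also have "\<dots> = ennreal ((r' - r) powr (q / 2)) * gauss_moment TYPE('m) q * (\<integral>\<^sup>+\<omega>. \<psi> \<omega> * ennreal (h \<omega> powr (q / 2)) \<partial>M)"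
    by (rule nn_integral_cmult) measurable
  finally show ?thesis by (simp only: eq) (simp only: \<tau>_def)
qed

text \<open>By chaining it is enough to bound the expected dyadic energy. Level \<open>j\<close> consists of
  \<open>2 ^ j\<close> increments, each contributing \<open>(1 / 2 ^ j) powr (q / 2)\<close>, which is summable, even with
  the weights \<open>v ^ j\<close> for \<open>v = 2 powr ((q - 2) / 4)\<close>, exactly because \<open>q > 2\<close>. The factor \<open>\<psi>\<close>
  makes this a bound on conditional expectations.\<close>
lemma increment_sup_moment:
  assumes \<sigma>: "stopping_time F \<sigma>" and pos: "\<And>\<omega>. \<omega> \<in> space M \<Longrightarrow> 0 \<le> \<sigma> \<omega>"
    and h: "h \<in> borel_measurable (pre_sigma \<sigma>)" "\<And>\<omega>. \<omega> \<in> space M \<Longrightarrow> 0 \<le> h \<omega>"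
    and \<psi>: "\<psi> \<in> borel_measurable (pre_sigma \<sigma>)" and q: "2 < q"
  shows "(\<integral>\<^sup>+\<omega>. \<psi> \<omega> * (SUP r\<in>{0..1}. ennreal (norm (W (\<sigma> \<omega> + r * h \<omega>) \<omega> - W (\<sigma> \<omega>) \<omega>) powr q)) \<partial>M)
    \<le> osc_const TYPE('m) q * (\<integral>\<^sup>+\<omega>. \<psi> \<omega> * ennreal (h \<omega> powr (q / 2)) \<partial>M)"
proof -
  define v where "v = (2::real) powr ((q - 2) / 4)"
  define \<theta> where "\<theta> = (2::real) powr (- (q - 2) / 4)"
  define c where "c = (1 / (1 - v powr (- 1 / q))) powr q"
  define I where "I = (\<integral>\<^sup>+\<omega>. \<psi> \<omega> * ennreal (h \<omega> powr (q / 2)) \<partial>M)"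
  have v: "1 < v" using q by (simp add: v_def)
  have \<theta>: "0 < \<theta>" "\<theta> < 1" using q by (auto simp: \<theta>_def powr_less_one)
  define f where "f \<omega> r = W (\<sigma> \<omega> + r * h \<omega>) \<omega>" for \<omega> r
  have cont: "continuous_on {0..1} (f \<omega>)" if \<omega>: "\<omega> \<in> space M" for \<omega>
    unfolding f_def using pos[OF \<omega>] h(2)[OF \<omega>]
    by (intro continuous_on_compose2[OF continuous_path[OF \<omega>]] continuous_intros) auto
  note [measurable] = h(1) \<psi>
  have fm [measurable]: "(\<lambda>\<omega>. f \<omega> r) \<in> borel_measurable M" if "0 \<le> r" for r
  proof -
    have rh: "(\<lambda>\<omega>. r * h \<omega>) \<in> borel_measurable (pre_sigma \<sigma>)" by measurable
    have \<tau>: "stopping_time F (\<lambda>\<omega>. \<sigma> \<omega> + r * h \<omega>)" by (rule stopping_time_add[OF \<sigma> rh(1)]) (use h that in simp)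
    show ?thesis unfolding f_def
      by (rule measurable_pre_sigma_M[OF \<tau> measurable_W_stopping_time[OF \<tau>]]) (use pos h(2) that in simp)
  qed
  have \<psi>M [measurable]: "\<psi> \<in> borel_measurable M" using measurable_pre_sigma_M[OF \<sigma> \<psi>] .
  have "(\<integral>\<^sup>+\<omega>. \<psi> \<omega> * (SUP r\<in>{0..1}. ennreal (norm (W (\<sigma> \<omega> + r * h \<omega>) \<omega> - W (\<sigma> \<omega>) \<omega>) powr q)) \<partial>M)
    \<le> (\<integral>\<^sup>+\<omega>. \<psi> \<omega> * (ennreal c * dyadic_energy v q (f \<omega>)) \<partial>M)"
  proof (intro nn_integral_mono mult_left_mono SUP_least)
    fix \<omega> r assume "\<omega> \<in> space M" "r \<in> {0..1::real}"
    then show "ennreal (norm (W (\<sigma> \<omega> + r * h \<omega>) \<omega> - W (\<sigma> \<omega>) \<omega>) powr q) \<le> ennreal c * dyadic_energy v q (f \<omega>)"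
      using oscillation_le_dyadic_energy[OF _ v cont, of q \<omega> r] q by (simp add: f_def c_def)
  qed simp
  also have "\<dots> = (\<integral>\<^sup>+\<omega>. ennreal c * (\<Sum>j. \<Sum>k<2 ^ j. ennreal (v ^ j) * (\<psi> \<omega> * ennreal (norm (f \<omega> (real (Suc k) / 2 ^ j) - f \<omega> (real k / 2 ^ j)) powr q))) \<partial>M)"
    unfolding dyadic_energy_def
    by (intro nn_integral_cong) (simp add: ennreal_suminf_cmult[symmetric] sum_distrib_left mult_ac)
  also have "\<dots> = ennreal c * (\<integral>\<^sup>+\<omega>. (\<Sum>j. \<Sum>k<2 ^ j. ennreal (v ^ j) * (\<psi> \<omega> * ennreal (norm (f \<omega> (real (Suc k) / 2 ^ j) - f \<omega> (real k / 2 ^ j)) powr q))) \<partial>M)"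
    by (rule nn_integral_cmult) measurable
  also have "(\<integral>\<^sup>+\<omega>. (\<Sum>j. \<Sum>k<2 ^ j. ennreal (v ^ j) * (\<psi> \<omega> * ennreal (norm (f \<omega> (real (Suc k) / 2 ^ j) - f \<omega> (real k / 2 ^ j)) powr q))) \<partial>M)
     = (\<Sum>j. \<integral>\<^sup>+\<omega>. (\<Sum>k<2 ^ j. ennreal (v ^ j) * (\<psi> \<omega> * ennreal (norm (f \<omega> (real (Suc k) / 2 ^ j) - f \<omega> (real k / 2 ^ j)) powr q))) \<partial>M)"
    by (rule nn_integral_suminf) measurable
  also have "\<dots> = (\<Sum>j. ennreal (\<theta> ^ j) * (gauss_moment TYPE('m) q * I))"
  proof (rule suminf_cong)
    fix j :: nat
    have "(\<integral>\<^sup>+\<omega>. (\<Sum>k<2 ^ j. ennreal (v ^ j) * (\<psi> \<omega> * ennreal (norm (f \<omega> (real (Suc k) / 2 ^ j) - f \<omega> (real k / 2 ^ j)) powr q))) \<partial>M)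
      = (\<Sum>k<2 ^ j. \<integral>\<^sup>+\<omega>. ennreal (v ^ j) * (\<psi> \<omega> * ennreal (norm (f \<omega> (real (Suc k) / 2 ^ j) - f \<omega> (real k / 2 ^ j)) powr q)) \<partial>M)"
      by (rule nn_integral_sum) measurable
    also have "\<dots> = (\<Sum>k<2 ^ j. ennreal (v ^ j) * \<integral>\<^sup>+\<omega>. (\<psi> \<omega> * ennreal (norm (f \<omega> (real (Suc k) / 2 ^ j) - f \<omega> (real k / 2 ^ j)) powr q)) \<partial>M)"
      by (intro sum.cong refl nn_integral_cmult) measurable
    also have "\<dots> = (\<Sum>k<(2::nat) ^ j. ennreal (v ^ j) * (ennreal ((1 / 2 ^ j) powr (q / 2)) * gauss_moment TYPE('m) q * I))"
    proof (intro sum.cong refl arg_cong2[where f="(*)"])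
      fix k :: nat
      have e: "real (Suc k) / 2 ^ j - real k / 2 ^ j = 1 / 2 ^ j" by (simp add: diff_divide_distrib[symmetric])
      show "(\<integral>\<^sup>+\<omega>. (\<psi> \<omega> * ennreal (norm (f \<omega> (real (Suc k) / 2 ^ j) - f \<omega> (real k / 2 ^ j)) powr q)) \<partial>M) = ennreal ((1 / 2 ^ j) powr (q / 2)) * gauss_moment TYPE('m) q * I"
        unfolding f_def I_def e[symmetric]
        by (rule increment_moment[OF \<sigma> pos h \<psi>]) (use q in \<open>auto intro: divide_right_mono\<close>)
    qed
    also have "\<dots> = ennreal (2 ^ j * v ^ j * (1 / 2 ^ j) powr (q / 2)) * (gauss_moment TYPE('m) q * I)"
      using v by (simp add: ennreal_mult' mult_ac ennreal_power[symmetric])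
    also have "2 ^ j * v ^ j * (1 / 2 ^ j) powr (q / 2) = \<theta> ^ j"
    proof -
      have "(2::real) ^ j * v ^ j * (1 / 2 ^ j) powr (q / 2) = 2 powr (real j) * 2 powr ((q - 2) / 4 * real j) * 2 powr (- real j * (q / 2))"
        by (simp add: v_def powr_realpow[symmetric] powr_powr powr_divide powr_minus_divide)
      also have "\<dots> = 2 powr (- (q - 2) / 4 * real j)" unfolding powr_add[symmetric]
        by (rule arg_cong[where f="\<lambda>x. 2 powr x"]) (simp add: field_simps)
      also have "\<dots> = \<theta> ^ j" by (simp add: \<theta>_def powr_realpow[symmetric] powr_powr)
      finally show ?thesis .
    qed
    finally show "(\<integral>\<^sup>+\<omega>. (\<Sum>k<2 ^ j. ennreal (v ^ j) * (\<psi> \<omega> * ennreal (norm (f \<omega> (real (Suc k) / 2 ^ j) - f \<omega> (real k / 2 ^ j)) powr q))) \<partial>M)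
      = ennreal (\<theta> ^ j) * (gauss_moment TYPE('m) q * I)" .
  qed
  also have "\<dots> = (\<Sum>j. ennreal (\<theta> ^ j)) * (gauss_moment TYPE('m) q * I)" by (rule ennreal_suminf_multc)
  also have "(\<Sum>j. ennreal (\<theta> ^ j)) = ennreal (1 / (1 - \<theta>))"
    using \<theta> by (subst suminf_ennreal2) (auto simp: suminf_geometric summable_geometric)
  finally show ?thesis by (simp add: osc_const_def v_def \<theta>_def c_def I_def mult_ac)
qed

end

section \<open>Doob's inequality for sums of orthogonal increments\<close>

primrec runmax :: "(nat \<Rightarrow> real) \<Rightarrow> nat \<Rightarrow> real" where
  "runmax N 0 = N 0"
| "runmax N (Suc n) = max (runmax N n) (N (Suc n))"

lemma runmax_ge: "i \<le> n \<Longrightarrow> N i \<le> runmax N n"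
  by (induction n) (auto simp: le_Suc_eq le_max_iff_disj)

lemma runmax_least: "(\<And>i. i \<le> n \<Longrightarrow> N i \<le> c) \<Longrightarrow> runmax N n \<le> c"
  by (induction n) auto

text \<open>A deterministic inequality: summation by parts gives
  \<open>(runmax N n)\<^sup>2 / 2 + (\<Sum>i<n. runmax N i * (N (Suc i) - N i)) \<le> runmax N n * N n\<close>, because
  \<open>runmax N\<close> increases only where it equals \<open>N\<close>. The sum has mean zero for a martingale, which
  yields Doob's inequality for the one-sided maximum.\<close>
lemma doob_pathwise:
  assumes "N 0 = 0"
  shows "(runmax N n)\<^sup>2 + 4 * (\<Sum>i<n. runmax N i * (N (Suc i) - N i)) \<le> 4 * (N n)\<^sup>2"
proof -
  have "(runmax N n)\<^sup>2 / 2 + (\<Sum>i<n. runmax N i * (N (Suc i) - N i)) \<le> runmax N n * N n"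
  proof (induction n)
    case (Suc n)
    define m n' where "m = runmax N n" and "n' = N (Suc n)"
    have "(max m n')\<^sup>2 / 2 - m\<^sup>2 / 2 + m * n' \<le> max m n' * n'"
    proof (cases "n' \<le> m")
      case False
      have "0 \<le> (n' - m)\<^sup>2 / 2" by simp
      also have "\<dots> = n'\<^sup>2 / 2 + m\<^sup>2 / 2 - m * n'" by (simp add: power2_eq_square field_simps)
      finally show ?thesis using False by (simp add: power2_eq_square)
    qed simp
    then show ?case using Suc by (simp add: m_def n'_def algebra_simps)
  qed (simp add: assms)
  moreover have "4 * (runmax N n * N n) \<le> (runmax N n)\<^sup>2 + 4 * (N n)\<^sup>2"
    using zero_le_power2[of "runmax N n - 2 * N n"] by (simp add: power2_eq_square algebra_simps)
  ultimately show ?thesis by linarith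
qed

definition (in prob_space) sq_int :: "('a \<Rightarrow> real) \<Rightarrow> bool" where
  "sq_int u \<longleftrightarrow> u \<in> borel_measurable M \<and> integrable M (\<lambda>\<omega>. (u \<omega>)\<^sup>2)"

context prob_space begin

lemma sq_int_mult: "sq_int u \<Longrightarrow> sq_int v \<Longrightarrow> integrable M (\<lambda>\<omega>. u \<omega> * v \<omega>)"
  unfolding sq_int_def
proof (rule Bochner_Integration.integrable_bound[where f="\<lambda>\<omega>. (u \<omega>)\<^sup>2 + (v \<omega>)\<^sup>2"], goal_cases)
  case 3
  have "\<bar>u \<omega> * v \<omega>\<bar> \<le> (u \<omega>)\<^sup>2 + (v \<omega>)\<^sup>2" for \<omega>
    using sum_squares_bound[of "\<bar>u \<omega>\<bar>" "\<bar>v \<omega>\<bar>"] mult_nonneg_nonneg[of "\<bar>u \<omega>\<bar>" "\<bar>v \<omega>\<bar>"] by (simp add: abs_mult del: mult_nonneg_nonneg)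
  then show ?case by (intro AE_I2) (simp add: abs_mult)
qed (auto intro: borel_measurable_times)

lemma sq_int_bound:
  assumes "u \<in> borel_measurable M" "sq_int v" "sq_int v'" "\<And>\<omega>. (u \<omega>)\<^sup>2 \<le> c * ((v \<omega>)\<^sup>2 + (v' \<omega>)\<^sup>2)"
  shows "sq_int u"
  unfolding sq_int_def
proof (rule conjI[OF assms(1)], rule Bochner_Integration.integrable_bound[where f="\<lambda>\<omega>. c * ((v \<omega>)\<^sup>2 + (v' \<omega>)\<^sup>2)"])
  show "integrable M (\<lambda>\<omega>. c * ((v \<omega>)\<^sup>2 + (v' \<omega>)\<^sup>2))"
    using assms(2,3) unfolding sq_int_def by (intro integrable_mult_right Bochner_Integration.integrable_add) blast+
  show "(\<lambda>\<omega>. (u \<omega>)\<^sup>2) \<in> borel_measurable M" by (intro borel_measurable_power assms(1))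
  show "AE \<omega> in M. norm ((u \<omega>)\<^sup>2) \<le> norm (c * ((v \<omega>)\<^sup>2 + (v' \<omega>)\<^sup>2))"
    by (intro AE_I2) (simp only: real_norm_def abs_power2 order_trans[OF assms(4) abs_ge_self])
qed

lemma sq_int_add: "sq_int u \<Longrightarrow> sq_int v \<Longrightarrow> sq_int (\<lambda>\<omega>. u \<omega> + v \<omega>)"
proof (rule sq_int_bound[where v=u and v'=v and c=2])
  show "(u \<omega> + v \<omega>)\<^sup>2 \<le> 2 * ((u \<omega>)\<^sup>2 + (v \<omega>)\<^sup>2)" for \<omega>
    using sum_squares_bound[of "u \<omega>" "v \<omega>"] by (simp add: power2_sum)
qed (auto simp: sq_int_def)

lemma sq_int_max: "sq_int u \<Longrightarrow> sq_int v \<Longrightarrow> sq_int (\<lambda>\<omega>. max (u \<omega>) (v \<omega>))"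
  by (rule sq_int_bound[where v=u and v'=v and c=1]) (auto simp: sq_int_def max_def)

lemma sq_int_0: "sq_int (\<lambda>_. 0)" by (simp add: sq_int_def)

lemma doob_L2:
  fixes \<xi> N :: "nat \<Rightarrow> 'a \<Rightarrow> real"
  assumes N_def: "\<And>n \<omega>. N n \<omega> = (\<Sum>i<n. \<xi> i \<omega>)"
    and sq: "\<And>i. sq_int (\<xi> i)"
    and orth1: "\<And>i. sq_int (N i) \<Longrightarrow> (LINT \<omega>|M. N i \<omega> * \<xi> i \<omega>) = 0"
    and orth2: "\<And>i. sq_int (\<lambda>\<omega>. runmax (\<lambda>n. N n \<omega>) i) \<Longrightarrow> (LINT \<omega>|M. runmax (\<lambda>n. N n \<omega>) i * \<xi> i \<omega>) = 0"
  shows "sq_int (\<lambda>\<omega>. runmax (\<lambda>n. N n \<omega>) n)"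
    and "(LINT \<omega>|M. (runmax (\<lambda>n. N n \<omega>) n)\<^sup>2) \<le> 4 * (\<Sum>i<n. LINT \<omega>|M. (\<xi> i \<omega>)\<^sup>2)"
proof -
  have N_0: "N 0 \<omega> = 0" and N_Suc: "N (Suc n) \<omega> = N n \<omega> + \<xi> n \<omega>" for n \<omega> by (simp_all add: N_def)
  have sqN: "sq_int (N n)" for n
  proof (induction n)
    case 0 then show ?case using sq_int_0 by (simp add: N_0[abs_def])
  next
    case (Suc n)
    show ?case unfolding N_Suc[abs_def] by (rule sq_int_add[OF Suc sq])
  qed
  show sqR: "sq_int (\<lambda>\<omega>. runmax (\<lambda>n. N n \<omega>) n)" for n
    by (induction n) (simp_all add: sqN sq_int_max)
  have EN: "(LINT \<omega>|M. (N n \<omega>)\<^sup>2) = (\<Sum>i<n. LINT \<omega>|M. (\<xi> i \<omega>)\<^sup>2)" for n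
  proof (induction n)
    case (Suc n)
    have "(LINT \<omega>|M. (N (Suc n) \<omega>)\<^sup>2) = (LINT \<omega>|M. (N n \<omega>)\<^sup>2 + 2 * (N n \<omega> * \<xi> n \<omega>) + (\<xi> n \<omega>)\<^sup>2)"
      by (intro Bochner_Integration.integral_cong refl) (simp add: N_Suc power2_sum)
    also have "\<dots> = (LINT \<omega>|M. (N n \<omega>)\<^sup>2) + 2 * (LINT \<omega>|M. N n \<omega> * \<xi> n \<omega>) + (LINT \<omega>|M. (\<xi> n \<omega>)\<^sup>2)"
      using sqN[of n] sq[of n] sq_int_mult[OF sqN sq, of n n] by (simp add: sq_int_def)
    finally show ?case using Suc orth1[OF sqN[of n]] by simp
  qed (simp add: N_0)
  have int_R: "integrable M (\<lambda>\<omega>. runmax (\<lambda>n. N n \<omega>) i * \<xi> i \<omega>)" for i by (rule sq_int_mult[OF sqR sq])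
  have "(LINT \<omega>|M. (runmax (\<lambda>n. N n \<omega>) n)\<^sup>2) = (LINT \<omega>|M. (runmax (\<lambda>n. N n \<omega>) n)\<^sup>2 + 4 * (\<Sum>i<n. runmax (\<lambda>n. N n \<omega>) i * \<xi> i \<omega>))"
    using sqR[of n] int_R by (simp add: sq_int_def orth2[OF sqR])
  also have "\<dots> \<le> (LINT \<omega>|M. 4 * (N n \<omega>)\<^sup>2)"
  proof (rule integral_mono)
    show "integrable M (\<lambda>\<omega>. (runmax (\<lambda>n. N n \<omega>) n)\<^sup>2 + 4 * (\<Sum>i<n. runmax (\<lambda>n. N n \<omega>) i * \<xi> i \<omega>))"
      using sqR[of n] int_R by (simp add: sq_int_def)
    show "integrable M (\<lambda>\<omega>. 4 * (N n \<omega>)\<^sup>2)" using sqN[of n] by (simp add: sq_int_def)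
    show "(runmax (\<lambda>n. N n \<omega>) n)\<^sup>2 + 4 * (\<Sum>i<n. runmax (\<lambda>n. N n \<omega>) i * \<xi> i \<omega>) \<le> 4 * (N n \<omega>)\<^sup>2" for \<omega>
      using doob_pathwise[of "\<lambda>n. N n \<omega>" n] by (simp add: N_0 N_Suc)
  qed
  finally show "(LINT \<omega>|M. (runmax (\<lambda>n. N n \<omega>) n)\<^sup>2) \<le> 4 * (\<Sum>i<n. LINT \<omega>|M. (\<xi> i \<omega>)\<^sup>2)"
    by (simp add: EN)
qed

end

section \<open>The scheme stopped at the terminal time\<close>

text \<open>The scheme with its last step shortened so as to end at \<open>T\<close>. From then on all steps have
  length zero, so that statements about all \<open>n\<close> need no case distinction.\<close>
primrec capped_state ::
  "(real ^ 'd \<Rightarrow> real ^ 'd) \<Rightarrow> (real ^ 'd \<Rightarrow> real ^ 'm ^ 'd) \<Rightarrow> (real ^ 'd \<Rightarrow> real) \<Rightarrow> real ^ 'd \<Rightarrow> real \<Rightarrow>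
   (real \<Rightarrow> real ^ 'm) \<Rightarrow> nat \<Rightarrow> real \<times> (real ^ 'd)" where
  "capped_state f g \<delta> x0 T w 0 = (0, x0)"
| "capped_state f g \<delta> x0 T w (Suc n) =
     (let (s, x) = capped_state f g \<delta> x0 T w n; h = min (\<delta> x) (T - s)
      in (s + h, x + h *\<^sub>R f x + g x *v (w (s + h) - w s)))"

locale em_path =
  fixes f :: "real ^ 'd \<Rightarrow> real ^ 'd" and g :: "real ^ 'd \<Rightarrow> real ^ 'm ^ 'd" and \<delta> :: "real ^ 'd \<Rightarrow> real"
    and x0 :: "real ^ 'd" and T :: real and w :: "real \<Rightarrow> real ^ 'm"
  assumes \<delta>_pos: "\<And>x. 0 < \<delta> x" and T_pos: "0 < T"
begin

definition s where "s n = fst (capped_state f g \<delta> x0 T w n)"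
definition x where "x n = snd (capped_state f g \<delta> x0 T w n)"
definition h where "h n = min (\<delta> (x n)) (T - s n)"
definition bridge where "bridge n r = x n + (r * h n) *\<^sub>R f (x n) + g (x n) *v (w (s n + r * h n) - w (s n))"

abbreviation "tt \<equiv> em_time f g \<delta> x0 w"
abbreviation "yy \<equiv> em_val f g \<delta> x0 w"
abbreviation "Y \<equiv> em_interp f g \<delta> x0 w"

lemma s_0: "s 0 = 0" and x_0: "x 0 = x0" by (simp_all add: s_def x_def)

lemma s_Suc: "s (Suc n) = s n + h n"
  and x_Suc: "x (Suc n) = x n + h n *\<^sub>R f (x n) + g (x n) *v (w (s n + h n) - w (s n))"
  by (simp_all add: s_def x_def h_def Let_def split_beta)

lemma tt_0: "tt 0 = 0" and yy_0: "yy 0 = x0" by (simp_all add: em_time_def em_val_def)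

lemma tt_Suc: "tt (Suc n) = tt n + \<delta> (yy n)"
  and yy_Suc: "yy (Suc n) = yy n + \<delta> (yy n) *\<^sub>R f (yy n) + g (yy n) *v (w (tt (Suc n)) - w (tt n))"
  by (simp_all add: em_time_def em_val_def Let_def split_beta)

lemma s_le: "s n \<le> T" by (induction n) (use T_pos in \<open>auto simp: s_0 s_Suc h_def\<close>)

lemma h_nonneg: "0 \<le> h n" using less_imp_le[OF \<delta>_pos[of "x n"]] s_le[of n] by (simp add: h_def)

lemma h_le: "h n \<le> \<delta> (x n)" "h n \<le> T"
proof -
  have "0 \<le> s n" by (induction n) (auto simp: s_0 s_Suc h_nonneg)
  then show "h n \<le> T" by (simp add: h_def)
qed (simp add: h_def)

lemma s_nonneg: "0 \<le> s n" by (induction n) (auto simp: s_0 s_Suc h_nonneg)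

lemma s_eq_sum: "s n = (\<Sum>i<n. h i)" by (induction n) (auto simp: s_0 s_Suc)

text \<open>If \<open>T\<close> is hit exactly, then both alternatives apply. Beyond \<open>T\<close> only the time is compared,
  since the last value of the stopped scheme is the interpolated path at \<open>T\<close> (lemma \<open>x_at_T\<close>)
  rather than a value of the original scheme.\<close>
lemma capped_agrees:
  "(tt n \<le> T \<longrightarrow> s n = tt n \<and> x n = yy n) \<and> (T \<le> tt n \<longrightarrow> s n = T)"
proof (induction n)
  case 0
  then show ?case using T_pos by (simp add: s_0 x_0 tt_0 yy_0)
next
  case (Suc n)
  have d: "0 < \<delta> (yy n)" by (rule \<delta>_pos)
  show ?case
  proof (intro conjI impI)
    assume le: "tt (Suc n) \<le> T"
    then have "tt n \<le> T" using d by (simp add: tt_Suc)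
    then have e: "s n = tt n" "x n = yy n" using Suc by auto
    then have "h n = \<delta> (yy n)" using le by (simp add: h_def tt_Suc)
    then show "s (Suc n) = tt (Suc n)" "x (Suc n) = yy (Suc n)" by (simp_all add: s_Suc x_Suc tt_Suc yy_Suc e)
  next
    assume ge: "T \<le> tt (Suc n)"
    show "s (Suc n) = T"
    proof (cases "T \<le> tt n")
      case True
      then have "s n = T" using Suc by auto
      then show ?thesis using less_imp_le[OF \<delta>_pos[of "x n"]] by (simp add: s_Suc h_def)
    next
      case False
      then have e: "s n = tt n" "x n = yy n" using Suc by auto
      then show ?thesis using ge by (simp add: s_Suc h_def tt_Suc)
    qed
  qed
qed

lemma s_less_iff: "s n < T \<longleftrightarrow> tt n < T"
  using capped_agrees[of n] by (cases "tt n < T") auto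

lemma agrees_before_T: "s n < T \<Longrightarrow> s n = tt n \<and> x n = yy n"
  using capped_agrees[of n] s_less_iff[of n] by auto

lemma tt_strict_mono: "strict_mono tt"
  by (rule strict_monoI_Suc) (simp add: tt_Suc \<delta>_pos)

lemma Y_eq:
  assumes "tt n \<le> t" "t < tt (Suc n)"
  shows "Y t = yy n + (t - tt n) *\<^sub>R f (yy n) + g (yy n) *v (w t - w (tt n))"
proof -
  have mono: "mono tt" by (rule strict_mono_mono[OF tt_strict_mono])
  have "tt m \<le> t \<longleftrightarrow> m \<le> n" for m
    using assms monoD[OF mono, of m n] monoD[OF mono, of "Suc n" m] by (cases "m \<le> n") auto
  then have "{tt m |m. tt m \<le> t} = tt ` {..n}" by auto
  moreover have "Max (tt ` {..n}) = tt n"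
    by (rule Max_eqI) (auto intro: monoD[OF mono])
  ultimately have fl: "em_floor f g \<delta> x0 w t = tt n" unfolding em_floor_def by simp
  have "em_index f g \<delta> x0 w t = n"
    unfolding em_index_def fl using strict_mono_eq[OF tt_strict_mono] by auto
  then show ?thesis by (simp add: em_interp_def fl Let_def)
qed

lemma Y_tt: "Y (tt n) = yy n"
  using Y_eq[of n "tt n"] \<delta>_pos by (simp add: tt_Suc)

lemma bridge_1: "bridge n 1 = x (Suc n)"
  by (simp add: bridge_def x_Suc)

lemma bridge_eq_Y_before_T:
  assumes "s n < T" "0 \<le> r" "r \<le> 1"
  shows "bridge n r = Y (s n + r * h n)"
proof (cases "r * h n < \<delta> (x n)")
  case True
  have e: "s n = tt n" "x n = yy n" using agrees_before_T[OF assms(1)] by auto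
  have "0 \<le> r * h n" using assms h_nonneg by simp
  then have "Y (tt n + r * h n) = yy n + (r * h n) *\<^sub>R f (yy n) + g (yy n) *v (w (tt n + r * h n) - w (tt n))"
    using Y_eq[of n "tt n + r * h n"] True by (simp add: tt_Suc e)
  then show ?thesis by (simp add: bridge_def e)
next
  case False
  have e: "s n = tt n" "x n = yy n" using agrees_before_T[OF assms(1)] by auto
  have "r * h n \<le> h n" using assms h_nonneg by (simp add: mult_left_le_one_le)
  then have h: "h n = \<delta> (x n)" "r * h n = h n" using False h_le(1)[of n] by linarith+
  then have "s (Suc n) = tt (Suc n)" by (simp add: s_Suc tt_Suc e)
  then have "x (Suc n) = yy (Suc n)" using capped_agrees[of "Suc n"] s_le[of "Suc n"] by auto
  have "bridge n r = bridge n 1" by (simp add: bridge_def h(2))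
  also have "\<dots> = yy (Suc n)" by (simp add: bridge_1 \<open>x (Suc n) = yy (Suc n)\<close>)
  also have "\<dots> = Y (s n + r * h n)" unfolding h(2) using Y_tt[of "Suc n"] by (simp add: tt_Suc e h(1))
  finally show ?thesis .
qed

lemma x_at_T: "s n = T \<Longrightarrow> x n = Y T"
proof (induction n)
  case 0
  then show ?case using T_pos by (simp add: s_0)
next
  case (Suc n)
  show ?case
  proof (cases "s n < T")
    case True
    then show ?thesis using bridge_eq_Y_before_T[OF True, of 1] Suc.prems by (simp add: bridge_1 s_Suc)
  next
    case False
    then have sT: "s n = T" using s_le[of n] by simp
    then have "h n = 0" using less_imp_le[OF \<delta>_pos[of "x n"]] by (simp add: h_def)
    then show ?thesis using Suc.IH[OF sT] by (simp add: x_Suc)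
  qed
qed

lemma bridge_eq_Y:
  assumes "0 \<le> r" "r \<le> 1"
  shows "bridge n r = Y (s n + r * h n)"
proof (cases "s n < T")
  case False
  then have sT: "s n = T" using s_le[of n] by simp
  then have "h n = 0" using less_imp_le[OF \<delta>_pos[of "x n"]] by (simp add: h_def)
  then show ?thesis using x_at_T[OF sT] sT by (simp add: bridge_def)
qed (use bridge_eq_Y_before_T assms in blast)

lemma Y_eq_bridge:
  assumes att: "T \<le> tt k" and t: "0 \<le> t" "t \<le> T"
  shows "\<exists>n r. 0 \<le> r \<and> r \<le> 1 \<and> t = s n + r * h n"
proof -
  have sk: "s k = T" using capped_agrees[of k] att by auto
  define m where "m = (LEAST m. t \<le> s m)"
  have "t \<le> s k" using sk t by simp
  then have m: "t \<le> s m" unfolding m_def by (rule LeastI)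
  show ?thesis
  proof (cases m)
    case 0
    then show ?thesis using m t by (intro exI[of _ 0] exI[of _ 0]) (simp add: s_0)
  next
    case (Suc n)
    have "\<not> t \<le> s n" using not_less_Least[of n "\<lambda>m. t \<le> s m"] Suc by (simp add: m_def)
    then have tn: "s n < t" "t \<le> s n + h n" using m Suc by (auto simp: s_Suc)
    then show ?thesis by (intro exI[of _ n] exI[of _ "(t - s n) / h n"]) (auto simp: field_simps)
  qed
qed

text \<open>On a ball the continuous function \<open>\<delta>\<close> has a positive minimum, which bounds all steps from
  below.\<close>
lemma attained_if_bounded:
  assumes \<delta>: "continuous_on UNIV \<delta>" and bounded: "\<And>n. norm (x n) \<le> R"
  shows "\<exists>k>0. T \<le> tt k"
proof (rule ccontr)
  assume "\<not> (\<exists>k>0. T \<le> tt k)"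
  then have less: "tt k < T" for k using T_pos by (cases k) (auto simp: tt_0 not_le)
  have "cball (0 :: real^'d) R \<noteq> {}" using order_trans[OF norm_ge_zero bounded[of 0]] by simp
  then obtain z where z: "\<And>y. y \<in> cball 0 R \<Longrightarrow> \<delta> z \<le> \<delta> y"
    using continuous_attains_inf[OF compact_cball _ continuous_on_subset[OF \<delta> subset_UNIV], of 0 R] by blast
  have "real n * \<delta> z \<le> tt n" for n
  proof (induction n)
    case (Suc n)
    have "yy n = x n" using agrees_before_T[of n] s_less_iff[of n] less[of n] by simp
    then have "\<delta> z \<le> \<delta> (yy n)" using z bounded[of n] by simp
    then show ?case using Suc by (simp add: tt_Suc algebra_simps)
  qed (simp add: tt_0)
  moreover obtain n :: nat where "T / \<delta> z \<le> real n" using real_arch_simple by blast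
  then have "T \<le> real n * \<delta> z" using \<delta>_pos[of z] by (simp add: field_simps)
  ultimately show False using less[of n] by (meson not_le order_trans)
qed

text \<open>The supremum over an interval becomes a supremum over countably many steps and a fixed
  unit interval, whose constituents are expressed by stopping times.\<close>
lemma Sup_Y_eq_Sup_bridge:
  assumes "T \<le> tt k"
  shows "(SUP t\<in>{0..T}. \<phi> (Y t)) = (SUP n. SUP r\<in>{0..1}. \<phi> (bridge n r) :: ennreal)"
proof (rule antisym)
  show "(SUP t\<in>{0..T}. \<phi> (Y t)) \<le> (SUP n. SUP r\<in>{0..1}. \<phi> (bridge n r))"
  proof (rule SUP_least)
    fix t assume "t \<in> {0..T}"
    then obtain n r where "0 \<le> r" "r \<le> 1" "t = s n + r * h n" using Y_eq_bridge[OF assms, of t] by auto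
    then have e: "\<phi> (Y t) = \<phi> (bridge n r)" "r \<in> {0..1}" using bridge_eq_Y[of r n] by auto
    show "\<phi> (Y t) \<le> (SUP n. SUP r\<in>{0..1}. \<phi> (bridge n r))" unfolding e(1)
      by (rule order_trans[OF SUP_upper[OF e(2), of "\<lambda>r. \<phi> (bridge n r)"] SUP_upper[OF UNIV_I, of "\<lambda>n. SUP r\<in>{0..1}. \<phi> (bridge n r)" n]])
  qed
  show "(SUP n. SUP r\<in>{0..1}. \<phi> (bridge n r)) \<le> (SUP t\<in>{0..T}. \<phi> (Y t))"
  proof (intro SUP_least)
    fix n and r :: real assume r: "r \<in> {0..1}"
    have "s n + r * h n \<in> {0..T}"
    proof -
      have "r * h n \<le> h n" using r h_nonneg by (simp add: mult_left_le_one_le)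
      moreover have "s n + h n \<le> T" using s_le[of "Suc n"] by (simp add: s_Suc)
      ultimately show ?thesis using r h_nonneg[of n] s_nonneg[of n] by simp
    qed
    then show "\<phi> (bridge n r) \<le> (SUP t\<in>{0..T}. \<phi> (Y t))"
      using bridge_eq_Y[of r n] r by (auto intro: SUP_upper)
  qed
qed

end

section \<open>Moments at the grid points\<close>

lemma measurable_matrix_vector [measurable]:
  assumes [measurable]: "A \<in> borel_measurable N" "v \<in> borel_measurable N"
  shows "(\<lambda>\<omega>. (A \<omega> :: real^'m^'d) *v v \<omega>) \<in> borel_measurable N"
proof (rule borel_measurable_continuous_Pair[OF assms])
  show "continuous_on UNIV (\<lambda>x :: (real^'m^'d) \<times> (real^'m). fst x *v snd x)"
    unfolding matrix_vector_mult_def by (intro continuous_intros)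
qed

text \<open>The stopped scheme driven by a Brownian motion. What is known about the coefficients
  enters only through the one-step bounds with a common constant \<open>C\<close>.\<close>
locale em_chain = bm_paths M F W for M :: "'w measure" and F and W :: "real \<Rightarrow> 'w \<Rightarrow> real ^ 'm" +
  fixes f :: "real ^ 'd \<Rightarrow> real ^ 'd" and g :: "real ^ 'd \<Rightarrow> real ^ 'm ^ 'd" and \<delta> :: "real ^ 'd \<Rightarrow> real"
    and x0 :: "real ^ 'd" and T p q B C :: real
  assumes \<delta>_pos: "\<And>x. 0 < \<delta> x" and T_pos: "0 < T"
    and f_cont: "continuous_on UNIV f" and g_cont: "continuous_on UNIV g" and \<delta>_cont: "continuous_on UNIV \<delta>"
    and q: "2 < q" and q_le: "q \<le> p" and C_nonneg: "0 \<le> C"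
    and step: "\<And>y h. 0 \<le> h \<Longrightarrow> h \<le> \<delta> y \<Longrightarrow> h \<le> T \<Longrightarrow> em_step y (f y) (g y) h (h powr (1 / 3)) B"
    and growth_p: "\<And>y h. 0 \<le> h \<Longrightarrow> h \<le> \<delta> y \<Longrightarrow> h \<le> T \<Longrightarrow>
      (LINT z|std_gauss. lyap p (y + em_step.incr (f y) (g y) h z)) \<le> lyap p y * (1 + C * h)"
    and growth_half: "\<And>y h. 0 \<le> h \<Longrightarrow> h \<le> \<delta> y \<Longrightarrow> h \<le> T \<Longrightarrow>
      (LINT z|std_gauss. lyap (q / 2) (y + em_step.incr (f y) (g y) h z)) \<le> lyap (q / 2) y * (1 + C * h)"
    and fluctuation: "\<And>y h. 0 \<le> h \<Longrightarrow> h \<le> \<delta> y \<Longrightarrow> h \<le> T \<Longrightarrow>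
      (LINT z|std_gauss. (lyap (q / 2) (y + em_step.incr (f y) (g y) h z) - lyap (q / 2) y)\<^sup>2) \<le> C * (lyap p y * h)"
    and drift_power: "\<And>y h. 0 \<le> h \<Longrightarrow> h \<le> \<delta> y \<Longrightarrow> h \<le> T \<Longrightarrow> (h * norm (f y)) powr q \<le> C * (lyap p y * h)"
    and diffusion_power: "\<And>y h. 0 \<le> h \<Longrightarrow> h \<le> \<delta> y \<Longrightarrow> h \<le> T \<Longrightarrow> norm (g y) powr q * h powr (q / 2) \<le> C * (lyap p y * h)"
begin

definition S where "S n \<omega> = em_path.s f g \<delta> x0 T (\<lambda>t. W t \<omega>) n"
definition X where "X n \<omega> = em_path.x f g \<delta> x0 T (\<lambda>t. W t \<omega>) n"
definition H where "H n \<omega> = em_path.h f g \<delta> x0 T (\<lambda>t. W t \<omega>) n"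
definition next_val where "next_val n \<omega> z = X n \<omega> + em_step.incr (f (X n \<omega>)) (g (X n \<omega>)) (H n \<omega>) z"

lemma em_path: "em_path \<delta> T" by unfold_locales (rule \<delta>_pos T_pos)+

lemma S_0: "S 0 \<omega> = 0" and X_0: "X 0 \<omega> = x0" and S_Suc: "S (Suc n) \<omega> = S n \<omega> + H n \<omega>"
  and X_Suc: "X (Suc n) \<omega> = X n \<omega> + H n \<omega> *\<^sub>R f (X n \<omega>) + g (X n \<omega>) *v (W (S n \<omega> + H n \<omega>) \<omega> - W (S n \<omega>) \<omega>)"
  and H_eq: "H n \<omega> = min (\<delta> (X n \<omega>)) (T - S n \<omega>)"
  using em_path.s_0[OF em_path] em_path.x_0[OF em_path] em_path.s_Suc[OF em_path] em_path.x_Suc[OF em_path] em_path.h_def[OF em_path]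
  by (simp_all add: S_def X_def H_def)

lemma S_le: "S n \<omega> \<le> T" and S_nonneg: "0 \<le> S n \<omega>" and H_nonneg: "0 \<le> H n \<omega>" and H_le: "H n \<omega> \<le> \<delta> (X n \<omega>)" "H n \<omega> \<le> T"
  and S_eq_sum: "S n \<omega> = (\<Sum>i<n. H i \<omega>)"
  using em_path.s_le[OF em_path] em_path.s_nonneg[OF em_path] em_path.h_nonneg[OF em_path] em_path.h_le[OF em_path] em_path.s_eq_sum[OF em_path]
  by (simp_all add: S_def X_def H_def)

lemmas H_admissible = H_nonneg H_le

lemma measurable_coeffs [measurable]: "f \<in> borel_measurable borel" "g \<in> borel_measurable borel" "\<delta> \<in> borel_measurable borel"
  by (intro borel_measurable_continuous_onI f_cont g_cont \<delta>_cont)+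

text \<open>Each grid time is the previous one plus a length known there, so it is again a stopping
  time, and the new value is known at the new time.\<close>
lemma stopping_and_adapted: "stopping_time F (S n) \<and> X n \<in> borel_measurable (pre_sigma (S n))"
proof (induction n)
  case 0
  have "S 0 = (\<lambda>_. 0)" "X 0 = (\<lambda>_. x0)" by (auto simp: S_0 X_0)
  then show ?case by (simp add: stopping_time_const)
next
  case (Suc n)
  then have st: "stopping_time F (S n)" and [measurable]: "X n \<in> borel_measurable (pre_sigma (S n))" by auto
  note [measurable] = measurable_stopping_time_pre_sigma[OF st]
  have H: "H n \<in> borel_measurable (pre_sigma (S n))" unfolding H_eq[abs_def] by measurable
  note [measurable] = H
  have eq: "S (Suc n) = (\<lambda>\<omega>. S n \<omega> + H n \<omega>)" by (auto simp: S_Suc)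
  have st': "stopping_time F (S (Suc n))" unfolding eq by (rule stopping_time_add[OF st H H_nonneg])
  have later: "u \<in> borel_measurable (pre_sigma (S n)) \<Longrightarrow> u \<in> borel_measurable (pre_sigma (S (Suc n)))" for u :: "'w \<Rightarrow> 'b::topological_space"
    by (rule measurable_pre_sigma_mono[OF st st']) (simp_all add: S_Suc H_nonneg)
  have [measurable]: "(\<lambda>\<omega>. W (S n \<omega> + H n \<omega>) \<omega> - W (S n \<omega>) \<omega>) \<in> borel_measurable (pre_sigma (S (Suc n)))"
    unfolding eq by (rule measurable_increment[OF st S_nonneg H H_nonneg])
  have [measurable]: "(\<lambda>\<omega>. X n \<omega> + H n \<omega> *\<^sub>R f (X n \<omega>)) \<in> borel_measurable (pre_sigma (S (Suc n)))" by (rule later) measurable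
  have [measurable]: "(\<lambda>\<omega>. g (X n \<omega>)) \<in> borel_measurable (pre_sigma (S (Suc n)))" by (rule later) measurable
  have "X (Suc n) \<in> borel_measurable (pre_sigma (S (Suc n)))" unfolding X_Suc[abs_def] by measurable
  with st' show ?case by simp
qed

lemma stopping_S: "stopping_time F (S n)" and adapted_X [measurable]: "X n \<in> borel_measurable (pre_sigma (S n))"
  using stopping_and_adapted by auto

lemma adapted_S [measurable]: "S n \<in> borel_measurable (pre_sigma (S n))" by (rule measurable_stopping_time_pre_sigma[OF stopping_S])

lemma adapted_H [measurable]: "H n \<in> borel_measurable (pre_sigma (S n))"
  unfolding H_eq[abs_def] by measurable

lemma adapted_M: "u \<in> pre_sigma (S n) \<rightarrow>\<^sub>M N \<Longrightarrow> u \<in> M \<rightarrow>\<^sub>M N" by (rule measurable_pre_sigma_M[OF stopping_S])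

lemma adapted_later: "u \<in> pre_sigma (S m) \<rightarrow>\<^sub>M N \<Longrightarrow> m \<le> n \<Longrightarrow> u \<in> pre_sigma (S n) \<rightarrow>\<^sub>M N"
proof (rule measurable_pre_sigma_mono[OF stopping_S stopping_S])
  fix \<omega> assume "m \<le> n"
  then show "S m \<omega> \<le> S n \<omega>" unfolding S_eq_sum by (intro sum_mono2) (auto simp: H_nonneg)
qed

lemma measurable_X_M [measurable]: "X n \<in> borel_measurable M" and measurable_H_M [measurable]: "H n \<in> borel_measurable M"
  and measurable_S_M [measurable]: "S n \<in> borel_measurable M"
  by (rule adapted_M[OF adapted_X] adapted_M[OF adapted_H] adapted_M[OF adapted_S])+

lemma step_H: "em_step (X n \<omega>) (f (X n \<omega>)) (g (X n \<omega>)) (H n \<omega>) (H n \<omega> powr (1 / 3)) B"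
  by (rule step[OF H_admissible])

lemma incr_eq: "em_step.incr fv gv h z = h *\<^sub>R fv + sqrt h *\<^sub>R (gv *v z)" if "em_step y fv gv h k B" for y fv and gv :: "real^'m^'d" and h k z
  by (rule em_step.incr_def[OF that])

lemma next_val_eq: "next_val n \<omega> z = X n \<omega> + H n \<omega> *\<^sub>R f (X n \<omega>) + g (X n \<omega>) *v (sqrt (H n \<omega>) *\<^sub>R z)"
  unfolding next_val_def incr_eq[OF step_H] by (simp add: matrix_vector_mult_scaleR)

text \<open>The Markov property of the chain. The function \<open>\<Psi>\<close> may depend on the whole past, for
  instance through the next grid time.\<close>
lemma one_step_nn_integral:
  assumes [measurable]: "case_prod \<Psi> \<in> borel_measurable (pre_sigma (S n) \<Otimes>\<^sub>M borel)"
  shows "(\<integral>\<^sup>+\<omega>. \<Psi> \<omega> (X (Suc n) \<omega>) \<partial>M) = (\<integral>\<^sup>+\<omega>. \<integral>\<^sup>+z. \<Psi> \<omega> (next_val n \<omega> z) \<partial>std_gauss \<partial>M)"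
proof -
  have "(\<lambda>p. (fst p, X n (fst p) + H n (fst p) *\<^sub>R f (X n (fst p)) + g (X n (fst p)) *v snd p)) \<in> pre_sigma (S n) \<Otimes>\<^sub>M borel \<rightarrow>\<^sub>M pre_sigma (S n) \<Otimes>\<^sub>M borel"
    by measurable
  from measurable_compose[OF this assms]
  have "case_prod (\<lambda>\<omega> v. \<Psi> \<omega> (X n \<omega> + H n \<omega> *\<^sub>R f (X n \<omega>) + g (X n \<omega>) *v v)) \<in> borel_measurable (pre_sigma (S n) \<Otimes>\<^sub>M borel)"
    by (simp add: case_prod_beta')
  from strong_markov_nn_integral[OF stopping_S S_nonneg adapted_H H_nonneg this]
  show ?thesis unfolding X_Suc next_val_eq .
qed

lemma one_step_integral:
  fixes \<Psi> :: "'w \<Rightarrow> real ^ 'd \<Rightarrow> real"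
  assumes m: "case_prod \<Psi> \<in> borel_measurable (pre_sigma (S n) \<Otimes>\<^sub>M borel)" and int: "integrable M (\<lambda>\<omega>. \<Psi> \<omega> (X (Suc n) \<omega>))"
  shows "(LINT \<omega>|M. \<Psi> \<omega> (X (Suc n) \<omega>)) = (LINT \<omega>|M. LINT z|std_gauss. \<Psi> \<omega> (next_val n \<omega> z))"
proof -
  have "(\<lambda>p. (fst p, X n (fst p) + H n (fst p) *\<^sub>R f (X n (fst p)) + g (X n (fst p)) *v snd p)) \<in> pre_sigma (S n) \<Otimes>\<^sub>M borel \<rightarrow>\<^sub>M pre_sigma (S n) \<Otimes>\<^sub>M borel"
    by measurable
  from measurable_compose[OF this m]
  have "case_prod (\<lambda>\<omega> v. \<Psi> \<omega> (X n \<omega> + H n \<omega> *\<^sub>R f (X n \<omega>) + g (X n \<omega>) *v v)) \<in> borel_measurable (pre_sigma (S n) \<Otimes>\<^sub>M borel)"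
    by (simp add: case_prod_beta')
  from strong_markov_integral[OF stopping_S S_nonneg adapted_H H_nonneg this] int
  show ?thesis unfolding X_Suc next_val_eq by simp
qed

lemma integrable_next_lyap: "0 \<le> a \<Longrightarrow> integrable std_gauss (\<lambda>z. lyap a (next_val n \<omega> z) ^ j)"
  unfolding next_val_def
  by (rule em_step.integrable_lyap[OF step_H, where N="nat \<lceil>a\<rceil>"]) (auto simp: real_nat_ceiling_ge)

lemma measurable_next_val [measurable]: "next_val n \<omega> \<in> borel_measurable borel"
  unfolding next_val_eq[abs_def] by measurable

text \<open>The rate exceeds the growth rate \<open>C\<close> by one; the surplus pays for the loss in
  \<open>weight_decay\<close>.\<close>
definition weight where "weight n \<omega> = exp (- (C + 1) * S n \<omega>)"

definition loss where "loss = 1 / (1 + (C + 1) * T)"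

lemma loss_pos: "0 < loss" using C_nonneg T_pos unfolding loss_def by (intro divide_pos_pos add_pos_nonneg) auto

lemma weight_pos: "0 < weight n \<omega>" by (simp add: weight_def)

lemma weight_ge: "exp (- (C + 1) * T) \<le> weight n \<omega>"
  unfolding weight_def using S_le[of n \<omega>] C_nonneg by simp

lemma adapted_weight [measurable]: "weight n \<in> borel_measurable (pre_sigma (S n))"
  unfolding weight_def[abs_def] by measurable

lemma adapted_weight_Suc [measurable]: "weight (Suc n) \<in> borel_measurable (pre_sigma (S n))"
  unfolding weight_def[abs_def] S_Suc by measurable

text \<open>The sum of these terms plays the part of the integral of \<open>lyap p\<close> along the path.\<close>
definition occ where "occ n \<omega> = lyap p (X n \<omega>) * H n \<omega>"

lemma occ_nonneg: "0 \<le> occ n \<omega>"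
  using lyap_pos[of p "X n \<omega>"] H_nonneg[of n \<omega>] by (simp add: occ_def)

lemma measurable_occ [measurable]: "occ n \<in> borel_measurable M"
  unfolding occ_def[abs_def] by measurable

text \<open>Writing \<open>c = C + 1\<close>,
  \<open>exp (- c h) * (1 + C h) \<le> (1 + C h) / (1 + c h) = 1 - h / (1 + c h)\<close>, and \<open>h \<le> T\<close>.\<close>
lemma weight_decay: "weight (Suc n) \<omega> * (1 + C * H n \<omega>) + weight n \<omega> * loss * H n \<omega> \<le> weight n \<omega>"
proof -
  define h where "h = H n \<omega>"
  define c where "c = C + 1"
  have h: "0 \<le> h" "h \<le> T" and c: "1 \<le> c" using H_admissible[of n \<omega>] C_nonneg by (auto simp: h_def c_def)
  have ch: "0 \<le> c * h" using c h by simp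
  have "exp (- (c * h)) \<le> 1 / (1 + c * h)"
    using exp_ge_add_one_self[of "c * h"] ch by (simp add: exp_minus inverse_eq_divide divide_left_mono)
  then have "exp (- (c * h)) * (1 + C * h) \<le> 1 / (1 + c * h) * (1 + C * h)"
    using C_nonneg h by (intro mult_right_mono) auto
  also have "\<dots> = 1 - h / (1 + c * h)" using ch by (simp add: field_simps c_def)
  also have "\<dots> \<le> 1 - h / (1 + c * T)" using h c T_pos ch
    by (intro diff_left_mono divide_left_mono mult_pos_pos add_left_mono mult_left_mono) (auto intro: add_pos_nonneg)
  finally have "exp (- (c * h)) * (1 + C * h) + loss * h \<le> 1" by (simp add: loss_def c_def)
  then have "weight n \<omega> * (exp (- (c * h)) * (1 + C * h) + loss * h) \<le> weight n \<omega> * 1"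
    using weight_pos[of n \<omega>] by (intro mult_left_mono) auto
  moreover have "weight (Suc n) \<omega> = weight n \<omega> * exp (- (c * h))"
    by (simp add: weight_def S_Suc h_def c_def exp_add[symmetric] algebra_simps)
  ultimately show ?thesis by (simp add: h_def algebra_simps)
qed

lemma weighted_moment_step:
  "(\<integral>\<^sup>+\<omega>. ennreal (weight (Suc n) \<omega> * lyap p (X (Suc n) \<omega>)) \<partial>M) + (\<integral>\<^sup>+\<omega>. ennreal (weight n \<omega> * loss * occ n \<omega>) \<partial>M)
   \<le> (\<integral>\<^sup>+\<omega>. ennreal (weight n \<omega> * lyap p (X n \<omega>)) \<partial>M)"
proof -
  have p0: "0 \<le> p" using q q_le by simp
  have "(\<integral>\<^sup>+\<omega>. ennreal (weight (Suc n) \<omega> * lyap p (X (Suc n) \<omega>)) \<partial>M) =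
    (\<integral>\<^sup>+\<omega>. \<integral>\<^sup>+z. ennreal (weight (Suc n) \<omega> * lyap p (next_val n \<omega> z)) \<partial>std_gauss \<partial>M)"
    by (rule one_step_nn_integral[where \<Psi>="\<lambda>\<omega> x. ennreal (weight (Suc n) \<omega> * lyap p x)"]) measurable
  also have "\<dots> \<le> (\<integral>\<^sup>+\<omega>. ennreal (weight (Suc n) \<omega> * (lyap p (X n \<omega>) * (1 + C * H n \<omega>))) \<partial>M)"
  proof (rule nn_integral_mono)
    fix \<omega>
    have "(\<integral>\<^sup>+z. ennreal (weight (Suc n) \<omega> * lyap p (next_val n \<omega> z)) \<partial>std_gauss) =
      ennreal (LINT z|std_gauss. weight (Suc n) \<omega> * lyap p (next_val n \<omega> z))"
      using integrable_next_lyap[OF p0, of n \<omega> 1]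
      by (intro nn_integral_eq_integral AE_I2 mult_nonneg_nonneg less_imp_le[OF weight_pos] less_imp_le[OF lyap_pos]) simp
    also have "(LINT z|std_gauss. weight (Suc n) \<omega> * lyap p (next_val n \<omega> z)) = weight (Suc n) \<omega> * (LINT z|std_gauss. lyap p (next_val n \<omega> z))"
      by simp
    also have "\<dots> \<le> weight (Suc n) \<omega> * (lyap p (X n \<omega>) * (1 + C * H n \<omega>))"
      unfolding next_val_def by (intro mult_left_mono growth_p H_admissible less_imp_le[OF weight_pos])
    finally show "(\<integral>\<^sup>+z. ennreal (weight (Suc n) \<omega> * lyap p (next_val n \<omega> z)) \<partial>std_gauss)
      \<le> ennreal (weight (Suc n) \<omega> * (lyap p (X n \<omega>) * (1 + C * H n \<omega>)))" by (simp add: ennreal_leI)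
  qed
  finally have "(\<integral>\<^sup>+\<omega>. ennreal (weight (Suc n) \<omega> * lyap p (X (Suc n) \<omega>)) \<partial>M) + (\<integral>\<^sup>+\<omega>. ennreal (weight n \<omega> * loss * occ n \<omega>) \<partial>M)
    \<le> (\<integral>\<^sup>+\<omega>. ennreal (weight (Suc n) \<omega> * (lyap p (X n \<omega>) * (1 + C * H n \<omega>))) \<partial>M) + (\<integral>\<^sup>+\<omega>. ennreal (weight n \<omega> * loss * occ n \<omega>) \<partial>M)"
    by (rule add_right_mono)
  also have "\<dots> = (\<integral>\<^sup>+\<omega>. ennreal (weight (Suc n) \<omega> * (lyap p (X n \<omega>) * (1 + C * H n \<omega>))) + ennreal (weight n \<omega> * loss * occ n \<omega>) \<partial>M)"
  proof (rule nn_integral_add[symmetric])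
    have [measurable]: "weight n \<in> borel_measurable M" "weight (Suc n) \<in> borel_measurable M" by (rule adapted_M[OF adapted_weight])+
    show "(\<lambda>\<omega>. ennreal (weight (Suc n) \<omega> * (lyap p (X n \<omega>) * (1 + C * H n \<omega>)))) \<in> borel_measurable M" by measurable
    show "(\<lambda>\<omega>. ennreal (weight n \<omega> * loss * occ n \<omega>)) \<in> borel_measurable M" by measurable
  qed
  also have "\<dots> \<le> (\<integral>\<^sup>+\<omega>. ennreal (weight n \<omega> * lyap p (X n \<omega>)) \<partial>M)"
  proof (rule nn_integral_mono)
    fix \<omega>
    note nn = less_imp_le[OF weight_pos[of n \<omega>]] less_imp_le[OF weight_pos[of "Suc n" \<omega>]] less_imp_le[OF lyap_pos[of p "X n \<omega>"]] H_nonneg[of n \<omega>] C_nonneg less_imp_le[OF loss_pos]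
    have "ennreal (weight (Suc n) \<omega> * (lyap p (X n \<omega>) * (1 + C * H n \<omega>))) + ennreal (weight n \<omega> * loss * occ n \<omega>)
       = ennreal ((weight (Suc n) \<omega> * (1 + C * H n \<omega>) + weight n \<omega> * loss * H n \<omega>) * lyap p (X n \<omega>))"
      using nn by (subst ennreal_plus[symmetric]) (auto simp: occ_def algebra_simps)
    also have "\<dots> \<le> ennreal (weight n \<omega> * lyap p (X n \<omega>))"
      using nn by (intro ennreal_leI mult_right_mono weight_decay) auto
    finally show "ennreal (weight (Suc n) \<omega> * (lyap p (X n \<omega>) * (1 + C * H n \<omega>))) + ennreal (weight n \<omega> * loss * occ n \<omega>)
      \<le> ennreal (weight n \<omega> * lyap p (X n \<omega>))" .
  qed
  finally show ?thesis .
qed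

text \<open>Since the steps are random, a bound on each moment would not bound the sum over the steps;
  the telescoping loss does.\<close>
lemma weighted_moments:
  "(\<integral>\<^sup>+\<omega>. ennreal (weight n \<omega> * lyap p (X n \<omega>)) \<partial>M) + (\<Sum>i<n. \<integral>\<^sup>+\<omega>. ennreal (weight i \<omega> * loss * occ i \<omega>) \<partial>M) \<le> ennreal (lyap p x0)"
proof (induction n)
  case 0
  then show ?case by (simp add: X_0 weight_def S_0 emeasure_space_1)
next
  case (Suc n)
  from order_trans[OF add_right_mono[OF weighted_moment_step[of n]] Suc]
  show ?case unfolding sum.lessThan_Suc by (simp only: add_ac)
qed

definition moment_bound where "moment_bound = exp ((C + 1) * T) / loss * lyap p x0"

lemma moment_bound_nonneg: "0 \<le> moment_bound"
  using less_imp_le[OF loss_pos] less_imp_le[OF lyap_pos[of p x0]] by (simp add: moment_bound_def)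

lemma unweight:
  assumes "0 \<le> u \<omega>"
  shows "ennreal (u \<omega>) \<le> ennreal (exp ((C + 1) * T) / loss) * ennreal (weight n \<omega> * loss * u \<omega>)"
proof -
  have "1 = exp ((C + 1) * T) * exp (- (C + 1) * T)" by (simp add: exp_add[symmetric] algebra_simps)
  also have "\<dots> \<le> exp ((C + 1) * T) * weight n \<omega>" by (intro mult_left_mono weight_ge) simp
  finally have "1 * u \<omega> \<le> (exp ((C + 1) * T) * weight n \<omega>) * u \<omega>" using assms by (intro mult_right_mono)
  then have "u \<omega> \<le> exp ((C + 1) * T) / loss * (weight n \<omega> * loss * u \<omega>)" using loss_pos by (simp add: field_simps)
  then show ?thesis using loss_pos by (subst ennreal_mult'[symmetric]) (auto intro: ennreal_leI)
qed

lemma occupation_le: "(\<Sum>i<n. \<integral>\<^sup>+\<omega>. ennreal (occ i \<omega>) \<partial>M) \<le> ennreal moment_bound"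
proof -
  have "(\<integral>\<^sup>+\<omega>. ennreal (occ i \<omega>) \<partial>M) \<le> ennreal (exp ((C + 1) * T) / loss) * (\<integral>\<^sup>+\<omega>. ennreal (weight i \<omega> * loss * occ i \<omega>) \<partial>M)" for i
  proof -
    have [measurable]: "weight i \<in> borel_measurable M" by (rule adapted_M[OF adapted_weight])
    have "(\<integral>\<^sup>+\<omega>. ennreal (occ i \<omega>) \<partial>M) \<le> (\<integral>\<^sup>+\<omega>. ennreal (exp ((C + 1) * T) / loss) * ennreal (weight i \<omega> * loss * occ i \<omega>) \<partial>M)"
      by (intro nn_integral_mono unweight occ_nonneg)
    also have "\<dots> = ennreal (exp ((C + 1) * T) / loss) * (\<integral>\<^sup>+\<omega>. ennreal (weight i \<omega> * loss * occ i \<omega>) \<partial>M)"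
      by (rule nn_integral_cmult) measurable
    finally show ?thesis .
  qed
  then have "(\<Sum>i<n. \<integral>\<^sup>+\<omega>. ennreal (occ i \<omega>) \<partial>M) \<le>
    (\<Sum>i<n. ennreal (exp ((C + 1) * T) / loss) * (\<integral>\<^sup>+\<omega>. ennreal (weight i \<omega> * loss * occ i \<omega>) \<partial>M))"
    by (rule sum_mono)
  also have "\<dots> = ennreal (exp ((C + 1) * T) / loss) * (\<Sum>i<n. \<integral>\<^sup>+\<omega>. ennreal (weight i \<omega> * loss * occ i \<omega>) \<partial>M)"
    by (simp add: sum_distrib_left)
  also have "\<dots> \<le> ennreal (exp ((C + 1) * T) / loss) * ennreal (lyap p x0)"
    by (intro mult_left_mono order_trans[OF _ weighted_moments[of n]]) auto
  also have "\<dots> = ennreal moment_bound" unfolding moment_bound_def using loss_pos by (intro ennreal_mult'[symmetric]) simp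
  finally show ?thesis .
qed

end

section \<open>The supremum over the grid points\<close>

context em_chain begin

definition vhalf where "vhalf n \<omega> = lyap (q / 2) (X n \<omega>)"
text \<open>The conditional expectation of \<open>vhalf (Suc n)\<close> given the past at the \<open>n\<close>-th grid time.\<close>
definition vhalf_pred where "vhalf_pred n \<omega> = (LINT z|std_gauss. lyap (q / 2) (next_val n \<omega> z))"
definition mart_diff where "mart_diff n \<omega> = vhalf (Suc n) \<omega> - vhalf_pred n \<omega>"
definition mart where "mart n \<omega> = (\<Sum>i<n. mart_diff i \<omega>)"

lemma adapted_vhalf [measurable]: "vhalf n \<in> borel_measurable (pre_sigma (S n))" unfolding vhalf_def[abs_def] by measurable

lemma adapted_vhalf_pred [measurable]: "vhalf_pred n \<in> borel_measurable (pre_sigma (S n))"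
  unfolding vhalf_pred_def[abs_def]
proof (rule std_gauss.borel_measurable_lebesgue_integral)
  show "(\<lambda>(\<omega>, z). lyap (q / 2) (next_val n \<omega> z)) \<in> borel_measurable (pre_sigma (S n) \<Otimes>\<^sub>M std_gauss)"
    unfolding next_val_eq by measurable
qed

lemma adapted_mart_diff: "mart_diff n \<in> borel_measurable (pre_sigma (S (Suc n)))"
  unfolding mart_diff_def[abs_def]
  by (intro borel_measurable_diff adapted_vhalf adapted_later[OF adapted_vhalf_pred]) simp

lemma adapted_mart: "mart n \<in> borel_measurable (pre_sigma (S n))"
  unfolding mart_def[abs_def] by (intro borel_measurable_sum adapted_later[OF adapted_mart_diff]) auto

lemma adapted_runmax_mart: "(\<lambda>\<omega>. runmax (\<lambda>n. mart n \<omega>) n) \<in> borel_measurable (pre_sigma (S n))"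
proof (induction n)
  case 0 show ?case using adapted_mart[of 0] by simp
next
  case (Suc n)
  show ?case using adapted_mart[of "Suc n"] adapted_later[OF Suc, of "Suc n"] by (simp add: borel_measurable_max)
qed

text \<open>The mean minimises the quadratic deviation, so deviations from \<open>vhalf_pred\<close> are dominated
  by deviations from \<open>vhalf\<close>.\<close>
lemma conditional_variance:
  "(LINT z|std_gauss. (lyap (q / 2) (next_val n \<omega> z) - vhalf_pred n \<omega>)\<^sup>2) \<le> C * occ n \<omega>"
proof -
  have q0: "0 \<le> q / 2" using q by simp
  note i = integrable_next_lyap[OF q0, of n \<omega> 1, simplified] integrable_next_lyap[OF q0, of n \<omega> 2]
  define u where "u z = lyap (q / 2) (next_val n \<omega> z)" for z
  have iu: "integrable std_gauss u" "integrable std_gauss (\<lambda>z. (u z)\<^sup>2)" using i by (simp_all add: u_def[abs_def])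
  have Ku: "vhalf_pred n \<omega> = (LINT z|std_gauss. u z)" by (simp add: vhalf_pred_def u_def)
  have var: "(LINT z|std_gauss. (u z - c)\<^sup>2) = (LINT z|std_gauss. (u z)\<^sup>2) - 2 * c * vhalf_pred n \<omega> + c\<^sup>2" for c
  proof -
    have "(LINT z|std_gauss. (u z - c)\<^sup>2) = (LINT z|std_gauss. (u z)\<^sup>2 - 2 * c * u z + c\<^sup>2)"
      by (intro Bochner_Integration.integral_cong refl) (simp add: power2_diff)
    also have "\<dots> = (LINT z|std_gauss. (u z)\<^sup>2) - 2 * c * vhalf_pred n \<omega> + c\<^sup>2"
      using iu by (simp add: Ku measure_std_gauss_UNIV)
    finally show ?thesis .
  qed
  have "(LINT z|std_gauss. (u z - vhalf_pred n \<omega>)\<^sup>2) \<le> (LINT z|std_gauss. (u z - vhalf n \<omega>)\<^sup>2)"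
    unfolding var using zero_le_power2[of "vhalf_pred n \<omega> - vhalf n \<omega>"] by (simp add: power2_eq_square algebra_simps)
  also have "\<dots> \<le> C * occ n \<omega>"
    unfolding u_def vhalf_def next_val_def occ_def by (rule fluctuation[OF H_admissible])
  finally show ?thesis by (simp add: u_def)
qed

lemma mart_diff_second_moment: "(\<integral>\<^sup>+\<omega>. ennreal ((mart_diff n \<omega>)\<^sup>2) \<partial>M) \<le> ennreal C * (\<integral>\<^sup>+\<omega>. ennreal (occ n \<omega>) \<partial>M)"
proof -
  have q0: "0 \<le> q / 2" using q by simp
  have "(\<integral>\<^sup>+\<omega>. ennreal ((mart_diff n \<omega>)\<^sup>2) \<partial>M) = (\<integral>\<^sup>+\<omega>. \<integral>\<^sup>+z. ennreal ((lyap (q / 2) (next_val n \<omega> z) - vhalf_pred n \<omega>)\<^sup>2) \<partial>std_gauss \<partial>M)"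
    unfolding mart_diff_def vhalf_def by (rule one_step_nn_integral[where \<Psi>="\<lambda>\<omega> x. ennreal ((lyap (q / 2) x - vhalf_pred n \<omega>)\<^sup>2)"]) measurable
  also have "\<dots> \<le> (\<integral>\<^sup>+\<omega>. ennreal C * ennreal (occ n \<omega>) \<partial>M)"
  proof (rule nn_integral_mono)
    fix \<omega>
    note i = integrable_next_lyap[OF q0, of n \<omega> 1, simplified] integrable_next_lyap[OF q0, of n \<omega> 2]
    have "(\<integral>\<^sup>+z. ennreal ((lyap (q / 2) (next_val n \<omega> z) - vhalf_pred n \<omega>)\<^sup>2) \<partial>std_gauss) = ennreal (LINT z|std_gauss. (lyap (q / 2) (next_val n \<omega> z) - vhalf_pred n \<omega>)\<^sup>2)"
    proof (intro nn_integral_eq_integral AE_I2 zero_le_power2)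
      show "integrable std_gauss (\<lambda>z. (lyap (q / 2) (next_val n \<omega> z) - vhalf_pred n \<omega>)\<^sup>2)" using i by (simp add: power2_diff)
    qed
    also have "\<dots> \<le> ennreal (C * occ n \<omega>)" by (intro ennreal_leI conditional_variance)
    finally show "(\<integral>\<^sup>+z. ennreal ((lyap (q / 2) (next_val n \<omega> z) - vhalf_pred n \<omega>)\<^sup>2) \<partial>std_gauss) \<le> ennreal C * ennreal (occ n \<omega>)"
      using C_nonneg by (simp add: ennreal_mult')
  qed
  also have "\<dots> = ennreal C * (\<integral>\<^sup>+\<omega>. ennreal (occ n \<omega>) \<partial>M)"
    by (rule nn_integral_cmult) measurable
  finally show ?thesis .
qed

lemma mart_diff_second_moment_sum: "(\<Sum>i<n. \<integral>\<^sup>+\<omega>. ennreal ((mart_diff i \<omega>)\<^sup>2) \<partial>M) \<le> ennreal (C * moment_bound)"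
proof -
  have "(\<Sum>i<n. \<integral>\<^sup>+\<omega>. ennreal ((mart_diff i \<omega>)\<^sup>2) \<partial>M) \<le> (\<Sum>i<n. ennreal C * (\<integral>\<^sup>+\<omega>. ennreal (occ i \<omega>) \<partial>M))"
    by (intro sum_mono mart_diff_second_moment)
  also have "\<dots> \<le> ennreal C * ennreal moment_bound"
    unfolding sum_distrib_left[symmetric] by (intro mult_left_mono occupation_le) simp
  finally show ?thesis using C_nonneg by (simp add: ennreal_mult')
qed

lemma sq_int_mart_diff: "sq_int (mart_diff n)"
proof -
  have m [measurable]: "mart_diff n \<in> borel_measurable M" by (rule adapted_M[OF adapted_mart_diff])
  have "(\<integral>\<^sup>+\<omega>. ennreal ((mart_diff n \<omega>)\<^sup>2) \<partial>M) \<le> (\<Sum>i<Suc n. \<integral>\<^sup>+\<omega>. ennreal ((mart_diff i \<omega>)\<^sup>2) \<partial>M)"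
    by (intro member_le_sum) auto
  also have "\<dots> < \<infinity>" by (rule order_le_less_trans[OF mart_diff_second_moment_sum]) simp
  finally have "integrable M (\<lambda>\<omega>. (mart_diff n \<omega>)\<^sup>2)" by (intro integrableI_nonneg) auto
  then show ?thesis by (simp add: sq_int_def)
qed

text \<open>Conditionally on the past, \<open>mart_diff n\<close> has mean zero.\<close>
lemma mart_diff_orthogonal:
  assumes \<psi>: "\<psi> \<in> borel_measurable (pre_sigma (S n))" "sq_int \<psi>"
  shows "(LINT \<omega>|M. \<psi> \<omega> * mart_diff n \<omega>) = 0"
proof -
  have q0: "0 \<le> q / 2" using q by simp
  note [measurable] = \<psi>(1)
  have "(LINT \<omega>|M. \<psi> \<omega> * mart_diff n \<omega>) = (LINT \<omega>|M. LINT z|std_gauss. \<psi> \<omega> * (lyap (q / 2) (next_val n \<omega> z) - vhalf_pred n \<omega>))"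
    unfolding mart_diff_def vhalf_def
  proof (rule one_step_integral[where \<Psi>="\<lambda>\<omega> x. \<psi> \<omega> * (lyap (q / 2) x - vhalf_pred n \<omega>)"])
    show "integrable M (\<lambda>\<omega>. \<psi> \<omega> * (lyap (q / 2) (X (Suc n) \<omega>) - vhalf_pred n \<omega>))"
      using sq_int_mult[OF \<psi>(2) sq_int_mart_diff[of n]] by (simp add: mart_diff_def vhalf_def)
  qed measurable
  also have "\<dots> = (LINT \<omega>|M. 0)"
    using integrable_next_lyap[OF q0, of n _ 1]
    by (intro Bochner_Integration.integral_cong refl) (simp add: vhalf_pred_def measure_std_gauss_UNIV)
  finally show ?thesis by simp
qed

lemma runmax_mart_second_moment: "(\<integral>\<^sup>+\<omega>. ennreal ((runmax (\<lambda>n. mart n \<omega>) n)\<^sup>2) \<partial>M) \<le> ennreal (4 * C * moment_bound)"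
proof -
  note doob = doob_L2[OF mart_def sq_int_mart_diff mart_diff_orthogonal[OF adapted_mart] mart_diff_orthogonal[OF adapted_runmax_mart]]
  have "(\<Sum>i<n. \<integral>\<^sup>+\<omega>. ennreal ((mart_diff i \<omega>)\<^sup>2) \<partial>M) = (\<Sum>i<n. ennreal (LINT \<omega>|M. (mart_diff i \<omega>)\<^sup>2))"
    using sq_int_mart_diff by (intro sum.cong refl nn_integral_eq_integral AE_I2 zero_le_power2) (simp add: sq_int_def)
  also have "\<dots> = ennreal (\<Sum>i<n. LINT \<omega>|M. (mart_diff i \<omega>)\<^sup>2)"
    by (rule sum_ennreal) simp
  finally have "ennreal (\<Sum>i<n. LINT \<omega>|M. (mart_diff i \<omega>)\<^sup>2) \<le> ennreal (C * moment_bound)" using mart_diff_second_moment_sum[of n] by simp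
  then have s: "(\<Sum>i<n. LINT \<omega>|M. (mart_diff i \<omega>)\<^sup>2) \<le> C * moment_bound"
    using C_nonneg moment_bound_nonneg by (subst (asm) ennreal_le_iff) auto
  have "(\<integral>\<^sup>+\<omega>. ennreal ((runmax (\<lambda>n. mart n \<omega>) n)\<^sup>2) \<partial>M) = ennreal (LINT \<omega>|M. (runmax (\<lambda>n. mart n \<omega>) n)\<^sup>2)"
    using doob(1)[of n] by (intro nn_integral_eq_integral) (auto simp: sq_int_def)
  also have "\<dots> \<le> ennreal (4 * (C * moment_bound))"
    using doob(2)[of n] s by (intro ennreal_leI) linarith
  finally show ?thesis by (simp add: mult.assoc)
qed

lemma vhalf_pos: "0 < vhalf n \<omega>" by (simp add: vhalf_def lyap_pos)

text \<open>The compensator is bounded only from above, because \<open>f\<close> may be strongly dissipative;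
  accordingly only the one-sided maximum of the martingale is needed.\<close>
lemma vhalf_le: "vhalf n \<omega> \<le> vhalf 0 \<omega> + C * (\<Sum>i<n. vhalf i \<omega> * H i \<omega>) + mart n \<omega>"
proof (induction n)
  case (Suc n)
  have "vhalf (Suc n) \<omega> = vhalf_pred n \<omega> + mart_diff n \<omega>" by (simp add: mart_diff_def)
  also have "vhalf_pred n \<omega> \<le> vhalf n \<omega> * (1 + C * H n \<omega>)"
    unfolding vhalf_pred_def vhalf_def next_val_def by (rule growth_half[OF H_admissible])
  finally show ?case using Suc by (simp add: mart_def algebra_simps)
qed (simp add: mart_def)

text \<open>The square of the compensator is estimated by the Cauchy-Schwarz inequality and
  \<open>(\<Sum>i<n. H i) \<le> T\<close>.\<close>
lemma runmax_vhalf_sq_le: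
  "(runmax (\<lambda>n. vhalf n \<omega>) n)\<^sup>2 \<le> 3 * ((vhalf 0 \<omega>)\<^sup>2 + C\<^sup>2 * T * (\<Sum>i<n. occ i \<omega>) + (runmax (\<lambda>n. mart n \<omega>) n)\<^sup>2)"
proof -
  define A where "A = (\<Sum>i<n. vhalf i \<omega> * H i \<omega>)"
  define R where "R = runmax (\<lambda>n. mart n \<omega>) n"
  have ah: "0 \<le> vhalf i \<omega> * H i \<omega>" for i using vhalf_pos[of i \<omega>] H_nonneg[of i \<omega>] by simp
  have A: "0 \<le> A" unfolding A_def by (intro sum_nonneg ah)
  have "runmax (\<lambda>n. vhalf n \<omega>) n \<le> vhalf 0 \<omega> + C * A + R"
  proof (rule runmax_least)
    fix i assume i: "i \<le> n"
    have "(\<Sum>j<i. vhalf j \<omega> * H j \<omega>) \<le> A" unfolding A_def using i ah by (intro sum_mono2) auto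
    then show "vhalf i \<omega> \<le> vhalf 0 \<omega> + C * A + R"
      using vhalf_le[of i \<omega>] runmax_ge[OF i, of "\<lambda>n. mart n \<omega>"] mult_left_mono[OF _ C_nonneg] unfolding R_def by fastforce
  qed
  moreover have "0 \<le> runmax (\<lambda>n. vhalf n \<omega>) n" using runmax_ge[of 0 n "\<lambda>n. vhalf n \<omega>"] vhalf_pos[of 0 \<omega>] by simp
  ultimately have "(runmax (\<lambda>n. vhalf n \<omega>) n)\<^sup>2 \<le> (vhalf 0 \<omega> + C * A + R)\<^sup>2" by (intro power_mono)
  also have "\<dots> \<le> 3 * ((vhalf 0 \<omega>)\<^sup>2 + (C * A)\<^sup>2 + R\<^sup>2)"
    using sum_squares_bound[of "vhalf 0 \<omega>" "C * A"] sum_squares_bound[of "vhalf 0 \<omega>" R] sum_squares_bound[of "C * A" R]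
    by (simp add: power2_eq_square algebra_simps)
  also have "(C * A)\<^sup>2 \<le> C\<^sup>2 * T * (\<Sum>i<n. occ i \<omega>)"
  proof -
    have "A\<^sup>2 = (\<Sum>i<n. sqrt (H i \<omega>) * (vhalf i \<omega> * sqrt (H i \<omega>)))\<^sup>2"
      unfolding A_def by (intro arg_cong[where f="\<lambda>x. x\<^sup>2"] sum.cong refl) (use H_nonneg in \<open>simp add: mult_ac\<close>)
    also have "\<dots> \<le> (\<Sum>i<n. (sqrt (H i \<omega>))\<^sup>2) * (\<Sum>i<n. (vhalf i \<omega> * sqrt (H i \<omega>))\<^sup>2)" by (rule Cauchy_Schwarz_ineq_sum)
    also have "\<dots> = S n \<omega> * (\<Sum>i<n. (vhalf i \<omega>)\<^sup>2 * H i \<omega>)" using H_nonneg by (simp add: power_mult_distrib S_eq_sum)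
    also have "\<dots> \<le> T * (\<Sum>i<n. occ i \<omega>)"
    proof (rule mult_mono[OF S_le])
      have "(vhalf i \<omega>)\<^sup>2 \<le> lyap p (X i \<omega>)" for i unfolding vhalf_def lyap_power2 using q_le by (intro lyap_mono) simp
      then show "(\<Sum>i<n. (vhalf i \<omega>)\<^sup>2 * H i \<omega>) \<le> (\<Sum>i<n. occ i \<omega>)"
        unfolding occ_def by (intro sum_mono mult_right_mono H_nonneg)
    qed (use T_pos H_nonneg in \<open>auto intro!: sum_nonneg\<close>)
    finally show ?thesis unfolding power_mult_distrib by (simp add: mult_left_mono mult.assoc)
  qed
  finally show ?thesis by (simp add: R_def)
qed

definition sup_bound where "sup_bound = 3 * (lyap q x0 + C\<^sup>2 * T * moment_bound + 4 * C * moment_bound)"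

lemma sup_grid_moment: "(\<integral>\<^sup>+\<omega>. (SUP n. ennreal (lyap q (X n \<omega>))) \<partial>M) \<le> ennreal sup_bound"
proof -
  have am [measurable]: "vhalf n \<in> borel_measurable M" for n by (rule adapted_M[OF adapted_vhalf])
  have rm [measurable]: "(\<lambda>\<omega>. runmax (\<lambda>n. vhalf n \<omega>) n) \<in> borel_measurable M" for n
    by (induction n) simp_all
  have Nm [measurable]: "(\<lambda>\<omega>. runmax (\<lambda>n. mart n \<omega>) n) \<in> borel_measurable M" for n by (rule adapted_M[OF adapted_runmax_mart])
  have nonneg: "0 \<le> runmax (\<lambda>n. vhalf n \<omega>) n" for n \<omega> using runmax_ge[of 0 n "\<lambda>n. vhalf n \<omega>"] vhalf_pos[of 0 \<omega>] by simp
  have "(\<integral>\<^sup>+\<omega>. (SUP n. ennreal (lyap q (X n \<omega>))) \<partial>M) \<le> (\<integral>\<^sup>+\<omega>. (SUP n. ennreal ((runmax (\<lambda>n. vhalf n \<omega>) n)\<^sup>2)) \<partial>M)"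
  proof (intro nn_integral_mono SUP_mono)
    fix \<omega> n
    have "lyap q (X n \<omega>) = (vhalf n \<omega>)\<^sup>2" by (simp add: vhalf_def lyap_power2)
    also have "\<dots> \<le> (runmax (\<lambda>n. vhalf n \<omega>) n)\<^sup>2" using vhalf_pos[of n \<omega>] by (intro power_mono runmax_ge) auto
    finally show "\<exists>m\<in>UNIV. ennreal (lyap q (X n \<omega>)) \<le> ennreal ((runmax (\<lambda>n. vhalf n \<omega>) m)\<^sup>2)" by (intro bexI[of _ n] ennreal_leI) auto
  qed
  also have "\<dots> = (SUP n. \<integral>\<^sup>+\<omega>. ennreal ((runmax (\<lambda>n. vhalf n \<omega>) n)\<^sup>2) \<partial>M)"
    by (rule nn_integral_monotone_convergence_SUP)
       (auto intro!: incseq_SucI le_funI ennreal_leI power_mono nonneg)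
  also have "\<dots> \<le> ennreal sup_bound"
  proof (rule SUP_least)
    fix n
    have "(\<integral>\<^sup>+\<omega>. ennreal ((runmax (\<lambda>n. vhalf n \<omega>) n)\<^sup>2) \<partial>M) \<le>
       (\<integral>\<^sup>+\<omega>. ennreal 3 * (ennreal (lyap q x0) + (ennreal (C\<^sup>2 * T) * (\<Sum>i<n. ennreal (occ i \<omega>)) + ennreal ((runmax (\<lambda>n. mart n \<omega>) n)\<^sup>2))) \<partial>M)"
    proof (rule nn_integral_mono)
      fix \<omega>
      have l: "0 \<le> occ i \<omega>" for i by (rule occ_nonneg)
      have "ennreal ((runmax (\<lambda>n. vhalf n \<omega>) n)\<^sup>2) \<le> ennreal (3 * (lyap q x0 + (C\<^sup>2 * T * (\<Sum>i<n. occ i \<omega>) + (runmax (\<lambda>n. mart n \<omega>) n)\<^sup>2)))"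
        using runmax_vhalf_sq_le[of \<omega> n] by (intro ennreal_leI) (simp add: vhalf_def lyap_power2 X_0 add.assoc)
      also have "\<dots> = ennreal 3 * (ennreal (lyap q x0) + (ennreal (C\<^sup>2 * T) * (\<Sum>i<n. ennreal (occ i \<omega>)) + ennreal ((runmax (\<lambda>n. mart n \<omega>) n)\<^sup>2)))"
        using l T_pos less_imp_le[OF lyap_pos[of q x0]] by (simp add: ennreal_mult ennreal_plus sum_nonneg sum_ennreal)
      finally show "ennreal ((runmax (\<lambda>n. vhalf n \<omega>) n)\<^sup>2) \<le> ennreal 3 * (ennreal (lyap q x0) + (ennreal (C\<^sup>2 * T) * (\<Sum>i<n. ennreal (occ i \<omega>)) + ennreal ((runmax (\<lambda>n. mart n \<omega>) n)\<^sup>2)))" .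
    qed
    also have "\<dots> = ennreal 3 * (ennreal (lyap q x0) + (ennreal (C\<^sup>2 * T) * (\<Sum>i<n. \<integral>\<^sup>+\<omega>. ennreal (occ i \<omega>) \<partial>M) + (\<integral>\<^sup>+\<omega>. ennreal ((runmax (\<lambda>n. mart n \<omega>) n)\<^sup>2) \<partial>M)))"
      by (simp add: nn_integral_cmult nn_integral_add nn_integral_sum emeasure_space_1)
    also have "\<dots> \<le> ennreal 3 * (ennreal (lyap q x0) + (ennreal (C\<^sup>2 * T) * ennreal moment_bound + ennreal (4 * C * moment_bound)))"
      by (intro mult_left_mono add_mono occupation_le runmax_mart_second_moment order_refl) auto
    also have "\<dots> = ennreal sup_bound"
      using C_nonneg T_pos moment_bound_nonneg less_imp_le[OF lyap_pos[of q x0]]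
      unfolding sup_bound_def add.assoc by (simp add: ennreal_mult del: distrib_left_numeral)
    finally show "(\<integral>\<^sup>+\<omega>. ennreal ((runmax (\<lambda>n. vhalf n \<omega>) n)\<^sup>2) \<partial>M) \<le> ennreal sup_bound" .
  qed
  finally show ?thesis .
qed

end

section \<open>The supremum over the interpolated path\<close>

lemma SUP_unit_interval_dyadic:
  fixes u :: "real \<Rightarrow> real"
  assumes u: "continuous_on {0..1} u"
  shows "(SUP r\<in>{0..1}. ennreal (u r)) = (SUP r\<in>(\<Union>j. (\<lambda>k. real k / 2 ^ j) ` {..2 ^ j}). ennreal (u r))" (is "_ = (SUP r\<in>?D. _)")
proof (rule antisym)
  show "(SUP r\<in>{0..1}. ennreal (u r)) \<le> (SUP r\<in>?D. ennreal (u r))"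
  proof (rule SUP_least)
    fix r :: real assume r: "r \<in> {0..1}"
    obtain x where x: "x \<longlonglongrightarrow> r" "\<And>J. x J \<in> {0..1}" "\<And>J. \<exists>k\<le>2 ^ J. x J = real k / 2 ^ J"
      using r by (auto intro: unit_dyadic_approx[of r])
    have "(\<lambda>J. ennreal (u (x J))) \<longlonglongrightarrow> ennreal (u r)"
      using x(2) r by (intro tendsto_ennrealI continuous_on_tendsto_compose[OF u x(1)] always_eventually) auto
    moreover have "ennreal (u (x J)) \<le> (SUP r\<in>?D. ennreal (u r))" for J
      using x(3)[of J] by (intro SUP_upper) auto
    ultimately show "ennreal (u r) \<le> (SUP r\<in>?D. ennreal (u r))" by (intro LIMSEQ_le_const2) auto
  qed
  show "(SUP r\<in>?D. ennreal (u r)) \<le> (SUP r\<in>{0..1}. ennreal (u r))"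
  proof (rule SUP_subset_mono)
    show "?D \<subseteq> {0..1}"
    proof
      fix r assume "r \<in> ?D"
      then obtain j k where "k \<le> 2 ^ j" "r = real k / 2 ^ j" by auto
      moreover from this(1) have "real k \<le> 2 ^ j" by (metis of_nat_le_iff of_nat_numeral of_nat_power)
      ultimately show "r \<in> {0..1}" by simp
    qed
  qed simp
qed

lemma powr_sum3_le:
  fixes a b c q :: real
  assumes "0 \<le> a" "0 \<le> b" "0 \<le> c" "0 \<le> q"
  shows "(a + b + c) powr q \<le> 3 powr q * (a powr q + b powr q + c powr q)"
proof -
  define m where "m = max a (max b c)"
  have "(a + b + c) powr q \<le> (3 * m) powr q" using assms by (intro powr_mono2) (auto simp: m_def)
  also have "\<dots> = 3 powr q * m powr q" using assms by (simp add: powr_mult m_def)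
  also have "m powr q \<le> a powr q + b powr q + c powr q" by (simp add: m_def max_def)
  finally show ?thesis by simp
qed

context em_chain begin

text \<open>The moment bound for the supremum makes the grid values almost surely bounded.\<close>
lemma attained_AE: "AE \<omega> in M. \<exists>k>0. T \<le> em_time f g \<delta> x0 (\<lambda>t. W t \<omega>) k"
proof -
  have "AE \<omega> in M. (SUP n. ennreal (lyap q (X n \<omega>))) \<noteq> \<infinity>"
  proof (rule nn_integral_PInf_AE)
    show "(\<integral>\<^sup>+\<omega>. (SUP n. ennreal (lyap q (X n \<omega>))) \<partial>M) \<noteq> \<infinity>"
      using sup_grid_moment by (auto simp: top_unique)
  qed measurable
  then show ?thesis
  proof eventually_elim
    fix \<omega> assume fin: "(SUP n. ennreal (lyap q (X n \<omega>))) \<noteq> \<infinity>"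
    then obtain c where c: "0 \<le> c" "(SUP n. ennreal (lyap q (X n \<omega>))) = ennreal c"
      by (cases "SUP n. ennreal (lyap q (X n \<omega>))") auto
    have "norm (X n \<omega>) \<le> c powr (1 / q)" for n
    proof -
      have "ennreal (lyap q (X n \<omega>)) \<le> ennreal c" unfolding c(2)[symmetric] by (rule SUP_upper) simp
      then have "lyap q (X n \<omega>) \<le> c" using c(1) by simp
      then have "norm (X n \<omega>) powr q \<le> c" using norm_powr_le_lyap[of q "X n \<omega>"] q by linarith
      then have "(norm (X n \<omega>) powr q) powr (1 / q) \<le> c powr (1 / q)" using q by (intro powr_mono2) auto
      then show ?thesis using q by (simp add: powr_powr)
    qed
    then show "\<exists>k>0. T \<le> em_time f g \<delta> x0 (\<lambda>t. W t \<omega>) k"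
      unfolding X_def by (rule em_path.attained_if_bounded[OF em_path \<delta>_cont])
  qed
qed

definition Bridge where "Bridge n r \<omega> = em_path.bridge f g \<delta> x0 T (\<lambda>t. W t \<omega>) n r"

lemma Bridge_eq: "Bridge n r \<omega> = X n \<omega> + (r * H n \<omega>) *\<^sub>R f (X n \<omega>) + g (X n \<omega>) *v (W (S n \<omega> + r * H n \<omega>) \<omega> - W (S n \<omega>) \<omega>)"
  unfolding Bridge_def X_def H_def S_def by (rule em_path.bridge_def[OF em_path])

lemma continuous_W_in_step:
  assumes "\<omega> \<in> space M" shows "continuous_on {0..1} (\<lambda>r. W (S n \<omega> + r * H n \<omega>) \<omega>)"
  by (intro continuous_on_compose2[OF continuous_path[OF assms]] continuous_intros) (auto simp: S_nonneg H_nonneg)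

lemma continuous_Bridge: "\<omega> \<in> space M \<Longrightarrow> continuous_on {0..1} (\<lambda>r. Bridge n r \<omega>)"
  unfolding Bridge_eq
  by (intro continuous_intros continuous_W_in_step matrix_vector_mult_linear_continuous_on
       continuous_on_compose2[OF matrix_vector_mult_linear_continuous_on[of UNIV]]) auto

lemma measurable_W_in_step [measurable]:
  assumes "0 \<le> r" shows "(\<lambda>\<omega>. W (S n \<omega> + r * H n \<omega>) \<omega>) \<in> borel_measurable M"
proof -
  have rh: "(\<lambda>\<omega>. r * H n \<omega>) \<in> borel_measurable (pre_sigma (S n))" by measurable
  have \<tau>: "stopping_time F (\<lambda>\<omega>. S n \<omega> + r * H n \<omega>)"
    by (rule stopping_time_add[OF stopping_S rh]) (use H_nonneg assms in simp)
  show ?thesis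
    by (rule measurable_pre_sigma_M[OF \<tau> measurable_W_stopping_time[OF \<tau>]]) (use S_nonneg H_nonneg assms in simp)
qed

lemma measurable_W_at_grid [measurable]: "(\<lambda>\<omega>. W (S n \<omega>) \<omega>) \<in> borel_measurable M"
  using measurable_W_in_step[of 0 n] by simp

lemma measurable_Bridge: "0 \<le> r \<Longrightarrow> Bridge n r \<in> borel_measurable M"
  unfolding Bridge_eq[abs_def] by measurable

definition osc where "osc n \<omega> = (SUP r\<in>{0..1}. ennreal (norm (W (S n \<omega> + r * H n \<omega>) \<omega> - W (S n \<omega>) \<omega>) powr q))"
definition bridge_sup where "bridge_sup \<omega> = (SUP n. SUP r\<in>{0..1}. ennreal (norm (Bridge n r \<omega>) powr q))"

text \<open>By continuity the supremum may be taken over the countable set of dyadic points.\<close>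
lemma measurable_unit_SUP:
  fixes u :: "real \<Rightarrow> 'w \<Rightarrow> 'b :: {real_normed_vector, second_countable_topology}"
  assumes m: "\<And>r. 0 \<le> r \<Longrightarrow> u r \<in> borel_measurable M" and c: "\<And>\<omega>. \<omega> \<in> space M \<Longrightarrow> continuous_on {0..1} (\<lambda>r. u r \<omega>)"
  shows "(\<lambda>\<omega>. SUP r\<in>{0..1}. ennreal (norm (u r \<omega>) powr q)) \<in> borel_measurable M"
proof -
  define D where "D = (\<Union>j. (\<lambda>k. real k / 2 ^ j) ` {..2 ^ j::nat})"
  have "(\<lambda>\<omega>. SUP r\<in>D. ennreal (norm (u r \<omega>) powr q)) \<in> borel_measurable M"
  proof (rule borel_measurable_SUP)
    show "countable D" unfolding D_def by simp
    fix r assume "r \<in> D"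
    then have [measurable]: "u r \<in> borel_measurable M" by (intro m) (auto simp: D_def)
    show "(\<lambda>\<omega>. ennreal (norm (u r \<omega>) powr q)) \<in> borel_measurable M" by measurable
  qed
  moreover have "(SUP r\<in>{0..1}. ennreal (norm (u r \<omega>) powr q)) = (SUP r\<in>D. ennreal (norm (u r \<omega>) powr q))" if "\<omega> \<in> space M" for \<omega>
    unfolding D_def using q by (intro SUP_unit_interval_dyadic continuous_on_powr' continuous_on_norm c that continuous_on_const) auto
  ultimately show ?thesis by (simp cong: measurable_cong)
qed

lemma measurable_osc [measurable]: "osc n \<in> borel_measurable M"
  unfolding osc_def[abs_def]
  by (intro measurable_unit_SUP borel_measurable_diff measurable_W_in_step measurable_W_at_grid continuous_on_diff continuous_W_in_step continuous_on_const)

lemma measurable_bridge_sup [measurable]: "bridge_sup \<in> borel_measurable M"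
  unfolding bridge_sup_def[abs_def]
  by (intro borel_measurable_SUP measurable_unit_SUP measurable_Bridge continuous_Bridge) auto

text \<open>The three contributions are the value at the grid point, the drift over the step and the
  oscillation of the noise.\<close>
lemma Bridge_power_le:
  assumes r: "r \<in> {0..1}"
  shows "ennreal (norm (Bridge n r \<omega>) powr q) \<le> ennreal (3 powr q) * (ennreal (lyap q (X n \<omega>)) + (ennreal C * ennreal (occ n \<omega>) + ennreal (norm (g (X n \<omega>)) powr q) * osc n \<omega>))"
proof -
  define w where "w = W (S n \<omega> + r * H n \<omega>) \<omega> - W (S n \<omega>) \<omega>"
  have h: "0 \<le> occ n \<omega>" by (rule occ_nonneg)
  have "norm (Bridge n r \<omega>) \<le> norm (X n \<omega>) + norm ((r * H n \<omega>) *\<^sub>R f (X n \<omega>)) + norm (g (X n \<omega>) *v w)"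
    unfolding Bridge_eq w_def by (rule norm_triangle_le[OF add_mono[OF norm_triangle_ineq order_refl]])
  also have "\<dots> \<le> norm (X n \<omega>) + H n \<omega> * norm (f (X n \<omega>)) + norm (g (X n \<omega>)) * norm w"
  proof (intro add_mono order_refl norm_matrix_vector_le)
    have "r * (H n \<omega> * norm (f (X n \<omega>))) \<le> 1 * (H n \<omega> * norm (f (X n \<omega>)))" using r H_nonneg[of n \<omega>] by (intro mult_right_mono) auto
    then show "norm ((r * H n \<omega>) *\<^sub>R f (X n \<omega>)) \<le> H n \<omega> * norm (f (X n \<omega>))" using r H_nonneg[of n \<omega>] by (simp add: abs_mult mult.assoc)
  qed
  finally have "norm (Bridge n r \<omega>) powr q \<le> (norm (X n \<omega>) + H n \<omega> * norm (f (X n \<omega>)) + norm (g (X n \<omega>)) * norm w) powr q"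
    using q by (intro powr_mono2) auto
  also have "\<dots> \<le> 3 powr q * (norm (X n \<omega>) powr q + (H n \<omega> * norm (f (X n \<omega>))) powr q + (norm (g (X n \<omega>)) * norm w) powr q)"
    using q H_nonneg[of n \<omega>] by (intro powr_sum3_le) auto
  also have "\<dots> \<le> 3 powr q * (lyap q (X n \<omega>) + C * occ n \<omega> + norm (g (X n \<omega>)) powr q * norm w powr q)"
    unfolding occ_def using q by (intro mult_left_mono add_mono norm_powr_le_lyap drift_power H_admissible) (auto simp: powr_mult)
  finally have "ennreal (norm (Bridge n r \<omega>) powr q) \<le> ennreal (3 powr q * (lyap q (X n \<omega>) + C * occ n \<omega> + norm (g (X n \<omega>)) powr q * norm w powr q))"
    by (rule ennreal_leI)
  also have "\<dots> = ennreal (3 powr q) * (ennreal (lyap q (X n \<omega>)) + (ennreal C * ennreal (occ n \<omega>) + ennreal (norm (g (X n \<omega>)) powr q) * ennreal (norm w powr q)))"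
    using h C_nonneg less_imp_le[OF lyap_pos[of q "X n \<omega>"]] by (simp add: ennreal_mult ennreal_plus add.assoc)
  also have "\<dots> \<le> ennreal (3 powr q) * (ennreal (lyap q (X n \<omega>)) + (ennreal C * ennreal (occ n \<omega>) + ennreal (norm (g (X n \<omega>)) powr q) * osc n \<omega>))"
    unfolding osc_def w_def by (intro mult_left_mono add_left_mono SUP_upper r) auto
  finally show ?thesis .
qed

lemma osc_moment: "(\<integral>\<^sup>+\<omega>. ennreal (norm (g (X n \<omega>)) powr q) * osc n \<omega> \<partial>M) \<le> osc_const TYPE('m) q * (ennreal C * (\<integral>\<^sup>+\<omega>. ennreal (occ n \<omega>) \<partial>M))"
proof -
  have "(\<integral>\<^sup>+\<omega>. ennreal (norm (g (X n \<omega>)) powr q) * osc n \<omega> \<partial>M) \<le> osc_const TYPE('m) q * (\<integral>\<^sup>+\<omega>. ennreal (norm (g (X n \<omega>)) powr q) * ennreal (H n \<omega> powr (q / 2)) \<partial>M)"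
    unfolding osc_def by (rule increment_sup_moment[OF stopping_S S_nonneg adapted_H H_nonneg _ q]) measurable
  also have "\<dots> \<le> osc_const TYPE('m) q * (\<integral>\<^sup>+\<omega>. ennreal C * ennreal (occ n \<omega>) \<partial>M)"
  proof (intro mult_left_mono nn_integral_mono)
    fix \<omega>
    show "ennreal (norm (g (X n \<omega>)) powr q) * ennreal (H n \<omega> powr (q / 2)) \<le> ennreal C * ennreal (occ n \<omega>)"
      using diffusion_power[OF H_admissible, of n \<omega>, folded occ_def] C_nonneg by (simp add: ennreal_mult'[symmetric] ennreal_leI)
  qed simp
  also have "\<dots> = osc_const TYPE('m) q * (ennreal C * (\<integral>\<^sup>+\<omega>. ennreal (occ n \<omega>) \<partial>M))"
    by (subst nn_integral_cmult) measurable
  finally show ?thesis .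
qed

lemma occupation_suminf_le: "(\<Sum>n. \<integral>\<^sup>+\<omega>. ennreal (occ n \<omega>) \<partial>M) \<le> ennreal moment_bound"
  by (rule suminf_le_const[OF summableI occupation_le])

text \<open>The supremum over the steps is taken only of the values at the grid points; for the rest
  it is replaced by the sum over the steps, which the occupation bound controls.\<close>
lemma bridge_sup_moment:
  "(\<integral>\<^sup>+\<omega>. bridge_sup \<omega> \<partial>M) \<le> ennreal (3 powr q) * (ennreal sup_bound + (1 + osc_const TYPE('m) q) * (ennreal C * ennreal moment_bound))"
proof -
  define E where "E n = (\<integral>\<^sup>+\<omega>. ennreal (occ n \<omega>) \<partial>M)" for n
  define V where "V n \<omega> = ennreal C * ennreal (occ n \<omega>) + ennreal (norm (g (X n \<omega>)) powr q) * osc n \<omega>" for n \<omega>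
  have Vm [measurable]: "V n \<in> borel_measurable M" for n unfolding V_def by measurable
  have EV: "(\<integral>\<^sup>+\<omega>. V n \<omega> \<partial>M) \<le> (1 + osc_const TYPE('m) q) * (ennreal C * E n)" for n
  proof -
    have "(\<integral>\<^sup>+\<omega>. V n \<omega> \<partial>M) = (\<integral>\<^sup>+\<omega>. ennreal C * ennreal (occ n \<omega>) \<partial>M) + (\<integral>\<^sup>+\<omega>. ennreal (norm (g (X n \<omega>)) powr q) * osc n \<omega> \<partial>M)"
      unfolding V_def by (rule nn_integral_add) measurable
    also have "(\<integral>\<^sup>+\<omega>. ennreal C * ennreal (occ n \<omega>) \<partial>M) = ennreal C * E n"
      unfolding E_def by (rule nn_integral_cmult) measurable
    also have "ennreal C * E n + (\<integral>\<^sup>+\<omega>. ennreal (norm (g (X n \<omega>)) powr q) * osc n \<omega> \<partial>M) \<le> ennreal C * E n + osc_const TYPE('m) q * (ennreal C * E n)"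
      unfolding E_def by (intro add_left_mono osc_moment)
    finally show ?thesis by (simp add: distrib_right)
  qed
  have "(\<integral>\<^sup>+\<omega>. bridge_sup \<omega> \<partial>M) \<le> (\<integral>\<^sup>+\<omega>. ennreal (3 powr q) * ((SUP n. ennreal (lyap q (X n \<omega>))) + (\<Sum>n. V n \<omega>)) \<partial>M)"
    unfolding bridge_sup_def
  proof (intro nn_integral_mono SUP_least)
    fix \<omega> n and r :: real assume r: "r \<in> {0..1}"
    have "ennreal (norm (Bridge n r \<omega>) powr q) \<le> ennreal (3 powr q) * (ennreal (lyap q (X n \<omega>)) + V n \<omega>)"
      unfolding V_def by (rule Bridge_power_le[OF r])
    also have "\<dots> \<le> ennreal (3 powr q) * ((SUP n. ennreal (lyap q (X n \<omega>))) + (\<Sum>n. V n \<omega>))"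
    proof (intro mult_left_mono add_mono SUP_upper)
      show "V n \<omega> \<le> (\<Sum>n. V n \<omega>)" using sum_le_suminf[OF summableI, of "{n}" "\<lambda>n. V n \<omega>"] by simp
    qed auto
    finally show "ennreal (norm (Bridge n r \<omega>) powr q) \<le> ennreal (3 powr q) * ((SUP n. ennreal (lyap q (X n \<omega>))) + (\<Sum>n. V n \<omega>))" .
  qed
  also have "\<dots> = ennreal (3 powr q) * (\<integral>\<^sup>+\<omega>. (SUP n. ennreal (lyap q (X n \<omega>))) + (\<Sum>n. V n \<omega>) \<partial>M)"
    by (rule nn_integral_cmult) measurable
  also have "(\<integral>\<^sup>+\<omega>. (SUP n. ennreal (lyap q (X n \<omega>))) + (\<Sum>n. V n \<omega>) \<partial>M) = (\<integral>\<^sup>+\<omega>. (SUP n. ennreal (lyap q (X n \<omega>))) \<partial>M) + (\<integral>\<^sup>+\<omega>. (\<Sum>n. V n \<omega>) \<partial>M)"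
    by (rule nn_integral_add) measurable
  also have "(\<integral>\<^sup>+\<omega>. (\<Sum>n. V n \<omega>) \<partial>M) = (\<Sum>n. \<integral>\<^sup>+\<omega>. V n \<omega> \<partial>M)" by (rule nn_integral_suminf) measurable
  also have "ennreal (3 powr q) * ((\<integral>\<^sup>+\<omega>. (SUP n. ennreal (lyap q (X n \<omega>))) \<partial>M) + (\<Sum>n. \<integral>\<^sup>+\<omega>. V n \<omega> \<partial>M))
     \<le> ennreal (3 powr q) * (ennreal sup_bound + (1 + osc_const TYPE('m) q) * (ennreal C * ennreal moment_bound))"
  proof (intro mult_left_mono add_mono sup_grid_moment)
    have "(\<Sum>n. \<integral>\<^sup>+\<omega>. V n \<omega> \<partial>M) \<le> (\<Sum>n. (1 + osc_const TYPE('m) q) * (ennreal C * E n))"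
      by (intro suminf_le EV summableI)
    also have "\<dots> = (1 + osc_const TYPE('m) q) * (ennreal C * (\<Sum>n. E n))" by simp
    also have "\<dots> \<le> (1 + osc_const TYPE('m) q) * (ennreal C * ennreal moment_bound)"
      unfolding E_def by (intro mult_left_mono occupation_suminf_le) auto
    finally show "(\<Sum>n. \<integral>\<^sup>+\<omega>. V n \<omega> \<partial>M) \<le> (1 + osc_const TYPE('m) q) * (ennreal C * ennreal moment_bound)" .
  qed simp
  finally show ?thesis .
qed

lemma em_sup_pow_eq_bridge_sup: "AE \<omega> in M. bridge_sup \<omega> = em_sup_pow f g \<delta> x0 W T q \<omega>"
  using attained_AE
proof eventually_elim
  fix \<omega> assume "\<exists>k>0. T \<le> em_time f g \<delta> x0 (\<lambda>t. W t \<omega>) k"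
  then obtain k where "T \<le> em_time f g \<delta> x0 (\<lambda>t. W t \<omega>) k" by auto
  from em_path.Sup_Y_eq_Sup_bridge[OF em_path this, of "\<lambda>y. ennreal (norm y powr q)"]
  show "bridge_sup \<omega> = em_sup_pow f g \<delta> x0 W T q \<omega>" by (simp add: bridge_sup_def em_sup_pow_def Bridge_def)
qed

end

section \<open>Continuous versions and the main theorem\<close>

text \<open>Set the path to zero on the null set where it is discontinuous. The filtration contains
  all null sets, so the new process is still adapted, and negative indices are given the
  \<open>\<sigma>\<close>-algebra at time zero.\<close>
lemma brownian_motion_continuous_version:
  fixes W :: "real \<Rightarrow> 'w \<Rightarrow> real ^ 'm"
  assumes uc: "usual_conditions M F" and bm: "brownian_motion M F W"
  obtains N where "N \<in> null_sets M"
    and "bm_paths M (\<lambda>t. F (max 0 t)) (\<lambda>t \<omega>. if \<omega> \<in> N then 0 else W t \<omega>)"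
proof -
  interpret prob_space M using uc by (simp add: usual_conditions_def)
  interpret complete_measure M using uc by (simp add: usual_conditions_def)
  have sub: "subalgebra M (F t)" if "0 \<le> t" for t using uc that by (simp add: usual_conditions_def)
  have mono: "sets (F s) \<subseteq> sets (F t)" if "0 \<le> s" "s \<le> t" for s t
    using uc[unfolded usual_conditions_def] that by blast
  have null_F: "null_sets M \<subseteq> sets (F t)" if "0 \<le> t" for t
  proof -
    have "null_sets M \<subseteq> sets (F 0)" using uc[unfolded usual_conditions_def] by blast
    then show ?thesis using mono[OF order_refl that] by (rule order_trans)
  qed
  have space_F: "space (F t) = space M" if "0 \<le> t" for t using sub[OF that] by (simp add: subalgebra_def)
  have W: "W t \<in> borel_measurable (F t)" if "0 \<le> t" for t using bm that by (simp add: brownian_motion_def)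
  have "AE \<omega> in M. continuous_on {0..} (\<lambda>t. W t \<omega>)" using bm by (simp add: brownian_motion_def)
  then have N: "{\<omega> \<in> space M. \<not> continuous_on {0..} (\<lambda>t. W t \<omega>)} \<in> null_sets M"
    by (simp only: AE_iff_null_sets)
  define N where "N = {\<omega> \<in> space M. \<not> continuous_on {0..} (\<lambda>t. W t \<omega>)}"
  have N: "N \<in> null_sets M" using N by (simp only: N_def)
  define V where "V t \<omega> = (if \<omega> \<in> N then 0 else W t \<omega>)" for t \<omega>
  have V_F: "V t \<in> borel_measurable (F t)" if t: "0 \<le> t" for t
  proof -
    have [measurable]: "N \<in> sets (F t)" using N null_F[OF t] by auto
    note [measurable] = W[OF t]
    show ?thesis unfolding V_def by measurable
  qed
  have F_M: "f \<in> borel_measurable (F t) \<Longrightarrow> f \<in> borel_measurable M" if "0 \<le> t" for f :: "'w \<Rightarrow> real ^ 'm" and t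
    by (rule measurable_from_subalg[OF sub[OF that]])
  have V_M: "V t \<in> borel_measurable M" and W_M: "W t \<in> borel_measurable M" if "0 \<le> t" for t
    by (rule F_M[OF that V_F[OF that]] F_M[OF that W[OF that]])+
  have AE_eq: "AE \<omega> in M. V t \<omega> - V s \<omega> = W t \<omega> - W s \<omega>" for s t
    using AE_not_in[OF N] by eventually_elim (simp add: V_def)
  have "bm_paths M (\<lambda>t. F (max 0 t)) V"
  proof (rule bm_paths.intro, rule prob_space_axioms, rule bm_paths_axioms.intro)
    show "filtration (space M) (\<lambda>t. F (max 0 t))"
    proof
      show "space (F (max 0 t)) = space M" for t by (simp add: space_F)
      show "sets (F (max 0 s)) \<subseteq> sets (F (max 0 t))" if "s \<le> t" for s t using that by (intro mono) auto
    qed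
    show "sets (F (max 0 t)) \<subseteq> sets M" for t using sub[of "max 0 t"] by (simp add: subalgebra_def)
    show "V t \<in> borel_measurable (F (max 0 t))" if "0 \<le> t" for t using V_F[OF that] that by (simp add: max_absorb2)
    show "continuous_on {0..} (\<lambda>t. V t \<omega>)" if "\<omega> \<in> space M" for \<omega>
      using that by (cases "\<omega> \<in> N") (auto simp: V_def N_def)
  next
    fix s t :: real and A B assume st: "0 \<le> s" "s < t" and A: "A \<in> sets (F (max 0 s))" and B: "B \<in> sets (borel :: (real ^ 'm) measure)"
    have AF: "A \<in> sets (F s)" using A st by (simp add: max_absorb2)
    then have [measurable]: "A \<in> sets M" using sub[OF st(1)] by (auto simp: subalgebra_def)
    have [measurable]: "V s \<in> borel_measurable M" "V t \<in> borel_measurable M" "W s \<in> borel_measurable M" "W t \<in> borel_measurable M"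
      using st by (auto intro!: V_M W_M)
    note [measurable] = B
    have ind1: "indep_set (sets (F s)) (sets (vimage_algebra (space M) (\<lambda>\<omega>. W t \<omega> - W s \<omega>) borel))"
      using bm st by (simp add: brownian_motion_def)
    have ind2: "{\<omega> \<in> space M. W t \<omega> - W s \<omega> \<in> B} \<in> sets (vimage_algebra (space M) (\<lambda>\<omega>. W t \<omega> - W s \<omega>) borel)"
    proof -
      have "{\<omega> \<in> space M. W t \<omega> - W s \<omega> \<in> B} = (\<lambda>\<omega>. W t \<omega> - W s \<omega>) -` B \<inter> space M" by auto
      then show ?thesis using in_vimage_algebra[OF B, of "\<lambda>\<omega>. W t \<omega> - W s \<omega>" "space M"] by simp
    qed
    have ind: "prob (A \<inter> {\<omega> \<in> space M. W t \<omega> - W s \<omega> \<in> B}) = prob A * prob {\<omega> \<in> space M. W t \<omega> - W s \<omega> \<in> B}"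
      by (rule indep_setD[OF ind1 AF ind2])
    have "prob (A \<inter> {\<omega> \<in> space M. V t \<omega> - V s \<omega> \<in> B}) = prob (A \<inter> {\<omega> \<in> space M. W t \<omega> - W s \<omega> \<in> B})"
      using AE_eq[of t s] by (intro finite_measure_eq_AE) auto
    moreover have "prob {\<omega> \<in> space M. V t \<omega> - V s \<omega> \<in> B} = prob {\<omega> \<in> space M. W t \<omega> - W s \<omega> \<in> B}"
      using AE_eq[of t s] by (intro finite_measure_eq_AE) auto
    ultimately show "prob (A \<inter> {\<omega> \<in> space M. V t \<omega> - V s \<omega> \<in> B}) = prob A * prob {\<omega> \<in> space M. V t \<omega> - V s \<omega> \<in> B}"
      using ind by simp
  next
    fix s t :: real assume st: "0 \<le> s" "s < t"
    have [measurable]: "V s \<in> borel_measurable M" "V t \<in> borel_measurable M" "W s \<in> borel_measurable M" "W t \<in> borel_measurable M"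
      using st by (auto intro!: V_M W_M)
    have "distr M borel (\<lambda>\<omega>. V t \<omega> - V s \<omega>) = distr M borel (\<lambda>\<omega>. W t \<omega> - W s \<omega>)"
      using AE_eq[of t s] by (intro distr_cong_AE) auto
    also have "\<dots> = distr std_gauss borel (\<lambda>z. sqrt (t - s) *\<^sub>R z)"
      using bm st by (intro gaussian_vector_law) (auto simp: brownian_motion_def)
    finally show "distr M borel (\<lambda>\<omega>. V t \<omega> - V s \<omega>) = distr std_gauss borel (\<lambda>z. sqrt (t - s) *\<^sub>R z)" .
  qed
  then show thesis using that[OF N] by (simp add: V_def[abs_def])
qed

lemma (in complete_measure) borel_measurable_AE_eq:
  assumes u: "u \<in> M \<rightarrow>\<^sub>M N" and ae: "AE \<omega> in M. u \<omega> = v \<omega>" and v: "\<And>\<omega>. \<omega> \<in> space M \<Longrightarrow> v \<omega> \<in> space N"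
  shows "v \<in> M \<rightarrow>\<^sub>M N"
proof (rule measurableI)
  fix A assume A: "A \<in> sets N"
  show "v -` A \<inter> space M \<in> sets M"
  proof (rule in_sets_AE)
    show "AE \<omega> in M. \<omega> \<in> u -` A \<inter> space M \<longleftrightarrow> \<omega> \<in> v -` A \<inter> space M" using ae by eventually_elim auto
  qed (use measurable_sets[OF u A] in auto)
qed (rule v)

lemma continuous_on_if_locally_lipschitz:
  fixes f :: "'a :: real_normed_vector \<Rightarrow> 'b :: real_normed_vector"
  assumes lip: "\<And>R x y. 0 < R \<Longrightarrow> norm x \<le> R \<Longrightarrow> norm y \<le> R \<Longrightarrow> norm (f x - f y) \<le> C R * norm (x - y)"
  shows "continuous_on UNIV f"
proof (rule continuous_at_imp_continuous_on, rule ballI)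
  fix x
  have "(\<lambda>y. f y - f x) \<midarrow>x\<rightarrow> 0"
  proof (rule Lim_null_comparison)
    have "\<forall>\<^sub>F y in at x. dist y x < 1" by (intro eventually_at_topological[THEN iffD2] exI[of _ "ball x 1"]) (auto simp: dist_commute)
    then show "\<forall>\<^sub>F y in at x. norm (f y - f x) \<le> C (norm x + 1) * norm (y - x)"
    proof eventually_elim
      fix y assume "dist y x < 1"
      then have "norm y \<le> norm x + 1" using norm_triangle_ineq2[of y x] by (simp add: dist_norm)
      then show "norm (f y - f x) \<le> C (norm x + 1) * norm (y - x)" by (intro lip add_nonneg_pos) auto
    qed
    have "(\<lambda>y. C (norm x + 1) * norm (y - x)) \<midarrow>x\<rightarrow> C (norm x + 1) * norm (x - x)" by (intro tendsto_intros)
    then show "(\<lambda>y. C (norm x + 1) * norm (y - x)) \<midarrow>x\<rightarrow> 0" by simp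
  qed
  then show "isCont f x" unfolding isCont_def by (simp add: LIM_zero_iff)
qed

theorem theorem3p5:
  fixes x0 :: "real ^ 'd"
    and p l T K1 K2 K3 \<gamma> :: real
    and CR :: "real \<Rightarrow> real"
  assumes "\<forall>R>0. CR R > 0"
    and "p \<ge> 2" and "K1 \<ge> 0" and "K2 \<ge> 0"
    and "l > 2" and "K3 > 0"
    and "0 < \<gamma>" and "\<gamma> \<le> 1 / 3"
    and "p > l"
    and "T > 0"
  shows "\<exists>C_T>0.
    \<forall>(M :: 'w measure) F (W :: real \<Rightarrow> 'w \<Rightarrow> real ^ 'm)
      (f :: real ^ 'd \<Rightarrow> real ^ 'd) (g :: real ^ 'd \<Rightarrow> real ^ 'm ^ 'd) (\<delta> :: real ^ 'd \<Rightarrow> real).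
      usual_conditions M F \<longrightarrow>
      brownian_motion M F W \<longrightarrow>
      (\<forall>R>0. \<forall>x y. max (norm x) (norm y) \<le> R \<longrightarrow>
         norm (f x - f y) + norm (g x - g y) \<le> CR R * norm (x - y)) \<longrightarrow>
      (\<forall>x. x \<bullet> f x + (p - 1) / 2 * (norm (g x))\<^sup>2 \<le> K1 * (norm x)\<^sup>2 + K2) \<longrightarrow>
      (\<forall>x. (norm (g x))\<^sup>2 \<le> K3 * (1 + norm x powr l)) \<longrightarrow>
      (\<forall>x. \<delta> x > 0) \<longrightarrow>
      continuous_on UNIV \<delta> \<longrightarrow>
      (\<forall>x. norm (f x) * \<delta> x powr \<gamma> \<le> 1 + norm x) \<longrightarrow>
      (\<forall>x. (norm (g x))\<^sup>2 * \<delta> x powr \<gamma> \<le> (1 + norm x)\<^sup>2) \<longrightarrow>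
        as_attainable M f g \<delta> x0 W T \<and>
        em_sup_pow f g \<delta> x0 W T (p + 2 - l) \<in> borel_measurable M \<and>
        (\<integral>\<^sup>+ \<omega>. em_sup_pow f g \<delta> x0 W T (p + 2 - l) \<omega> \<partial>M) \<le> ennreal C_T"
proof -
  define q where "q = p + 2 - l"
  define B where "B = 2 * (1 + T)\<^sup>2"
  have q: "2 < q" "q \<le> p" and B: "0 \<le> B" using assms by (auto simp: q_def B_def)
  obtain C1 where C1: "0 \<le> C1" "\<forall>y fv (gv :: real^'m^'d) h k. em_step y fv gv h k B \<longrightarrow>
    y \<bullet> fv + (p - 1) / 2 * (norm gv)\<^sup>2 \<le> K1 * (norm y)\<^sup>2 + K2 \<longrightarrow>
    (LINT z|std_gauss. lyap p (y + em_step.incr fv gv h z)) \<le> lyap p y * (1 + C1 * h)"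
    using exists_growth_const[of p p K1 K2 B, OF _ order_refl assms(2-4) B] assms by auto
  obtain C2 where C2: "0 \<le> C2" "\<forall>y fv (gv :: real^'m^'d) h k. em_step y fv gv h k B \<longrightarrow>
    y \<bullet> fv + (p - 1) / 2 * (norm gv)\<^sup>2 \<le> K1 * (norm y)\<^sup>2 + K2 \<longrightarrow>
    (LINT z|std_gauss. lyap (q / 2) (y + em_step.incr fv gv h z)) \<le> lyap (q / 2) y * (1 + C2 * h)"
    using exists_growth_const[of "q / 2" p K1 K2 B, OF _ _ assms(2-4) B] q by auto
  obtain C3 where C3: "0 \<le> C3" "\<forall>y fv (gv :: real^'m^'d) h k. em_step y fv gv h k B \<longrightarrow>
    (norm gv)\<^sup>2 \<le> K3 * (1 + norm y powr l) \<longrightarrow>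
    (LINT z|std_gauss. (lyap (q / 2) (y + em_step.incr fv gv h z) - lyap (q / 2) y)\<^sup>2) \<le> C3 * (lyap p y * h)"
    using exists_fluctuation_const[of "q / 2" p l K3 B, OF _ _ _ _ B] assms q by (auto simp: q_def)
  define C4 where "C4 = B powr q * (B ^ 3) powr (q / 2 - 1)"
  define C5 where "C5 = 2 * K3 * (B\<^sup>2) powr (q - 2)"
  define C where "C = C1 + C2 + C3 + C4 + C5"
  have Cge: "0 \<le> C" "C1 \<le> C" "C2 \<le> C" "C3 \<le> C" "C4 \<le> C" "C5 \<le> C"
    using C1(1) C2(1) C3(1) assms by (auto simp: C_def C4_def C5_def)
  define bound where "bound = ennreal (3 powr q) * (ennreal (em_chain.sup_bound x0 T p q C) + (1 + osc_const TYPE('m) q) * (ennreal C * ennreal (em_chain.moment_bound x0 T p C)))"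
  have fin: "bound < \<infinity>"
    unfolding bound_def using osc_const_finite[where 'm='m, of q] q by (auto simp: ennreal_mult_less_top ennreal_add_less_top)
  define C_T where "C_T = enn2real bound + 1"
  have C_T: "0 < C_T" "bound \<le> ennreal C_T"
    using fin enn2real_nonneg[of bound] by (auto simp: C_T_def ennreal_enn2real_if intro: add_nonneg_pos)
  show ?thesis
  proof (intro exI[of _ C_T] conjI C_T(1) allI impI)
    fix M :: "'w measure" and F and W :: "real \<Rightarrow> 'w \<Rightarrow> real ^ 'm"
      and f :: "real ^ 'd \<Rightarrow> real ^ 'd" and g :: "real ^ 'd \<Rightarrow> real ^ 'm ^ 'd" and \<delta> :: "real ^ 'd \<Rightarrow> real"
    assume uc: "usual_conditions M F" and bm: "brownian_motion M F W"
      and lip: "\<forall>R>0. \<forall>x y. max (norm x) (norm y) \<le> R \<longrightarrow> norm (f x - f y) + norm (g x - g y) \<le> CR R * norm (x - y)"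
      and mono: "\<forall>x. x \<bullet> f x + (p - 1) / 2 * (norm (g x))\<^sup>2 \<le> K1 * (norm x)\<^sup>2 + K2"
      and gl: "\<forall>x. (norm (g x))\<^sup>2 \<le> K3 * (1 + norm x powr l)"
      and \<delta>: "\<forall>x. \<delta> x > 0" "continuous_on UNIV \<delta>"
      and f\<delta>: "\<forall>x. norm (f x) * \<delta> x powr \<gamma> \<le> 1 + norm x"
      and g\<delta>: "\<forall>x. (norm (g x))\<^sup>2 * \<delta> x powr \<gamma> \<le> (1 + norm x)\<^sup>2"
    interpret prob_space M using uc by (simp add: usual_conditions_def)
    interpret complete_measure M using uc by (simp add: usual_conditions_def)
    obtain N where N: "N \<in> null_sets M"
      and bmp: "bm_paths M (\<lambda>t. F (max 0 t)) (\<lambda>t \<omega>. if \<omega> \<in> N then 0 else W t \<omega>)"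
      by (rule brownian_motion_continuous_version[OF uc bm])
    define V where "V t \<omega> = (if \<omega> \<in> N then 0 else W t \<omega>)" for t \<omega>
    interpret V: bm_paths M "\<lambda>t. F (max 0 t)" V using bmp by (simp add: V_def[abs_def])
    have step: "em_step y (f y) (g y) h (h powr (1 / 3)) B" if "0 \<le> h" "h \<le> \<delta> y" "h \<le> T" for y h
      unfolding B_def by (rule em_step_of_timestep[OF assms(7,8) that f\<delta>[rule_format] g\<delta>[rule_format]])
    have up: "c * h \<le> C * h" "c * (lyap p y * h) \<le> C * (lyap p y * h)" if "c \<le> C" "0 \<le> h" for c h and y :: "real ^ 'd"
      using that less_imp_le[OF lyap_pos[of p y]] by (auto intro!: mult_right_mono)
    have up': "lyap b y * (1 + c * h) \<le> lyap b y * (1 + C * h)" if "c \<le> C" "0 \<le> h" for c h b and y :: "real ^ 'd"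
      using up(1)[OF that] less_imp_le[OF lyap_pos[of b y]] by (intro mult_left_mono) auto
    interpret em_chain M "\<lambda>t. F (max 0 t)" V f g \<delta> x0 T p q B C
    proof (rule em_chain.intro, rule V.bm_paths_axioms, rule em_chain_axioms.intro)
      have fl: "norm (f x - f y) \<le> CR R * norm (x - y)" "norm (g x - g y) \<le> CR R * norm (x - y)" if "0 < R" "norm x \<le> R" "norm y \<le> R" for R x y
      proof -
        have "norm (f x - f y) + norm (g x - g y) \<le> CR R * norm (x - y)" using lip that by simp
        then show "norm (f x - f y) \<le> CR R * norm (x - y)" "norm (g x - g y) \<le> CR R * norm (x - y)"
          using norm_ge_zero[of "f x - f y"] norm_ge_zero[of "g x - g y"] by linarith+
      qed
      show "continuous_on UNIV f" "continuous_on UNIV g"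
        by (rule continuous_on_if_locally_lipschitz[OF fl(1)] continuous_on_if_locally_lipschitz[OF fl(2)]; assumption)+
      fix y :: "real ^ 'd" and h assume h: "0 \<le> h" "h \<le> \<delta> y" "h \<le> T"
      note s = step[OF h]
      show "em_step y (f y) (g y) h (h powr (1 / 3)) B" by (rule s)
      show "(LINT z|std_gauss. lyap p (y + em_step.incr (f y) (g y) h z)) \<le> lyap p y * (1 + C * h)"
        by (rule order_trans[OF C1(2)[rule_format, OF s] up'[OF Cge(2) h(1)]]) (use mono in blast)
      show "(LINT z|std_gauss. lyap (q / 2) (y + em_step.incr (f y) (g y) h z)) \<le> lyap (q / 2) y * (1 + C * h)"
        by (rule order_trans[OF C2(2)[rule_format, OF s] up'[OF Cge(3) h(1)]]) (use mono in blast)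
      show "(LINT z|std_gauss. (lyap (q / 2) (y + em_step.incr (f y) (g y) h z) - lyap (q / 2) y)\<^sup>2) \<le> C * (lyap p y * h)"
        by (rule order_trans[OF C3(2)[rule_format, OF s] up(2)[OF Cge(4) h(1)]]) (use gl in blast)
      show "(h * norm (f y)) powr q \<le> C * (lyap p y * h)"
        using em_step.drift_power_le[OF s _ q(2)] q up(2)[OF Cge(5) h(1), of y] by (simp add: C4_def)
      show "norm (g y) powr q * h powr (q / 2) \<le> C * (lyap p y * h)"
        using em_step.diffusion_power_le[OF s _ q_def, of K3] gl q assms up(2)[OF Cge(6) h(1), of y] by (simp add: C5_def)
    qed (use \<delta> assms q Cge in auto)
    \<comment> \<open>The scheme is computed from the path alone, so it is almost surely the same for both
      versions.\<close>
    have same_path: "AE \<omega> in M. (\<lambda>t. V t \<omega>) = (\<lambda>t. W t \<omega>)"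
      using AE_not_in[OF N] by eventually_elim (simp add: V_def)
    have "AE \<omega> in M. bridge_sup \<omega> = em_sup_pow f g \<delta> x0 W T q \<omega>"
      using em_sup_pow_eq_bridge_sup same_path by eventually_elim (simp add: em_sup_pow_def)
    note ae = this
    show "em_sup_pow f g \<delta> x0 W T (p + 2 - l) \<in> borel_measurable M"
      unfolding q_def[symmetric] by (rule borel_measurable_AE_eq[OF measurable_bridge_sup ae]) simp
    have "(\<integral>\<^sup>+\<omega>. em_sup_pow f g \<delta> x0 W T q \<omega> \<partial>M) = (\<integral>\<^sup>+\<omega>. bridge_sup \<omega> \<partial>M)"
    proof (rule nn_integral_cong_AE)
      show "AE \<omega> in M. em_sup_pow f g \<delta> x0 W T q \<omega> = bridge_sup \<omega>" using ae by eventually_elim (rule sym)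
    qed
    also have "\<dots> \<le> bound" unfolding bound_def by (rule bridge_sup_moment)
    finally show "(\<integral>\<^sup>+\<omega>. em_sup_pow f g \<delta> x0 W T (p + 2 - l) \<omega> \<partial>M) \<le> ennreal C_T"
      using C_T(2) by (simp add: q_def[symmetric])
    have att: "AE \<omega> in M. \<exists>k>0. T \<le> em_time f g \<delta> x0 (\<lambda>t. W t \<omega>) k"
      using attained_AE same_path by eventually_elim simp
    have ms: "{\<omega> \<in> space M. \<exists>k>0. T \<le> em_time f g \<delta> x0 (\<lambda>t. W t \<omega>) k} \<in> sets M"
    proof (rule in_sets_AE[OF _ sets.top])
      show "AE \<omega> in M. \<omega> \<in> space M \<longleftrightarrow> \<omega> \<in> {\<omega> \<in> space M. \<exists>k>0. T \<le> em_time f g \<delta> x0 (\<lambda>t. W t \<omega>) k}"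
        using att by eventually_elim simp
    qed (rule Collect_restrict)
    show "as_attainable M f g \<delta> x0 W T"
      unfolding as_attainable_def by (simp only: prob_Collect_eq_1[OF ms] att)
  qed
qed

end
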